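(* For $1\le s,q<\infty$, the quotient space $\mathrm{IDA}^{s,q}/H(\mathbb{C}^n)$ is a Banach space with the norm induced by $\|\cdot\|_{\mathrm{IDA}^{s,q}}$, that is, with $\|f+H(\mathbb{C}^n)\|=\|f\|_{\mathrm{IDA}^{s,q}}$ for $f\in\mathrm{IDA}^{s,q}$.
   Context: $v$ is Lebesgue measure on $\mathbb{C}^n$; $B(z,r)=\{w\in\mathbb{C}^n:|w-z|<r\}$; $H(\Omega)$ is the set of holomorphic functions on $\Omega$; $L^s=L^s(\mathbb{C}^n,dv)$. For $0<q<\infty$, $r>0$, $f\in L^q_{\mathrm{loc}}(\mathbb{C}^n)$, $G_{q,r}(f)(z)=\inf_{h\in H(B(z,r))}\left(\frac1{|B(z,r)|}\int_{B(z,r)}|f-h|^qdv\right)^{1/q}$. For $0<s\le\infty$, $\mathrm{IDA}^{s,q}$ is the set of $f\in L^q_{\mathrm{loc}}$ with $\|f\|_{\mathrm{IDA}^{s,q}}=\|G_{q,1}(f)\|_{L^s}<\infty$. *)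

theory Defs
  imports
    "HOL-Analysis.Analysis"
    "HOL-Algebra.Module"
    "HOL-Algebra.AbelCoset"
    "HOL-Algebra.Algebraic_Closure_Type"
begin

section \<open>Complex Banach spaces on a carrier\<close>

locale complex_normed_space = module "ring_of_type_algebra :: complex ring" M
  for M :: "(complex, 'a, 'm) module_scheme" (structure) +
  fixes \<nu> :: "'a \<Rightarrow> real"
  assumes norm_nonneg: "x \<in> carrier M \<Longrightarrow> 0 \<le> \<nu> x"
    and norm_eq_zero: "x \<in> carrier M \<Longrightarrow> \<nu> x = 0 \<longleftrightarrow> x = \<zero>\<^bsub>M\<^esub>"
    and norm_smult: "x \<in> carrier M \<Longrightarrow> \<nu> (c \<odot>\<^bsub>M\<^esub> x) = cmod c * \<nu> x"
    and norm_triangle: "x \<in> carrier M \<Longrightarrow> y \<in> carrier M \<Longrightarrow> \<nu> (x \<oplus>\<^bsub>M\<^esub> y) \<le> \<nu> x + \<nu> y"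

text \<open>The value 0 outside the carrier is irrelevant; it is there because \<^locale>\<open>Metric_space\<close>
  requires a distance that is nonnegative and symmetric on the whole type.\<close>

definition norm_dist :: "(complex, 'a, 'm) module_scheme \<Rightarrow> ('a \<Rightarrow> real) \<Rightarrow> 'a \<Rightarrow> 'a \<Rightarrow> real" where
  "norm_dist M \<nu> x y =
     (if x \<in> carrier M \<and> y \<in> carrier M then \<nu> (x \<ominus>\<^bsub>M\<^esub> y) else 0)"

lemma (in complex_normed_space) norm_uminus:
  assumes x: "x \<in> carrier M"
  shows "\<nu> (\<ominus>\<^bsub>M\<^esub> x) = \<nu> x"
proof -
  let ?R = "ring_of_type_algebra :: complex ring"
  have R: "carrier ?R = UNIV" "\<And>a b. a \<oplus>\<^bsub>?R\<^esub> b = a + b" "\<one>\<^bsub>?R\<^esub> = 1"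
    by (simp_all add: ring_of_type_algebra_def)
  have "(0::complex) \<odot>\<^bsub>M\<^esub> x \<oplus>\<^bsub>M\<^esub> 0 \<odot>\<^bsub>M\<^esub> x = 0 \<odot>\<^bsub>M\<^esub> x"
    using smult_l_distr[of 0 0 x] x by (simp add: R)
  moreover have c: "(a::complex) \<odot>\<^bsub>M\<^esub> x \<in> carrier M" for a
    using x by (simp add: R smult_closed)
  ultimately have "(0::complex) \<odot>\<^bsub>M\<^esub> x = \<zero>\<^bsub>M\<^esub>"
    using M.add.l_cancel_one' by metis
  moreover have "(- 1) \<odot>\<^bsub>M\<^esub> x \<oplus>\<^bsub>M\<^esub> 1 \<odot>\<^bsub>M\<^esub> x = (0::complex) \<odot>\<^bsub>M\<^esub> x"
    using smult_l_distr[of "-1" 1 x] x by (simp add: R)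
  ultimately have "\<ominus>\<^bsub>M\<^esub> x = (- 1) \<odot>\<^bsub>M\<^esub> x"
    using smult_one[OF x] x c by (metis M.minus_equality R(3))
  then show ?thesis by (simp add: norm_smult x)
qed

lemma (in complex_normed_space) Metric_space_norm_dist:
  "Metric_space (carrier M) (norm_dist M \<nu>)"
proof
  fix x y show "0 \<le> norm_dist M \<nu> x y" by (simp add: norm_dist_def norm_nonneg)
next
  fix x y
  have "\<nu> (x \<ominus>\<^bsub>M\<^esub> y) = \<nu> (y \<ominus>\<^bsub>M\<^esub> x)" if "x \<in> carrier M" "y \<in> carrier M"
    using norm_uminus[of "x \<ominus>\<^bsub>M\<^esub> y"] that
    by (simp add: M.minus_eq M.minus_add M.a_comm)
  then show "norm_dist M \<nu> x y = norm_dist M \<nu> y x" by (simp add: norm_dist_def)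
next
  fix x y assume *: "x \<in> carrier M" "y \<in> carrier M"
  have "x = y" if "x \<ominus>\<^bsub>M\<^esub> y = \<zero>\<^bsub>M\<^esub>"
    using M.minus_equality[of x "\<ominus>\<^bsub>M\<^esub> y"] that * by (simp add: M.minus_eq)
  moreover have "y \<ominus>\<^bsub>M\<^esub> y = \<zero>\<^bsub>M\<^esub>"
    using * by (simp add: M.minus_eq M.r_neg)
  ultimately show "norm_dist M \<nu> x y = 0 \<longleftrightarrow> x = y"
    using * by (auto simp add: norm_dist_def norm_eq_zero)
next
  fix x y z assume *: "x \<in> carrier M" "y \<in> carrier M" "z \<in> carrier M"
  have "x \<ominus>\<^bsub>M\<^esub> z = (x \<ominus>\<^bsub>M\<^esub> y) \<oplus>\<^bsub>M\<^esub> (y \<ominus>\<^bsub>M\<^esub> z)"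
    using * by (simp add: M.minus_eq M.a_assoc M.r_neg1)
  then show "norm_dist M \<nu> x z \<le> norm_dist M \<nu> x y + norm_dist M \<nu> y z"
    using * norm_triangle[of "x \<ominus>\<^bsub>M\<^esub> y" "y \<ominus>\<^bsub>M\<^esub> z"] by (simp add: norm_dist_def)
qed

locale complex_banach_space = complex_normed_space +
  assumes complete: "Metric_space.mcomplete (carrier M) (norm_dist M \<nu>)"


section \<open>Quotient modules\<close>

text \<open>The multiplicative fields of the record play no role in a module.\<close>

definition quotient_module ::
    "('c, 'a, 'm) module_scheme \<Rightarrow> 'a set \<Rightarrow> ('c, 'a set) module" where
  "quotient_module M N =
     \<lparr>carrier = a_rcosets\<^bsub>M\<^esub> N, mult = undefined, one = undefined,
      zero = N, add = (\<lambda>A B. A <+>\<^bsub>M\<^esub> B),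
      smult = (\<lambda>c A. \<Union>x\<in>A. N +>\<^bsub>M\<^esub> (c \<odot>\<^bsub>M\<^esub> x))\<rparr>"


section \<open>Holomorphic functions of several variables\<close>

text \<open>For open \<open>\<Omega>\<close>: complex Frechet differentiability at every point, i.e. the real
  derivative exists and is complex-linear.\<close>

definition holomorphic_funs :: "(complex ^ 'n) set \<Rightarrow> (complex ^ 'n \<Rightarrow> complex) set" where
  "holomorphic_funs \<Omega> =
     {h. \<forall>z\<in>\<Omega>. \<exists>D. (h has_derivative D) (at z) \<and> (\<forall>c v. D (c *s v) = c * D v)}"


section \<open>The spaces IDA\<close>

text \<open>Power with positive exponent \<open>a\<close>, with \<open>\<infinity>\<close> mapped to itself.\<close>

definition ennreal_powr :: "ennreal \<Rightarrow> real \<Rightarrow> ennreal" where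
  "ennreal_powr x a = (if x = \<infinity> then \<infinity> else ennreal (enn2real x powr a))"

definition Lloc :: "real \<Rightarrow> (complex ^ 'n \<Rightarrow> complex) set" where
  "Lloc q = {f \<in> borel_measurable lebesgue.
     \<forall>K. compact K \<longrightarrow> (\<integral>\<^sup>+w\<in>K. ennreal (cmod (f w) powr q) \<partial>lebesgue) < \<infinity>}"

definition IDA_G :: "real \<Rightarrow> real \<Rightarrow> (complex ^ 'n \<Rightarrow> complex) \<Rightarrow> complex ^ 'n \<Rightarrow> ennreal" where
  "IDA_G q r f z = (INF h\<in>holomorphic_funs (ball z r).
     ennreal_powr ((\<integral>\<^sup>+w\<in>ball z r. ennreal (cmod (f w - h w) powr q) \<partial>lebesgue)
       / emeasure lebesgue (ball z r)) (1 / q))"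

definition ida_enorm :: "real \<Rightarrow> real \<Rightarrow> (complex ^ 'n \<Rightarrow> complex) \<Rightarrow> ennreal" where
  "ida_enorm s q f = ennreal_powr (\<integral>\<^sup>+z. ennreal_powr (IDA_G q 1 f z) s \<partial>lebesgue) (1 / s)"

definition IDA :: "real \<Rightarrow> real \<Rightarrow> (complex ^ 'n \<Rightarrow> complex) set" where
  "IDA s q = {f \<in> Lloc q. ida_enorm s q f < \<infinity>}"

definition ida_norm :: "real \<Rightarrow> real \<Rightarrow> (complex ^ 'n \<Rightarrow> complex) \<Rightarrow> real" where
  "ida_norm s q f = enn2real (ida_enorm s q f)"

definition IDA_module :: "real \<Rightarrow> real \<Rightarrow> (complex, complex ^ 'n \<Rightarrow> complex) module" where
  "IDA_module s q =
     \<lparr>carrier = IDA s q, mult = undefined, one = undefined,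
      zero = (\<lambda>z. 0), add = (\<lambda>f g z. f z + g z), smult = (\<lambda>c f z. c * f z)\<rparr>"

text \<open>Elements of \<^const>\<open>Lloc\<close> are functions, not classes modulo null sets. Identifying
  functions that agree almost everywhere is built into the subspace that is divided out: it
  consists of all representatives of entire functions, so two functions get identified iff
  their difference is almost everywhere equal to an entire function.\<close>

definition entire_ae :: "(complex ^ 'n \<Rightarrow> complex) set" where
  "entire_ae = {f. \<exists>h\<in>holomorphic_funs UNIV. AE z in lebesgue. f z = h z}"

definition IDA_quotient ::
    "real \<Rightarrow> real \<Rightarrow> (complex, (complex ^ 'n \<Rightarrow> complex) set) module" where
  "IDA_quotient s q = quotient_module (IDA_module s q) entire_ae"

text \<open>The common value of \<^const>\<open>ida_norm\<close> on the members of a coset.\<close>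

definition ida_quotient_norm :: "real \<Rightarrow> real \<Rightarrow> (complex ^ 'n \<Rightarrow> complex) set \<Rightarrow> real" where
  "ida_quotient_norm s q A = the_elem (ida_norm s q ` A)"

end

theory Submission
  imports Defs "HOL-Complex_Analysis.Complex_Analysis"
begin

text \<open>
  \<open>IDA_G q 1 f z\<close> is the distance of \<open>f\<close> from the holomorphic functions in the normalised
  \<open>L\<^sup>q\<close> norm of the unit ball about \<open>z\<close>, and \<open>ida_enorm s q f\<close> is the \<open>L\<^sup>s\<close> norm of this distance as a
  function of \<open>z\<close>. Two applications of Minkowski's inequality therefore make it a seminorm, once the
  distance is known to be measurable in \<open>z\<close>. It is upper semicontinuous (\<open>open_IDA_G_less\<close>): if
  \<open>h\<close> is nearly optimal on a ball, then a slight dilation of \<open>h\<close> is nearly as good and is holomorphic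
  on a larger ball, so it also serves for the neighbouring balls. If the seminorm of \<open>f\<close> vanishes,
  then \<open>f\<close> is almost everywhere equal to a holomorphic function on a dense set of unit balls, and
  these functions agree on overlaps; hence the kernel consists of the representatives of entire
  functions.

  The substance is completeness. It suffices to treat a sequence with
  \<open>ida_enorm s q (f (k + 1) - f k) \<le> 1 / 2 ^ k\<close>. Put \<open>D k = f (k + 1) - f k\<close>. For almost every \<open>z\<close> the
  distances \<open>IDA_G q 1 (D k) z\<close> have a finite sum, and there are holomorphic \<open>h k\<close> on the unit ball
  about \<open>z\<close> for which the norm of \<open>D k - h k\<close> is at most twice that distance. So
  \<open>\<Phi> z = f 0 + (\<Sum>k. D k - h k)\<close> converges in \<open>L\<^sup>q\<close> of the ball. On the overlap of two balls the difference
  of two such limits is a series of holomorphic functions that converges in \<open>L\<^sup>q\<close>, hence locally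
  uniformly by the mean value inequality, and so it is holomorphic. A limit of the sequence is a
  single function \<open>F\<close> such that \<open>F - \<Phi> z\<close> is holomorphic on every one of these balls. To find it is to
  solve an additive Cousin problem on the whole space (\<open>exists_global_gluing\<close>).

  The Cousin problem is solved in two steps. Solutions on two boxes with a common face are merged
  after their difference, which is holomorphic near the face, has been written as a sum of
  functions that are holomorphic near one box each (\<open>additive_splitting\<close>); this splitting is Cauchy's
  integral formula for a rectangle in one coordinate, whose four edges are shared out between the
  two boxes. Starting from boxes that fit into a single ball, this gives a solution on every bounded
  box. Solutions on an increasing sequence of balls are then made to converge by subtracting entire
  functions that approximate their differences (\<open>entire_approximation\<close>), as in the Mittag-Leffler theorem.

  The theory of several complex variables enters through one criterion, \<open>holomorphic_funsI_lines\<close>: a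
  continuous function on an open set is complex Frechet differentiable if its restriction to every
  complex line is holomorphic. It reduces locally uniform limits and parameter integrals to one
  variable.
\<close>

(* Below, top is the greatest extended nonnegative real and $ the component of a vector. *)
hide_const (open) Order.top
no_notation fps_nth (infixl \<open>$\<close> 75)

section \<open>Minkowski's inequality for functions with values in [0, \<infinity>]\<close>

lemma ennreal_powr_ennreal [simp]: "0 \<le> x \<Longrightarrow> ennreal_powr (ennreal x) a = ennreal (x powr a)"
  by (simp add: ennreal_powr_def)

lemma ennreal_powr_top [simp]: "ennreal_powr top a = top"
  by (simp add: ennreal_powr_def)

lemma ennreal_powr_0 [simp]: "ennreal_powr 0 a = 0"
  by (simp add: ennreal_powr_def)

lemma ennreal_powr_mono:
  assumes "0 < a" "x \<le> y" shows "ennreal_powr x a \<le> ennreal_powr y a"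
  using assms by (cases x; cases y) (auto simp: powr_mono2 top_unique)

lemma ennreal_powr_powr:
  assumes "0 < a" "0 < b" shows "ennreal_powr (ennreal_powr x a) b = ennreal_powr x (a * b)"
  using assms by (cases x) (auto simp: powr_powr)

lemma ennreal_powr_one [simp]: "ennreal_powr x 1 = x"
  by (cases x) auto

lemma ennreal_powr_inverse:
  assumes "0 < a"
  shows "ennreal_powr (ennreal_powr x a) (1 / a) = x" "ennreal_powr (ennreal_powr x (1 / a)) a = x"
  using assms by (simp_all add: ennreal_powr_powr)

lemma ennreal_powr_eq_0_iff [simp]: "ennreal_powr x a = 0 \<longleftrightarrow> x = 0"
  by (cases x) auto

lemma ennreal_powr_eq_top_iff [simp]: "ennreal_powr x a = top \<longleftrightarrow> x = top"
  by (cases x) auto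

lemma ennreal_powr_less_top_iff [simp]: "ennreal_powr x a < top \<longleftrightarrow> x < top"
  by (simp add: less_top[symmetric])

text \<open>For a positive exponent the power is an order isomorphism of \<open>[0, \<infinity>]\<close>, so inequalities between
  norms become inequalities between integrals.\<close>

lemma ennreal_powr_le_iff:
  assumes "0 < a" shows "ennreal_powr x (1 / a) \<le> y \<longleftrightarrow> x \<le> ennreal_powr y a"
  using ennreal_powr_mono[of a "ennreal_powr x (1/a)" y] ennreal_powr_mono[of "1/a" x "ennreal_powr y a"] assms
  by (auto simp: ennreal_powr_inverse)

lemma ennreal_powr_less_iff:
  assumes "0 < a" shows "ennreal_powr x (1 / a) < y \<longleftrightarrow> x < ennreal_powr y a"
  using ennreal_powr_le_iff[of "1/a" y x] assms by (metis divide_divide_eq_right mult.left_neutral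
    div_by_1 linorder_not_less zero_less_divide_1_iff)

lemma ennreal_powr_mult:
  assumes "0 < a" shows "ennreal_powr (x * y) a = ennreal_powr x a * ennreal_powr y a"
proof (cases "x = 0 \<or> y = 0")
  case False
  then show ?thesis using assms
    by (cases x; cases y) (auto simp: ennreal_mult_top ennreal_top_mult powr_mult ennreal_mult'[symmetric])
qed auto

lemma ennreal_powr_SUP:
  assumes a: "0 < a" and ne: "I \<noteq> {}"
  shows "ennreal_powr (SUP i\<in>I. f i) a = (SUP i\<in>I. ennreal_powr (f i) a)"
proof (rule antisym)
  have "f i \<le> ennreal_powr (SUP i\<in>I. ennreal_powr (f i) a) (1 / a)" if "i \<in> I" for i
    using ennreal_powr_mono[of "1/a", OF _ SUP_upper[OF that, of "\<lambda>i. ennreal_powr (f i) a"]] a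
    by (simp add: ennreal_powr_inverse)
  then have "(SUP i\<in>I. f i) \<le> ennreal_powr (SUP i\<in>I. ennreal_powr (f i) a) (1 / a)"
    by (rule SUP_least)
  from ennreal_powr_mono[OF a this] a
  show "ennreal_powr (SUP i\<in>I. f i) a \<le> (SUP i\<in>I. ennreal_powr (f i) a)"
    by (simp add: ennreal_powr_inverse)
qed (auto intro!: SUP_least ennreal_powr_mono SUP_upper a)

lemma ennreal_powr_measurable [measurable]:
  assumes [measurable]: "f \<in> borel_measurable M"
  shows "(\<lambda>x. ennreal_powr (f x) a) \<in> borel_measurable M"
  unfolding ennreal_powr_def by measurable

text \<open>Functions with values in \<open>[0, \<infinity>]\<close> cover both norms that occur: \<open>ida_enorm\<close> is such a norm of the
  function \<open>IDA_G q 1 f\<close>, which may take the value \<open>\<infinity>\<close>.\<close>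

definition Lp_enorm :: "'a measure \<Rightarrow> real \<Rightarrow> ('a \<Rightarrow> ennreal) \<Rightarrow> ennreal" where
  "Lp_enorm M p u = ennreal_powr (\<integral>\<^sup>+x. ennreal_powr (u x) p \<partial>M) (1 / p)"

lemma Lp_enorm_le_iff:
  "0 < p \<Longrightarrow> Lp_enorm M p u \<le> c \<longleftrightarrow> (\<integral>\<^sup>+x. ennreal_powr (u x) p \<partial>M) \<le> ennreal_powr c p"
  unfolding Lp_enorm_def by (rule ennreal_powr_le_iff)

lemma Lp_enorm_mono_AE:
  assumes "0 < p" "AE x in M. u x \<le> v x" shows "Lp_enorm M p u \<le> Lp_enorm M p v"
  unfolding Lp_enorm_def using assms
  by (auto intro!: ennreal_powr_mono nn_integral_mono_AE elim!: eventually_mono)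

lemma Lp_enorm_cong_AE:
  assumes "AE x in M. u x = v x" shows "Lp_enorm M p u = Lp_enorm M p v"
  unfolding Lp_enorm_def using assms
  by (intro arg_cong2[where f=ennreal_powr] nn_integral_cong_AE) (auto elim!: eventually_mono)

lemma Lp_enorm_cmult:
  assumes "0 < p" and [measurable]: "u \<in> borel_measurable M"
  shows "Lp_enorm M p (\<lambda>x. c * u x) = c * Lp_enorm M p u"
  using assms(1) by (simp add: Lp_enorm_def ennreal_powr_mult nn_integral_cmult ennreal_powr_inverse)

lemma Lp_enorm_eq_0_iff:
  assumes "0 < p" and [measurable]: "u \<in> borel_measurable M"
  shows "Lp_enorm M p u = 0 \<longleftrightarrow> (AE x in M. u x = 0)"
  by (simp add: Lp_enorm_def nn_integral_0_iff_AE)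

lemma Lp_enorm_finite_AE:
  assumes "0 < p" and [measurable]: "u \<in> borel_measurable M" and "Lp_enorm M p u < top"
  shows "AE x in M. u x < top"
proof -
  have "AE x in M. ennreal_powr (u x) p \<noteq> \<infinity>"
    using assms(3) by (intro nn_integral_PInf_AE) (auto simp: Lp_enorm_def)
  then show ?thesis by (auto elim!: eventually_mono simp: less_top)
qed

text \<open>Convexity of \<open>x powr p\<close>, applied to \<open>x / A\<close> and \<open>y / B\<close> with the weights \<open>A / (A + B)\<close> and
  \<open>B / (A + B)\<close>. When \<open>A\<close> and \<open>B\<close> are the norms of two functions, integrating this inequality is the
  proof of Minkowski's inequality.\<close>

lemma powr_add_le_weighted:
  fixes x y A B p :: real
  assumes p: "1 \<le> p" and "0 < A" "0 < B" and "0 \<le> x" "0 \<le> y"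
  shows "(x + y) powr p \<le> (A + B) powr (p - 1) * A powr (1 - p) * x powr p
     + (A + B) powr (p - 1) * B powr (1 - p) * y powr p"
proof -
  have *: "(t * a + (1 - t) * b) powr p \<le> t * a powr p + (1 - t) * b powr p"
    if t: "0 < t" "t < 1" and ab: "0 \<le> a" "0 \<le> b" for t a b :: real
  proof -
    have t1: "t powr p \<le> t" "(1 - t) powr p \<le> 1 - t"
      using powr_mono'[of 1 p t] powr_mono'[of 1 p "1-t"] p t by simp_all
    consider "a = 0" | "b = 0" | "0 < a" "0 < b" using ab by linarith
    then show ?thesis
    proof cases
      case 1 then show ?thesis using ab t t1 mult_right_mono[OF t1(2), of "b powr p"] by (simp add: powr_mult)
    next
      case 2 then show ?thesis using ab t t1 mult_right_mono[OF t1(1), of "a powr p"] by (simp add: powr_mult)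
    next
      case 3 then show ?thesis using convex_onD[OF powr_convex[OF p], of t b a] t by (simp add: algebra_simps)
    qed
  qed
  define t where "t = A / (A + B)"
  have t: "0 < t" "t < 1" "1 - t = B / (A + B)" using assms by (auto simp: t_def field_simps)
  have "x + y = (A + B) * (t * (x / A) + (1 - t) * (y / B))"
    unfolding t(3) using assms add_pos_pos[of A B] by (simp add: t_def distrib_left)
  then have "(x + y) powr p = (A + B) powr p * (t * (x / A) + (1 - t) * (y / B)) powr p"
    using assms t by (simp add: powr_mult)
  also have "\<dots> \<le> (A + B) powr p * (t * (x / A) powr p + (1 - t) * (y / B) powr p)"
    using assms t by (intro mult_left_mono *) auto
  also have "\<dots> = (A + B) powr p * (A / (A + B) * (x powr p / A powr p) + B / (A + B) * (y powr p / B powr p))"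
    unfolding t(3) using assms by (simp add: t_def powr_divide)
  also have "\<dots> = (A + B) powr (p - 1) * A powr (1 - p) * x powr p
     + (A + B) powr (p - 1) * B powr (1 - p) * y powr p"
    using assms by (simp add: powr_diff field_simps)
  finally show ?thesis .
qed

lemma Lp_enorm_add:
  assumes p: "1 \<le> p" and [measurable]: "u \<in> borel_measurable M" "v \<in> borel_measurable M"
  shows "Lp_enorm M p (\<lambda>x. u x + v x) \<le> Lp_enorm M p u + Lp_enorm M p v"
proof -
  have main: "Lp_enorm M p (\<lambda>x. u x + v x) \<le> ennreal A + ennreal B"
    if AB: "0 < A" "0 < B" and u: "Lp_enorm M p u \<le> ennreal A" and v: "Lp_enorm M p v \<le> ennreal B" for A B
  proof -
    define a where "a = (A + B) powr (p - 1) * A powr (1 - p)"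
    define b where "b = (A + B) powr (p - 1) * B powr (1 - p)"
    have ab: "0 < a" "0 < b" using AB by (auto simp: a_def b_def)
    have pt: "ennreal_powr (u x + v x) p \<le> ennreal a * ennreal_powr (u x) p + ennreal b * ennreal_powr (v x) p" for x
    proof (cases "u x"; cases "v x")
      fix r s assume "0 \<le> r" "0 \<le> s" "u x = ennreal r" "v x = ennreal s"
      with powr_add_le_weighted[OF p AB, of r s] ab show ?thesis
        by (simp add: a_def[symmetric] b_def[symmetric] ennreal_mult'[symmetric] ennreal_plus[symmetric] del: ennreal_plus)
    qed (use ab in \<open>auto simp: ennreal_mult_top\<close>)
    have "(\<integral>\<^sup>+x. ennreal_powr (u x + v x) p \<partial>M) \<le>
      (\<integral>\<^sup>+x. ennreal a * ennreal_powr (u x) p + ennreal b * ennreal_powr (v x) p \<partial>M)"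
      by (intro nn_integral_mono pt)
    also have "\<dots> = ennreal a * (\<integral>\<^sup>+x. ennreal_powr (u x) p \<partial>M) + ennreal b * (\<integral>\<^sup>+x. ennreal_powr (v x) p \<partial>M)"
      by (simp add: nn_integral_add nn_integral_cmult)
    also have "\<dots> \<le> ennreal a * ennreal_powr (ennreal A) p + ennreal b * ennreal_powr (ennreal B) p"
      using u v p by (intro add_mono mult_left_mono) (auto simp: Lp_enorm_le_iff)
    also have "\<dots> = ennreal (a * A powr p + b * B powr p)"
      using AB ab by (simp add: ennreal_mult'[symmetric])
    also have "a * A powr p + b * B powr p = (A + B) powr (p - 1) * (A powr (1 - p) * A powr p + B powr (1 - p) * B powr p)"
      by (simp add: a_def b_def algebra_simps)
    also have "\<dots> = (A + B) powr p"
      using AB by (simp add: powr_add[symmetric]) (simp add: powr_diff)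
    also have "ennreal ((A + B) powr p) = ennreal_powr (ennreal A + ennreal B) p"
      using AB by (simp add: ennreal_plus[symmetric] del: ennreal_plus)
    finally show ?thesis using p by (simp add: Lp_enorm_le_iff)
  qed
  show ?thesis
  proof (cases "Lp_enorm M p u"; cases "Lp_enorm M p v")
    fix a b assume ab: "0 \<le> a" "0 \<le> b" "Lp_enorm M p u = ennreal a" "Lp_enorm M p v = ennreal b"
    \<comment> \<open>The weights in the main estimate need positive bounds, and either norm may be 0.\<close>
    show ?thesis
    proof (rule ennreal_le_epsilon)
      fix e :: real assume "0 < e"
      have "Lp_enorm M p (\<lambda>x. u x + v x) \<le> ennreal (a + e/2) + ennreal (b + e/2)"
        using ab \<open>0 < e\<close> by (intro main) (auto intro: ennreal_leI)
      also have "\<dots> = Lp_enorm M p u + Lp_enorm M p v + ennreal e"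
        using ab \<open>0 < e\<close> by (simp add: ennreal_plus[symmetric] del: ennreal_plus)
      finally show "Lp_enorm M p (\<lambda>x. u x + v x) \<le> Lp_enorm M p u + Lp_enorm M p v + ennreal e" .
    qed
  qed auto
qed

lemma Lp_enorm_sum:
  assumes p: "1 \<le> p" and u: "\<And>j. u j \<in> borel_measurable M"
  shows "Lp_enorm M p (\<lambda>x. \<Sum>j<n::nat. u j x) \<le> (\<Sum>j<n. Lp_enorm M p (u j))"
proof (induction n)
  case (Suc n)
  have "Lp_enorm M p (\<lambda>x. \<Sum>j<Suc n. u j x) \<le> Lp_enorm M p (\<lambda>x. \<Sum>j<n. u j x) + Lp_enorm M p (u n)"
    using Lp_enorm_add[OF p borel_measurable_sum[OF u] u] by simp
  with Suc show ?case by (simp add: add.commute) (meson add_left_mono order_trans)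
qed (simp add: Lp_enorm_def)

text \<open>Monotone convergence carries Minkowski's inequality over from finite sums.\<close>

lemma Lp_enorm_suminf:
  assumes p: "1 \<le> p" and u [measurable]: "\<And>j::nat. u j \<in> borel_measurable M"
  shows "Lp_enorm M p (\<lambda>x. \<Sum>j. u j x) \<le> (\<Sum>j. Lp_enorm M p (u j))"
proof -
  have p0: "0 < p" using p by simp
  have "(\<integral>\<^sup>+x. ennreal_powr (\<Sum>j. u j x) p \<partial>M) = (\<integral>\<^sup>+x. (SUP n. ennreal_powr (\<Sum>j<n. u j x) p) \<partial>M)"
    by (simp add: suminf_eq_SUP ennreal_powr_SUP p0)
  also have "\<dots> = (SUP n. \<integral>\<^sup>+x. ennreal_powr (\<Sum>j<n. u j x) p \<partial>M)"
    by (intro nn_integral_monotone_convergence_SUP)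
       (auto intro!: incseq_SucI le_funI ennreal_powr_mono p0)
  also have "\<dots> \<le> ennreal_powr (\<Sum>j. Lp_enorm M p (u j)) p"
  proof (rule SUP_least)
    fix n
    have "Lp_enorm M p (\<lambda>x. \<Sum>j<n. u j x) \<le> (\<Sum>j. Lp_enorm M p (u j))"
      by (rule order_trans[OF Lp_enorm_sum[OF p u] sum_le_suminf]) auto
    then show "(\<integral>\<^sup>+x. ennreal_powr (\<Sum>j<n. u j x) p \<partial>M) \<le> ennreal_powr (\<Sum>j. Lp_enorm M p (u j)) p"
      by (simp add: Lp_enorm_le_iff p0)
  qed
  finally show ?thesis by (simp add: Lp_enorm_le_iff p0)
qed

text \<open>On a probability space the norms increase with the exponent. The proof integrates Young's
  inequality \<open>p * u / A \<le> (u / A) powr p + (p - 1)\<close>, where \<open>A\<close> is any bound for the norm.\<close>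

lemma nn_integral_le_Lp_enorm:
  assumes p: "1 \<le> p" and M: "emeasure M (space M) = 1" and [measurable]: "u \<in> borel_measurable M"
  shows "(\<integral>\<^sup>+x. u x \<partial>M) \<le> Lp_enorm M p u"
proof -
  have p0: "0 < p" using p by simp
  have main: "(\<integral>\<^sup>+x. u x \<partial>M) \<le> ennreal A" if A: "0 < A" "Lp_enorm M p u \<le> ennreal A" for A
  proof -
    have pt: "ennreal p * u x \<le> ennreal (A powr (1 - p)) * ennreal_powr (u x) p + ennreal ((p - 1) * A)" for x
    proof (cases "u x")
      case (real r)
      have "p * (r / A) \<le> (r / A) powr p + (p - 1)"
      proof (cases "r = 0")
        case False
        then show ?thesis
          using Youngs_inequality_0[of "1/p" "1 - 1/p" "(r / A) powr p" 1] p p0 A real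
          by (simp add: powr_powr field_simps)
      qed (use p in auto)
      then have "A * (p * (r / A)) \<le> A * ((r / A) powr p + (p - 1))"
        using A by (intro mult_left_mono) auto
      then have "p * r \<le> A powr (1 - p) * r powr p + (p - 1) * A"
        using A real by (simp add: powr_divide powr_diff algebra_simps)
      then show ?thesis using real p A
        by (simp add: ennreal_mult'[symmetric] ennreal_plus[symmetric] del: ennreal_plus)
    qed (use A in \<open>auto simp: ennreal_mult_top\<close>)
    have "ennreal p * (\<integral>\<^sup>+x. u x \<partial>M) = (\<integral>\<^sup>+x. ennreal p * u x \<partial>M)"
      by (simp add: nn_integral_cmult)
    also have "\<dots> \<le> (\<integral>\<^sup>+x. ennreal (A powr (1 - p)) * ennreal_powr (u x) p + ennreal ((p - 1) * A) \<partial>M)"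
      by (intro nn_integral_mono pt)
    also have "\<dots> = ennreal (A powr (1 - p)) * (\<integral>\<^sup>+x. ennreal_powr (u x) p \<partial>M) + ennreal ((p - 1) * A)"
      by (simp add: nn_integral_add nn_integral_cmult M)
    also have "\<dots> \<le> ennreal (A powr (1 - p)) * ennreal_powr (ennreal A) p + ennreal ((p - 1) * A)"
      using A by (intro add_mono mult_left_mono) (auto simp: Lp_enorm_le_iff p0)
    also have "\<dots> = ennreal p * ennreal A"
      using A p by (simp add: ennreal_mult'[symmetric] powr_add[symmetric] ennreal_plus[symmetric] algebra_simps del: ennreal_plus)
    finally show ?thesis using p0 
      by (simp add: ennreal_mult_le_mult_iff)
  qed
  show ?thesis
  proof (cases "Lp_enorm M p u")
    case (real a)
    show ?thesis
    proof (rule ennreal_le_epsilon)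
      fix e :: real assume "0 < e"
      then show "(\<integral>\<^sup>+x. u x \<partial>M) \<le> Lp_enorm M p u + ennreal e"
        using main[of "a + e"] real by (simp add: ennreal_leI)
    qed
  qed auto
qed

section \<open>Holomorphic functions of several variables and complex lines\<close>

lemma norm_vector_scalar_mult: "norm (c *s v) = cmod c * norm (v :: complex ^ 'n)"
  by (simp add: norm_vec_def L2_set_def norm_mult power_mult_distrib sum_distrib_left[symmetric] real_sqrt_mult)

lemma bounded_linear_vector_scalar_mult: "bounded_linear (\<lambda>c. c *s (v :: complex ^ 'n))"
  by (rule bounded_linear_intro[where K="norm v"])
     (simp_all add: norm_vector_scalar_mult vec_eq_iff algebra_simps)

lemma has_derivative_complex_line:
  "((\<lambda>c. z + c *s (v :: complex ^ 'n)) has_derivative (\<lambda>c. c *s v)) (at c within S)"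
  by (auto intro!: derivative_eq_intros bounded_linear.has_derivative[OF bounded_linear_vector_scalar_mult])

lemma continuous_on_complex_line [continuous_intros]:
  "continuous_on S f \<Longrightarrow> continuous_on S g \<Longrightarrow> continuous_on S (\<lambda>x. f x *s (g x :: complex ^ 'n))"
  unfolding continuous_on_def
  by (intro ballI vec_tendstoI) (simp add: tendsto_mult tendsto_vec_nth)

lemma open_complex_line: "open \<Omega> \<Longrightarrow> open {c. z + c *s v \<in> (\<Omega> :: (complex ^ 'n) set)}"
  using open_vimage[of \<Omega> "\<lambda>c. z + c *s v"]
  by (simp add: vimage_def continuous_on_complex_line continuous_on_add)

lemma scaleR_eq_vector_scalar_mult: "t *\<^sub>R (v :: complex ^ 'n) = complex_of_real t *s v"
  unfolding vec_eq_iff by (simp add: scaleR_conv_of_real[where 'a=complex])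

lemma holomorphic_funs_imp_continuous_on: "h \<in> holomorphic_funs \<Omega> \<Longrightarrow> continuous_on \<Omega> h"
  unfolding holomorphic_funs_def
  by (blast intro: continuous_at_imp_continuous_on has_derivative_continuous)

lemma holomorphic_funs_subset: "h \<in> holomorphic_funs \<Omega> \<Longrightarrow> \<Omega>' \<subseteq> \<Omega> \<Longrightarrow> h \<in> holomorphic_funs \<Omega>'"
  unfolding holomorphic_funs_def by auto

lemma holomorphic_funs_const: "(\<lambda>z. c) \<in> holomorphic_funs \<Omega>"
  unfolding holomorphic_funs_def by (auto intro!: exI[of _ "\<lambda>v. 0"] derivative_eq_intros)

lemma holomorphic_funs_add:
  assumes "f \<in> holomorphic_funs \<Omega>" "g \<in> holomorphic_funs \<Omega>"
  shows "(\<lambda>z. f z + g z) \<in> holomorphic_funs \<Omega>"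
  unfolding holomorphic_funs_def
proof (intro CollectI ballI)
  fix z assume "z \<in> \<Omega>"
  with assms obtain D E where "(f has_derivative D) (at z)" "\<forall>c v. D (c *s v) = c * D v"
    "(g has_derivative E) (at z)" "\<forall>c v. E (c *s v) = c * E v"
    unfolding holomorphic_funs_def by blast
  then show "\<exists>D. ((\<lambda>z. f z + g z) has_derivative D) (at z) \<and> (\<forall>c v. D (c *s v) = c * D v)"
    by (intro exI[of _ "\<lambda>v. D v + E v"]) (auto intro!: derivative_eq_intros simp: algebra_simps)
qed

lemma holomorphic_funs_cmult:
  assumes "f \<in> holomorphic_funs \<Omega>" shows "(\<lambda>z. a * f z) \<in> holomorphic_funs \<Omega>"
  unfolding holomorphic_funs_def
proof (intro CollectI ballI)
  fix z assume "z \<in> \<Omega>"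
  with assms obtain D where "(f has_derivative D) (at z)" "\<forall>c v. D (c *s v) = c * D v"
    unfolding holomorphic_funs_def by blast
  then show "\<exists>D. ((\<lambda>z. a * f z) has_derivative D) (at z) \<and> (\<forall>c v. D (c *s v) = c * D v)"
    by (intro exI[of _ "\<lambda>v. a * D v"]) (auto intro!: derivative_eq_intros simp: algebra_simps)
qed

lemma holomorphic_funs_diff:
  assumes "f \<in> holomorphic_funs \<Omega>" "g \<in> holomorphic_funs \<Omega>"
  shows "(\<lambda>z. f z - g z) \<in> holomorphic_funs \<Omega>"
  using holomorphic_funs_add[OF assms(1) holomorphic_funs_cmult[OF assms(2), of "-1"]] by simp

lemma holomorphic_funs_sum:
  "(\<And>j. j \<in> I \<Longrightarrow> f j \<in> holomorphic_funs \<Omega>) \<Longrightarrow> (\<lambda>z. \<Sum>j\<in>I. f j z) \<in> holomorphic_funs \<Omega>"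
  by (induction I rule: infinite_finite_induct) (auto intro: holomorphic_funs_add holomorphic_funs_const)

text \<open>Holomorphy is local, so definitions by cases on open sets may be checked piecewise.\<close>

lemma holomorphic_funs_local:
  assumes "\<And>z. z \<in> \<Omega> \<Longrightarrow> \<exists>U g. open U \<and> z \<in> U \<and> g \<in> holomorphic_funs U \<and> (\<forall>w\<in>U. f w = g w)"
  shows "f \<in> holomorphic_funs \<Omega>"
  unfolding holomorphic_funs_def
proof (intro CollectI ballI)
  fix z assume "z \<in> \<Omega>"
  then obtain U g where U: "open U" "z \<in> U" "g \<in> holomorphic_funs U" "\<forall>w\<in>U. f w = g w"
    using assms by blast
  then obtain D where D: "(g has_derivative D) (at z)" "\<forall>c v. D (c *s v) = c * D v"
    unfolding holomorphic_funs_def by blast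
  have "(f has_derivative D) (at z)"
    by (rule has_derivative_transform_within_open[OF D(1) U(1,2)]) (use U(4) in auto)
  with D(2) show "\<exists>D. (f has_derivative D) (at z) \<and> (\<forall>c v. D (c *s v) = c * D v)" by blast
qed

lemma holomorphic_funs_along_line:
  assumes h: "h \<in> holomorphic_funs \<Omega>"
  shows "(\<lambda>c. h (z + c *s v)) holomorphic_on {c. z + c *s v \<in> \<Omega>}"
  unfolding holomorphic_on_def field_differentiable_def
proof (intro ballI)
  fix c assume "c \<in> {c. z + c *s v \<in> \<Omega>}"
  then obtain D where D: "(h has_derivative D) (at (z + c *s v))" "\<forall>a u. D (a *s u) = a * D u"
    using h unfolding holomorphic_funs_def by blast
  have "((\<lambda>c. h (z + c *s v)) has_derivative (\<lambda>d. D (d *s v))) (at c within {c. z + c *s v \<in> \<Omega>})"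
    using has_derivative_compose[OF has_derivative_complex_line[of z v] D(1)] .
  then show "\<exists>f'. ((\<lambda>c. h (z + c *s v)) has_field_derivative f') (at c within {c. z + c *s v \<in> \<Omega>})"
    by (intro exI[of _ "D v"]) (simp add: has_field_derivative_def D(2) mult_commute_abs)
qed

lemma holomorphic_funs_dilate:
  assumes h: "h \<in> holomorphic_funs \<Omega>"
  shows "(\<lambda>w. h (z + t *\<^sub>R (w - z))) \<in> holomorphic_funs {w. z + t *\<^sub>R (w - z) \<in> \<Omega>}"
  unfolding holomorphic_funs_def
proof (intro CollectI ballI)
  fix w assume "w \<in> {w. z + t *\<^sub>R (w - z) \<in> \<Omega>}"
  then obtain D where D: "(h has_derivative D) (at (z + t *\<^sub>R (w - z)))" "\<forall>a u. D (a *s u) = a * D u"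
    using h unfolding holomorphic_funs_def by blast
  have "((\<lambda>w. z + t *\<^sub>R (w - z)) has_derivative (\<lambda>v. t *\<^sub>R v)) (at w)"
    by (auto intro!: derivative_eq_intros)
  from has_derivative_compose[OF this D(1)]
  show "\<exists>D. ((\<lambda>w. h (z + t *\<^sub>R (w - z))) has_derivative D) (at w) \<and> (\<forall>c v. D (c *s v) = c * D v)"
    using D(2) by (intro exI[of _ "\<lambda>v. D (t *\<^sub>R v)"])
      (metis (no_types, lifting) scaleR_eq_vector_scalar_mult mult.left_commute)
qed

text \<open>The derivative along the complex line through \<open>z\<close> in direction \<open>v\<close>. It is the candidate for the
  Frechet derivative.\<close>

definition line_deriv :: "(complex ^ 'n \<Rightarrow> complex) \<Rightarrow> complex ^ 'n \<Rightarrow> complex ^ 'n \<Rightarrow> complex" where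
  "line_deriv h z v = deriv (\<lambda>c. h (z + c *s v)) 0"

context
  fixes h :: "complex ^ 'n \<Rightarrow> complex" and \<Omega> :: "(complex ^ 'n) set"
  assumes op: "open \<Omega>" and cont: "continuous_on \<Omega> h"
    and line: "\<And>z v. (\<lambda>c. h (z + c *s v)) holomorphic_on {c. z + c *s v \<in> \<Omega>}"
begin

lemma DERIV_line_deriv:
  assumes "z + c *s v \<in> \<Omega>"
  shows "((\<lambda>c. h (z + c *s v)) has_field_derivative line_deriv h (z + c *s v) v) (at c)"
proof -
  have "((\<lambda>d. h (z + c *s v + d *s v)) has_field_derivative line_deriv h (z + c *s v) v) (at 0)"
    unfolding line_deriv_def using assms
    by (intro holomorphic_derivI[OF line open_complex_line[OF op]]) auto
  then have "((\<lambda>d. h (z + (c + d) *s v)) has_field_derivative line_deriv h (z + c *s v) v) (at 0)"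
    by (simp add: add.assoc vector_add_ldistrib vector_sadd_rdistrib)
  then show ?thesis
    using DERIV_shift[of "\<lambda>c. h (z + c *s v)" "line_deriv h (z + c *s v) v" 0 c] by (simp add: add.commute)
qed

lemma line_deriv_scale:
  assumes "z \<in> \<Omega>" shows "line_deriv h z (a *s v) = a * line_deriv h z v"
proof -
  have "((\<lambda>c. h (z + c *s v)) has_field_derivative line_deriv h z v) (at (0 * a))"
    using DERIV_line_deriv[of z 0 v] assms by simp
  moreover have "((\<lambda>c. c * a) has_field_derivative a) (at 0)"
    by (auto intro!: derivative_eq_intros)
  ultimately have "((\<lambda>c. h (z + (c * a) *s v)) has_field_derivative line_deriv h z v * a) (at 0)"
    by (rule DERIV_chain2)
  then have "((\<lambda>c. h (z + c *s (a *s v))) has_field_derivative line_deriv h z v * a) (at 0)"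
    by (simp add: vector_smult_assoc)
  then show ?thesis by (simp add: line_deriv_def DERIV_imp_deriv)
qed

text \<open>Cauchy's estimate on a disc in the line bounds the difference of two derivatives by the difference
  of the function along the two lines, which is small by uniform continuity. The bound is first proved
  for unit vectors and then extended by homogeneity, so it is uniform in the direction.\<close>

lemma line_deriv_close:
  assumes z: "z \<in> \<Omega>" and e: "0 < e"
  shows "\<exists>d>0. ball z d \<subseteq> \<Omega> \<and> (\<forall>w\<in>ball z d. \<forall>v. cmod (line_deriv h w v - line_deriv h z v) \<le> e * norm v)"
proof -
  obtain r where r: "0 < r" "cball z r \<subseteq> \<Omega>"
    using op z open_contains_cball by blast
  define \<rho> where "\<rho> = r / 2"
  have "uniformly_continuous_on (cball z r) h"
    using r cont by (intro compact_uniformly_continuous) (auto intro: continuous_on_subset)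
  then obtain d where d: "0 < d" "\<And>x y. x \<in> cball z r \<Longrightarrow> y \<in> cball z r \<Longrightarrow> dist y x < d \<Longrightarrow> dist (h y) (h x) < e * \<rho>"
    unfolding uniformly_continuous_on_def using r e by (metis \<rho>_def half_gt_zero mult_pos_pos)
  define d' where "d' = min d \<rho>"
  have d': "0 < d'" "d' \<le> d" "d' \<le> \<rho>" using d r by (auto simp: d'_def \<rho>_def)
  have sub: "ball z d' \<subseteq> cball z r" using d' r by (auto simp: \<rho>_def)
  have unit: "cmod (line_deriv h w v - line_deriv h z v) \<le> e" if w: "w \<in> ball z d'" and v: "norm v = 1" for w v
  proof -
    have in_r: "w + c *s v \<in> cball z r" "z + c *s v \<in> cball z r" if "cmod c \<le> \<rho>" for c
    proof -
      have "dist z (w + c *s v) \<le> dist z w + norm (c *s v)"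
        by (metis dist_triangle_le add_left_mono dist_commute dist_norm add_diff_cancel_left' order_refl)
      then show "w + c *s v \<in> cball z r" using w d' that v by (auto simp: norm_vector_scalar_mult \<rho>_def)
      show "z + c *s v \<in> cball z r" using that v r by (simp add: dist_norm norm_vector_scalar_mult \<rho>_def)
    qed
    have hol: "(\<lambda>c. h (w + c *s v) - h (z + c *s v)) holomorphic_on cball 0 \<rho>"
      by (intro holomorphic_on_diff holomorphic_on_subset[OF line]) (use in_r r in auto)
    have "cmod ((deriv ^^ 1) (\<lambda>c. h (w + c *s v) - h (z + c *s v)) 0) \<le> fact 1 * (e * \<rho>) / \<rho> ^ 1"
    proof (rule Cauchy_inequality)
      show "(\<lambda>c. h (w + c *s v) - h (z + c *s v)) holomorphic_on ball 0 \<rho>"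
        using hol by (rule holomorphic_on_subset) auto
      show "continuous_on (cball 0 \<rho>) (\<lambda>c. h (w + c *s v) - h (z + c *s v))"
        using hol by (rule holomorphic_on_imp_continuous_on)
      show "0 < \<rho>" using r by (simp add: \<rho>_def)
      fix c :: complex assume "norm (0 - c) = \<rho>"
      then have "dist (h (w + c *s v)) (h (z + c *s v)) < e * \<rho>"
        using in_r[of c] w d' by (intro d(2)) (auto simp: dist_commute)
      then show "cmod (h (w + c *s v) - h (z + c *s v)) \<le> e * \<rho>" by (simp add: dist_norm)
    qed
    moreover have "deriv (\<lambda>c. h (w + c *s v) - h (z + c *s v)) 0 = line_deriv h w v - line_deriv h z v"
      using DERIV_line_deriv[of w 0 v] DERIV_line_deriv[of z 0 v] z subsetD[OF sub w] subsetD[OF r(2)]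
      by (intro DERIV_imp_deriv DERIV_diff) auto
    ultimately show ?thesis using r by (simp add: \<rho>_def)
  qed
  have "cmod (line_deriv h w v - line_deriv h z v) \<le> e * norm v" if w: "w \<in> ball z d'" for w v
  proof (cases "v = 0")
    case True
    have "line_deriv h y 0 = 0" for y by (simp add: line_deriv_def)
    with True show ?thesis by simp
  next
    case False
    define u where "u = complex_of_real (1 / norm v) *s v"
    have vu: "v = complex_of_real (norm v) *s u" and u: "norm u = 1"
      using False by (simp_all add: u_def vector_smult_assoc norm_vector_scalar_mult norm_divide)
    have wO: "w \<in> \<Omega>" using w sub r by auto
    have "line_deriv h w v - line_deriv h z v = complex_of_real (norm v) * (line_deriv h w u - line_deriv h z u)"
      using line_deriv_scale[OF wO, of "complex_of_real (norm v)" u]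
        line_deriv_scale[OF z, of "complex_of_real (norm v)" u] vu[symmetric]
      by (simp add: algebra_simps)
    then show ?thesis
      using mult_left_mono[OF unit[OF w u], of "norm v"] by (simp add: norm_mult mult.commute)
  qed
  with d' sub r show ?thesis by (intro exI[of _ d']) auto
qed

text \<open>The mean value inequality along the segment, for the function minus its expected linear part. One
  increment estimate at nearby base points serves both for additivity of the derivative and for
  differentiability itself.\<close>

lemma line_increment_close:
  assumes z: "z \<in> \<Omega>" and e: "0 < e"
  shows "\<exists>d>0. \<forall>w v. w \<in> ball z d \<longrightarrow> w + v \<in> ball z d \<longrightarrow>
    cmod (h (w + v) - h w - line_deriv h z v) \<le> e * norm v"
proof -
  obtain d where d: "0 < d" "ball z d \<subseteq> \<Omega>"
    "\<And>w v. w \<in> ball z d \<Longrightarrow> cmod (line_deriv h w v - line_deriv h z v) \<le> e * norm v"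
    using line_deriv_close[OF z e] by blast
  have "cmod (h (w + v) - h w - line_deriv h z v) \<le> e * norm v"
    if w: "w \<in> ball z d" "w + v \<in> ball z d" for w v
  proof -
    have seg: "w + c *s v \<in> ball z d" if "c \<in> closed_segment 0 1" for c :: complex
    proof -
      from that obtain t where t: "0 \<le> t" "t \<le> 1" "c = of_real t"
        by (auto simp: closed_segment_def scaleR_conv_of_real)
      have "(1 - t) *\<^sub>R w + t *\<^sub>R (w + v) \<in> ball z d"
        using convexD_alt[OF convex_ball w] t by blast
      then show ?thesis by (simp add: t scaleR_eq_vector_scalar_mult algebra_simps vector_add_ldistrib)
    qed
    have "cmod ((h (w + 1 *s v) - 1 * line_deriv h z v) - (h (w + 0 *s v) - 0 * line_deriv h z v))
       \<le> (e * norm v) * cmod (1 - 0)"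
    proof (rule field_differentiable_bound[where S="closed_segment 0 1"
          and f="\<lambda>c. h (w + c *s v) - c * line_deriv h z v" and f'="\<lambda>c. line_deriv h (w + c *s v) v - line_deriv h z v"])
      fix c :: complex assume "c \<in> closed_segment 0 1"
      from seg[OF this] show "((\<lambda>c. h (w + c *s v) - c * line_deriv h z v) has_field_derivative
          line_deriv h (w + c *s v) v - line_deriv h z v) (at c within closed_segment 0 1)"
        using d(2) by (auto intro!: derivative_eq_intros has_field_derivative_at_within[OF DERIV_line_deriv])
      show "cmod (line_deriv h (w + c *s v) v - line_deriv h z v) \<le> e * norm v"
        by (rule d(3)) (rule seg[OF \<open>c \<in> _\<close>])
    qed auto
    then show ?thesis by (simp add: diff_diff_eq add.commute)
  qed
  with d(1) show ?thesis by blast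
qed

text \<open>The increment along \<open>u + v\<close> is the increment along \<open>u\<close> followed by the one along \<open>v\<close> from a nearby
  base point; dividing by the common length \<open>t\<close> leaves an arbitrarily small error.\<close>

lemma line_deriv_add:
  assumes z: "z \<in> \<Omega>" shows "line_deriv h z (u + v) = line_deriv h z u + line_deriv h z v"
proof -
  have bd: "cmod (line_deriv h z (u + v) - line_deriv h z u - line_deriv h z v) \<le> e" if "0 < e" for e
  proof -
    define K where "K = norm u + norm v + norm (u + v) + 1"
    have K: "0 < K" by (simp add: K_def add_nonneg_pos)
    obtain d where d: "0 < d" "\<And>w v. w \<in> ball z d \<Longrightarrow> w + v \<in> ball z d \<Longrightarrow>
      cmod (h (w + v) - h w - line_deriv h z v) \<le> (e / K) * norm v"
      using line_increment_close[OF z, of "e / K"] \<open>0 < e\<close> K by auto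
    define t where "t = d / (2 * K)"
    have t: "0 < t" using d K by (simp add: t_def)
    \<comment> \<open>All three vectors have norm at most K - 1, so that every point used below stays in the ball.\<close>
    have small: "z + t *\<^sub>R x \<in> ball z d" if "norm x \<le> K" for x
    proof -
      have "t * norm x \<le> t * K" using that t by (intro mult_left_mono) auto
      also have "\<dots> < d" using K d by (simp add: t_def)
      finally show ?thesis using t by (simp add: dist_norm)
    qed
    let ?T = "\<lambda>x. t *\<^sub>R x"
    have 1: "cmod (h (z + ?T u) - h z - line_deriv h z (?T u)) \<le> (e / K) * norm (?T u)"
      using small[of u] d(1) by (intro d(2)) (auto simp: K_def)
    have 2: "cmod (h (z + ?T u + ?T v) - h (z + ?T u) - line_deriv h z (?T v)) \<le> (e / K) * norm (?T v)"
      using small[of u] small[of "u + v"] norm_triangle_ineq[of u v]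
      by (intro d(2)) (auto simp: K_def scaleR_add_right add.assoc)
    have 3: "cmod (h (z + ?T (u + v)) - h z - line_deriv h z (?T (u + v))) \<le> (e / K) * norm (?T (u + v))"
      using small[of "u + v"] d(1) by (intro d(2)) (auto simp: K_def)
    have sc: "line_deriv h z (?T x) = t * line_deriv h z x" for x
      by (simp add: scaleR_eq_vector_scalar_mult line_deriv_scale[OF z])
    have eq: "of_real t * (line_deriv h z (u + v) - line_deriv h z u - line_deriv h z v) =
      (h (z + ?T u) - h z - line_deriv h z (?T u)) + (h (z + ?T u + ?T v) - h (z + ?T u) - line_deriv h z (?T v))
      - (h (z + ?T (u + v)) - h z - line_deriv h z (?T (u + v)))"
      unfolding sc by (simp add: scaleR_add_right add.assoc) (simp add: algebra_simps)
    have "t * cmod (line_deriv h z (u + v) - line_deriv h z u - line_deriv h z v)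
        = cmod (of_real t * (line_deriv h z (u + v) - line_deriv h z u - line_deriv h z v))"
      using t by (simp add: norm_mult)
    also have "\<dots> \<le> (e / K) * norm (?T u) + (e / K) * norm (?T v) + (e / K) * norm (?T (u + v))"
      unfolding eq
      by (rule order_trans[OF norm_triangle_ineq4 add_mono[OF order_trans[OF norm_triangle_ineq add_mono[OF 1 2]] 3]])
    also have "\<dots> = (e / K) * t * (norm u + norm v + norm (u + v))"
      using t by (simp only: norm_scaleR abs_of_pos) (simp only: distrib_left mult.assoc)
    also have "\<dots> = (e / K) * t * (K - 1)" by (simp add: K_def)
    also have "\<dots> \<le> (e / K) * t * K" using t K \<open>0 < e\<close> by (intro mult_left_mono) auto
    also have "\<dots> = t * e" using K by simp
    finally show ?thesis using t by simp
  qed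
  have "cmod (line_deriv h z (u + v) - line_deriv h z u - line_deriv h z v) \<le> 0"
    by (rule field_le_epsilon) (use bd in auto)
  then show ?thesis by (simp add: diff_eq_eq add.commute)
qed

lemma holomorphic_funsI_lines: "h \<in> holomorphic_funs \<Omega>"
  unfolding holomorphic_funs_def
proof (intro CollectI ballI exI conjI allI)
  fix z assume z: "z \<in> \<Omega>"
  have "linear (line_deriv h z)"
    by (rule linearI) (simp_all add: line_deriv_add[OF z] scaleR_eq_vector_scalar_mult line_deriv_scale[OF z] scaleR_conv_of_real)
  then have "bounded_linear (line_deriv h z)" by (simp add: linear_conv_bounded_linear)
  moreover have "\<exists>d>0. \<forall>y. norm (y - z) < d \<longrightarrow> norm (h y - h z - line_deriv h z (y - z)) \<le> e * norm (y - z)"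
    if e: "0 < e" for e
  proof -
    obtain d where d: "0 < d" "\<And>w v. w \<in> ball z d \<Longrightarrow> w + v \<in> ball z d \<Longrightarrow>
      cmod (h (w + v) - h w - line_deriv h z v) \<le> e * norm v"
      using line_increment_close[OF z e] by blast
    have "norm (h y - h z - line_deriv h z (y - z)) \<le> e * norm (y - z)" if "norm (y - z) < d" for y
      using d(2)[of z "y - z"] d(1) that by (simp add: dist_norm norm_minus_commute)
    with d(1) show ?thesis by blast
  qed
  ultimately show "(h has_derivative line_deriv h z) (at z)"
    by (simp add: has_derivative_at_alt)
  show "line_deriv h z (c *s v) = c * line_deriv h z v" for c v
    by (rule line_deriv_scale[OF z])
qed

end

text \<open>Both continuity and holomorphy along lines survive locally uniform limits.\<close>

lemma holomorphic_funs_uniform_limit: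
  assumes op: "open \<Omega>" and f: "\<And>n. f n \<in> holomorphic_funs \<Omega>"
    and lim: "\<And>z. z \<in> \<Omega> \<Longrightarrow> \<exists>d>0. ball z d \<subseteq> \<Omega> \<and> uniform_limit (ball z d) f g sequentially"
  shows "g \<in> holomorphic_funs \<Omega>"
proof (rule holomorphic_funs_local)
  fix z assume "z \<in> \<Omega>"
  then obtain d where d: "0 < d" "ball z d \<subseteq> \<Omega>" "uniform_limit (ball z d) f g sequentially"
    using lim by blast
  have fd: "f n \<in> holomorphic_funs (ball z d)" for n
    by (rule holomorphic_funs_subset[OF f d(2)])
  have "g \<in> holomorphic_funs (ball z d)"
  proof (rule holomorphic_funsI_lines)
    show "continuous_on (ball z d) g"
      by (rule uniform_limit_theorem[OF _ d(3)]) (simp_all add: holomorphic_funs_imp_continuous_on[OF fd])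
    fix x v
    let ?S = "{c. x + c *s v \<in> ball z d}"
    show "(\<lambda>c. g (x + c *s v)) holomorphic_on ?S"
    proof (rule holomorphic_uniform_sequence)
      show "open ?S" by (rule open_complex_line) simp
      show "(\<lambda>c. f n (x + c *s v)) holomorphic_on ?S" for n by (rule holomorphic_funs_along_line[OF fd])
      fix c assume "c \<in> ?S"
      then obtain e where e: "0 < e" "cball c e \<subseteq> ?S"
        using \<open>open ?S\<close> open_contains_cball by blast
      moreover have "uniform_limit (cball c e) (\<lambda>n c. f n (x + c *s v)) (\<lambda>c. g (x + c *s v)) sequentially"
        by (rule uniform_limit_compose'[OF d(3)]) (use e in auto)
      ultimately show "\<exists>d>0. cball c d \<subseteq> ?S \<and>
          uniform_limit (cball c d) (\<lambda>n c. f n (x + c *s v)) (\<lambda>c. g (x + c *s v)) sequentially" by blast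
    qed
  qed simp
  with d(1) show "\<exists>U k. open U \<and> z \<in> U \<and> k \<in> holomorphic_funs U \<and> (\<forall>w\<in>U. g w = k w)"
    by (intro exI[of _ "ball z d"] exI[of _ g]) auto
qed

section \<open>The mean value inequality and averaged norms on balls\<close>

lemma nn_integral_lborel_translate:
  assumes [measurable]: "f \<in> borel_measurable borel"
  shows "(\<integral>\<^sup>+x. f (c + x) \<partial>lborel) = (\<integral>\<^sup>+x. f x \<partial>(lborel :: 'a::euclidean_space measure))"
  by (subst (2) lborel_distr_plus[of c, symmetric]) (simp add: nn_integral_distr)

text \<open>Uniqueness of Haar measure, for the image of Lebesgue measure. With \<open>g\<close> the indicator of the unit
  ball, which the isometry preserves, the double integral of \<open>f (T x) * g (y - T x)\<close> is computed in both
  orders; translation invariance gives the integral of \<open>f \<circ> T\<close> times the volume of the ball in one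
  order and the integral of \<open>f\<close> times this volume in the other.\<close>

lemma nn_integral_lborel_isometry:
  fixes T :: "'a::euclidean_space \<Rightarrow> 'a"
  assumes T: "linear T" "\<And>x. norm (T x) = norm x" and f [measurable]: "f \<in> borel_measurable borel"
  shows "(\<integral>\<^sup>+x. f (T x) \<partial>lborel) = (\<integral>\<^sup>+x. f x \<partial>lborel)"
proof -
  have [measurable]: "T \<in> borel_measurable borel"
    using T(1) by (intro borel_measurable_continuous_onI linear_continuous_on) (simp add: linear_conv_bounded_linear)
  have "inj T" using T linear_injective_0[OF T(1)] by (metis norm_eq_zero)
  then have "surj T" using linear_injective_imp_surjective T(1) by blast
  then obtain S where S: "\<And>y. T (S y) = y" by (metis surjD)
  define g :: "'a \<Rightarrow> ennreal" where "g = indicator (ball 0 1)"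
  have [measurable]: "g \<in> borel_measurable borel" by (simp add: g_def borel_measurable_indicator)
  have gT: "g (- T x) = g x" for x using T(2)[of x] by (simp add: g_def indicator_def)
  define I where "I = (\<integral>\<^sup>+x. g x \<partial>lborel)"
  have I: "I = emeasure lborel (ball (0::'a) 1)" by (simp add: I_def g_def)
  have I0: "I \<noteq> 0" using open_not_negligible[of "ball (0::'a) 1"]
    by (auto simp: I negligible_iff_null_sets null_sets_def)
  have Itop: "I \<noteq> top" using emeasure_lborel_ball_finite[of "0::'a" 1] by (simp add: I)
  have "(\<integral>\<^sup>+x. f (T x) \<partial>lborel) * I = (\<integral>\<^sup>+x. f (T x) * I \<partial>lborel)"
    by (simp add: nn_integral_multc)
  also have "\<dots> = (\<integral>\<^sup>+x. (\<integral>\<^sup>+y. f (T x) * g (- T x + y) \<partial>lborel) \<partial>lborel)"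
  proof (rule nn_integral_cong)
    fix x
    show "f (T x) * I = (\<integral>\<^sup>+y. f (T x) * g (- T x + y) \<partial>lborel)"
      using nn_integral_cmult[of "\<lambda>y. g (- T x + y)" lborel "f (T x)"] nn_integral_lborel_translate[of g "- T x"]
      by (simp add: I_def)
  qed
  also have "\<dots> = (\<integral>\<^sup>+y. (\<integral>\<^sup>+x. f (T x) * g (- T x + y) \<partial>lborel) \<partial>lborel)"
    by (rule lborel_pair.Fubini'[symmetric]) measurable
  also have "\<dots> = (\<integral>\<^sup>+y. (\<integral>\<^sup>+x. f (T (S y + x)) * g (- T (S y + x) + y) \<partial>lborel) \<partial>lborel)"
    by (intro nn_integral_cong nn_integral_lborel_translate[symmetric]) measurable
  also have "\<dots> = (\<integral>\<^sup>+y. (\<integral>\<^sup>+x. f (y + T x) * g x \<partial>lborel) \<partial>lborel)"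
    by (simp add: linear_add[OF T(1)] S gT)
  also have "\<dots> = (\<integral>\<^sup>+x. (\<integral>\<^sup>+y. f (y + T x) * g x \<partial>lborel) \<partial>lborel)"
    by (rule lborel_pair.Fubini'[symmetric]) measurable
  also have "\<dots> = (\<integral>\<^sup>+x. (\<integral>\<^sup>+y. f y \<partial>lborel) * g x \<partial>lborel)"
  proof (rule nn_integral_cong)
    fix x
    show "(\<integral>\<^sup>+y. f (y + T x) * g x \<partial>lborel) = (\<integral>\<^sup>+y. f y \<partial>lborel) * g x"
      using nn_integral_lborel_translate[OF f, of "T x"] by (simp add: nn_integral_multc add.commute)
  qed
  also have "\<dots> = (\<integral>\<^sup>+x. f x \<partial>lborel) * I"
    by (simp add: nn_integral_cmult I_def)
  finally show ?thesis
    using I0 Itop by (metis ennreal_mult_divide_eq)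
qed

text \<open>Cauchy's formula at the centre of the disc.\<close>

lemma cmod_le_circle_average:
  assumes g: "g holomorphic_on cball 0 1"
  shows "ennreal (cmod (g 0)) \<le> (\<integral>\<^sup>+t. ennreal (cmod (g (exp (2 * of_real pi * \<i> * of_real t)))) * indicator {0..1} t \<partial>lborel)"
proof -
  define G where "G t = g (exp (2 * of_real pi * \<i> * of_real t))" for t :: real
  have "((\<lambda>u. g u / (u - 0)) has_contour_integral (2 * of_real pi * \<i> * g 0)) (circlepath 0 1)"
    by (rule Cauchy_integral_circlepath_simple[OF g]) simp
  then have "((\<lambda>t. g (circlepath 0 1 t) / circlepath 0 1 t * vector_derivative (circlepath 0 1) (at t within {0..1}))
      has_integral (2 * of_real pi * \<i> * g 0)) {0..1}"
    by (simp add: has_contour_integral_def)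
  then have "((\<lambda>t. (2 * of_real pi * \<i>) * G t) has_integral (2 * of_real pi * \<i> * g 0)) {0..1}"
    by (rule has_integral_eq[rotated])
       (simp add: vector_derivative_circlepath01 del: vector_derivative_part_circlepath01, simp add: circlepath G_def field_simps)
  note scaled = this
  have "(G has_integral a) {0..1}" if "c \<noteq> 0" "((\<lambda>t. c * G t) has_integral c * a) {0..1}" for c a
    using has_integral_mult_right[OF that(2), of "inverse c"] that(1) by (simp add: mult.assoc[symmetric])
  from this[OF _ scaled] have G: "(G has_integral g 0) {0..1}" by simp
  have cont: "continuous_on {0..1} G"
    unfolding G_def
    by (rule continuous_on_compose2[OF holomorphic_on_imp_continuous_on[OF g]]) (auto intro!: continuous_intros)
  then have int: "(\<lambda>t. cmod (G t)) integrable_on {0..1}"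
    by (intro integrable_continuous_interval continuous_intros)
  have "cmod (g 0) \<le> integral {0..1} (\<lambda>t. cmod (G t))"
    using integral_norm_bound_integral[OF has_integral_integrable[OF G] int] G by (simp add: integral_unique)
  also have "ennreal \<dots> = (\<integral>\<^sup>+t. ennreal (cmod (G t)) * indicator {0..1} t \<partial>lborel)"
    by (rule nn_integral_has_integral_lebesgue'[symmetric]) (use int in auto)
  finally show ?thesis by (simp add: G_def ennreal_leI)
qed

text \<open>The circle inequality holds on the circle through every point \<open>w\<close> of the ball in the line through the
  centre. Integrating it over \<open>w\<close> and exchanging integrals, every rotation of the ball contributes the
  same integral.\<close>

lemma cmod_times_volume_le_ball_integral:
  fixes h :: "complex ^ 'n \<Rightarrow> complex"
  assumes h: "h \<in> holomorphic_funs (ball z r)"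
  shows "ennreal (cmod (h z)) * emeasure lborel (ball z r) \<le> (\<integral>\<^sup>+w. ennreal (cmod (h w)) * indicator (ball z r) w \<partial>lborel)"
proof -
  define H where "H w = ennreal (cmod (indicator (ball z r) w *\<^sub>R h w))" for w
  have Heq: "H w = ennreal (cmod (h w)) * indicator (ball z r) w" for w by (simp add: H_def indicator_def)
  have [measurable]: "(\<lambda>w. indicator (ball z r) w *\<^sub>R h w) \<in> borel_measurable borel"
    by (rule borel_measurable_continuous_on_indicator) (auto intro: holomorphic_funs_imp_continuous_on[OF h])
  have [measurable]: "H \<in> borel_measurable borel" unfolding H_def by measurable
  define e where "e t = exp (2 * of_real pi * \<i> * of_real t)" for t :: real
  have e: "cmod (e t) = 1" for t by (simp add: e_def)
  have ce: "continuous_on S e" for S unfolding e_def by (intro continuous_intros)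
  have lin: "linear (\<lambda>w. c *s (w :: complex ^ 'n))" for c
    by (rule linearI) (simp_all add: vec_eq_iff algebra_simps)
  have "(\<lambda>p::(complex ^ 'n) \<times> real. z + e (snd p) *s fst p) \<in> borel_measurable borel"
    by (intro borel_measurable_continuous_onI continuous_intros continuous_on_compose2[OF ce[of UNIV]]) auto
  then have [measurable]: "(\<lambda>p::(complex ^ 'n) \<times> real. z + e (snd p) *s fst p) \<in> borel \<Otimes>\<^sub>M borel \<rightarrow>\<^sub>M borel"
    by (simp add: borel_prod)
  have [measurable]: "(\<lambda>w. z + e t *s w) \<in> borel_measurable borel" for t
    by (intro borel_measurable_continuous_onI continuous_intros)
  have pt: "ennreal (cmod (h z)) * indicator (ball 0 r) w \<le> (\<integral>\<^sup>+t. H (z + e t *s w) * indicator {0..1} t \<partial>lborel)" for w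
  proof (cases "w \<in> ball 0 r")
    case True
    have inb: "z + c *s w \<in> ball z r" if "cmod c \<le> 1" for c
    proof -
      have "cmod c * norm w \<le> 1 * norm w" using that by (intro mult_right_mono) auto
      then show ?thesis using True by (simp add: dist_norm norm_vector_scalar_mult)
    qed
    have "(\<lambda>c. h (z + c *s w)) holomorphic_on cball 0 1"
      by (rule holomorphic_on_subset[OF holomorphic_funs_along_line[OF h]]) (use inb in auto)
    from cmod_le_circle_average[OF this] show ?thesis
      using True inb[of "e _"] by (simp add: Heq e e_def[symmetric])
  qed auto
  have rot: "(\<integral>\<^sup>+w. H (z + e t *s w) \<partial>lborel) = (\<integral>\<^sup>+w. H w \<partial>lborel)" for t
  proof -
    have "(\<integral>\<^sup>+w. H (z + e t *s w) \<partial>lborel) = (\<integral>\<^sup>+w. H (z + w) \<partial>lborel)"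
      by (rule nn_integral_lborel_isometry[of "\<lambda>w. e t *s w" "\<lambda>w. H (z + w)"])
         (simp_all add: lin norm_vector_scalar_mult e)
    then show ?thesis by (simp add: nn_integral_lborel_translate)
  qed
  have "emeasure lborel (ball z r) = (\<integral>\<^sup>+w. indicator (ball z r) (z + w) \<partial>lborel)"
    by (subst nn_integral_lborel_translate) (simp_all add: borel_measurable_indicator)
  also have "(\<lambda>w. indicator (ball z r) (z + w) :: ennreal) = indicator (ball 0 r)"
    by (auto simp: indicator_def dist_norm)
  finally have vol: "emeasure lborel (ball z r) = (\<integral>\<^sup>+w. indicator (ball (0 :: complex ^ 'n) r) w \<partial>lborel)" .
  have "ennreal (cmod (h z)) * emeasure lborel (ball z r)
      = (\<integral>\<^sup>+w. ennreal (cmod (h z)) * indicator (ball (0 :: complex ^ 'n) r) w \<partial>lborel)"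
    unfolding vol by (simp only: nn_integral_cmult borel_measurable_indicator sets_lborel borel_open open_ball)
  also have "\<dots> \<le> (\<integral>\<^sup>+w. (\<integral>\<^sup>+t. H (z + e t *s w) * indicator {0..1} t \<partial>lborel) \<partial>lborel)"
    by (intro nn_integral_mono pt)
  also have "\<dots> = (\<integral>\<^sup>+t. (\<integral>\<^sup>+w. H (z + e t *s w) * indicator {0..1} t \<partial>lborel) \<partial>lborel)"
    by (rule lborel_pair.Fubini'[symmetric]) (simp add: case_prod_beta, measurable)
  also have "\<dots> = (\<integral>\<^sup>+t. (\<integral>\<^sup>+w. H w \<partial>lborel) * indicator {0..1::real} t \<partial>lborel)"
    by (simp add: nn_integral_multc rot)
  also have "\<dots> = (\<integral>\<^sup>+w. H w \<partial>lborel)"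
    by (simp add: nn_integral_cmult)
  finally show ?thesis by (simp add: Heq)
qed

text \<open>Restricting the space to \<open>S\<close>, instead of multiplying by an indicator, allows integrands that are
  measurable on \<open>S\<close> only. The competitors in \<open>IDA_G\<close> are arbitrary outside their ball.\<close>

definition average_measure :: "'a::euclidean_space set \<Rightarrow> 'a measure" where
  "average_measure S = scale_measure (1 / emeasure lebesgue S) (lebesgue_on S)"

lemma measurable_average_measure [simp]:
  "measurable (average_measure S) N = measurable (lebesgue_on S) N"
  unfolding average_measure_def by (rule measurable_cong_sets) simp_all

lemma space_average_measure [simp]: "space (average_measure S) = S"
  by (simp add: average_measure_def space_scale_measure)

lemma nn_integral_average_measure:
  assumes "S \<in> sets lebesgue" "f \<in> borel_measurable (lebesgue_on S)"
  shows "(\<integral>\<^sup>+x. f x \<partial>average_measure S) = (\<integral>\<^sup>+x. f x * indicator S x \<partial>lebesgue) / emeasure lebesgue S"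
  using assms by (simp add: average_measure_def nn_integral_scale_measure nn_integral_restrict_space
      ennreal_times_divide divide_ennreal_def mult.commute)

lemma emeasure_lebesgue_ball:
  fixes z :: "'a::euclidean_space"
  assumes "0 < r"
  shows "emeasure lebesgue (ball z r) \<noteq> 0" "emeasure lebesgue (ball z r) \<noteq> top"
  using assms open_not_negligible[of "ball z r"] emeasure_lborel_ball_finite[of z r]
  by (auto simp: negligible_iff_null_sets null_sets_def)

lemma AE_average_ball:
  fixes z :: "'a::euclidean_space"
  assumes r: "0 < r"
  shows "(AE w in average_measure (ball z r). P w) \<longleftrightarrow> (AE w in lebesgue. w \<in> ball z r \<longrightarrow> P w)"
proof -
  define c where "c = 1 / emeasure lebesgue (ball z r)"
  have c: "c \<noteq> 0" using emeasure_lebesgue_ball[OF r, of z] by (simp add: c_def ennreal_divide_eq_0_iff)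
  have "(AE w in scale_measure c (lebesgue_on (ball z r)). P w) \<longleftrightarrow> (AE w in lebesgue_on (ball z r). P w)"
    using c by (simp add: eventually_ae_filter null_sets_def space_scale_measure)
  then show ?thesis
    unfolding average_measure_def c_def[symmetric] by (simp add: AE_restrict_space_iff)
qed

lemma emeasure_average_ball:
  fixes z :: "'a::euclidean_space"
  assumes "0 < r"
  shows "emeasure (average_measure (ball z r)) (space (average_measure (ball z r))) = 1"
proof -
  have "emeasure (average_measure (ball z r)) (ball z r) = 1 / emeasure lebesgue (ball z r) * emeasure lebesgue (ball z r)"
    by (simp add: average_measure_def emeasure_restrict_space)
  also have "\<dots> = 1"
    using emeasure_lebesgue_ball[OF assms, of z] ennreal_divide_times[of 1 "emeasure lebesgue (ball z r)"]
    by (simp add: zero_less_iff_neq_zero less_top)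
  finally show ?thesis by simp
qed

lemma holomorphic_funs_measurable:
  assumes "h \<in> holomorphic_funs \<Omega>" "\<Omega> \<in> sets lebesgue"
  shows "h \<in> borel_measurable (lebesgue_on \<Omega>)"
  using assms continuous_imp_measurable_on_sets_lebesgue holomorphic_funs_imp_continuous_on by blast

definition ball_enorm :: "real \<Rightarrow> complex ^ 'n \<Rightarrow> real \<Rightarrow> (complex ^ 'n \<Rightarrow> complex) \<Rightarrow> ennreal" where
  "ball_enorm q z r u = Lp_enorm (average_measure (ball z r)) q (\<lambda>w. ennreal (cmod (u w)))"

lemma ball_enorm_eq:
  assumes u: "u \<in> borel_measurable (lebesgue_on (ball z r))"
  shows "ball_enorm q z r u = ennreal_powr
    ((\<integral>\<^sup>+w. ennreal (cmod (u w) powr q) * indicator (ball z r) w \<partial>lebesgue) / emeasure lebesgue (ball z r)) (1 / q)"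
  using u by (simp add: ball_enorm_def Lp_enorm_def nn_integral_average_measure)

lemma ball_enorm_finite_iff:
  assumes r: "0 < r" and u: "u \<in> borel_measurable (lebesgue_on (ball z r))"
  shows "ball_enorm q z r u < top \<longleftrightarrow> (\<integral>\<^sup>+w\<in>ball z r. ennreal (cmod (u w) powr q) \<partial>lebesgue) < top"
  using emeasure_lebesgue_ball[OF r, of z]
  by (simp add: ball_enorm_eq[OF u] ennreal_divide_eq_top_iff flip: less_top)

lemma ball_enorm_triangle:
  assumes q: "1 \<le> q" and [measurable]: "u \<in> borel_measurable (lebesgue_on (ball z r))" "v \<in> borel_measurable (lebesgue_on (ball z r))"
  shows "ball_enorm q z r (\<lambda>w. u w + v w) \<le> ball_enorm q z r u + ball_enorm q z r v"
proof -
  have "ball_enorm q z r (\<lambda>w. u w + v w) \<le> Lp_enorm (average_measure (ball z r)) q (\<lambda>w. ennreal (cmod (u w)) + ennreal (cmod (v w)))"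
    unfolding ball_enorm_def using q
    by (intro Lp_enorm_mono_AE AE_I2)
       (auto simp: ennreal_plus[symmetric] norm_triangle_ineq intro!: ennreal_leI simp del: ennreal_plus)
  also have "\<dots> \<le> ball_enorm q z r u + ball_enorm q z r v"
    unfolding ball_enorm_def by (rule Lp_enorm_add[OF q]) simp_all
  finally show ?thesis .
qed

lemma ball_enorm_uminus [simp]: "ball_enorm q z r (\<lambda>w. - u w) = ball_enorm q z r u"
  by (simp add: ball_enorm_def)

lemma ball_enorm_diff_triangle:
  assumes q: "1 \<le> q" and u: "u \<in> borel_measurable (lebesgue_on (ball z r))" and v: "v \<in> borel_measurable (lebesgue_on (ball z r))"
  shows "ball_enorm q z r (\<lambda>w. u w - v w) \<le> ball_enorm q z r u + ball_enorm q z r v"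
  using ball_enorm_triangle[OF q u borel_measurable_uminus[OF v]] by simp

lemma ball_enorm_cmult:
  assumes "0 < q" and [measurable]: "u \<in> borel_measurable (lebesgue_on (ball z r))"
  shows "ball_enorm q z r (\<lambda>w. c * u w) = ennreal (cmod c) * ball_enorm q z r u"
  unfolding ball_enorm_def using assms(1)
  by (subst Lp_enorm_cmult[symmetric]) (simp_all add: norm_mult ennreal_mult)

lemma ball_enorm_cong_AE:
  assumes "0 < r" "AE w in lebesgue. w \<in> ball z r \<longrightarrow> u w = v w"
  shows "ball_enorm q z r u = ball_enorm q z r v"
  unfolding ball_enorm_def
  by (rule Lp_enorm_cong_AE) (use assms in \<open>auto simp: AE_average_ball elim!: eventually_mono\<close>)

lemma ball_enorm_eq_0:
  assumes "0 < r" "AE w in lebesgue. w \<in> ball z r \<longrightarrow> u w = v w"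
  shows "ball_enorm q z r (\<lambda>w. u w - v w) = 0"
proof -
  have "ball_enorm q z r (\<lambda>w. u w - v w) = ball_enorm q z r (\<lambda>w. 0)"
    by (rule ball_enorm_cong_AE) (use assms in \<open>auto elim!: eventually_mono\<close>)
  then show ?thesis by (simp add: ball_enorm_def Lp_enorm_def)
qed

lemma ball_enorm_bounded_finite:
  assumes q: "0 < q" and r: "0 < r" and M: "\<And>w. w \<in> ball z r \<Longrightarrow> cmod (u w) \<le> M"
  shows "ball_enorm q z r u < top"
proof -
  have "(\<integral>\<^sup>+w. ennreal_powr (ennreal (cmod (u w))) q \<partial>average_measure (ball z r))
    \<le> (\<integral>\<^sup>+w. ennreal_powr (ennreal M) q \<partial>average_measure (ball z r))"
    by (intro nn_integral_mono ennreal_powr_mono q ennreal_leI M) simp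
  also have "\<dots> = ennreal_powr (ennreal M) q" using emeasure_average_ball[OF r, of z] by simp
  finally have "ball_enorm q z r u \<le> ennreal M" by (simp add: ball_enorm_def Lp_enorm_le_iff[OF q])
  then show ?thesis by (simp add: le_less_trans)
qed

text \<open>Only the normalisation by the volume changes on a smaller ball.\<close>

lemma ball_enorm_subball:
  assumes "0 < p" "0 < r" "0 < \<rho>" and sub: "ball w \<rho> \<subseteq> ball z r"
    and u: "u \<in> borel_measurable (lebesgue_on (ball z r))"
  shows "ball_enorm p w \<rho> u \<le>
    ennreal_powr (emeasure lebesgue (ball z r) / emeasure lebesgue (ball w \<rho>)) (1 / p)
      * ball_enorm p z r u"
proof -
  define V where "V = emeasure lebesgue (ball z r)"
  define v where "v = emeasure lebesgue (ball w \<rho>)"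
  have V: "V \<noteq> 0" "V \<noteq> top" and v: "v \<noteq> 0" "v \<noteq> top"
    using assms emeasure_lebesgue_ball[of r z] emeasure_lebesgue_ball[of \<rho> w] by (simp_all add: V_def v_def)
  have u': "u \<in> borel_measurable (lebesgue_on (ball w \<rho>))"
    using measurable_restrict_mono[OF u sub] .
  define J where "J = (\<integral>\<^sup>+x. ennreal (cmod (u x) powr p) * indicator (ball z r) x \<partial>lebesgue)"
  have "(\<integral>\<^sup>+x. ennreal (cmod (u x) powr p) * indicator (ball w \<rho>) x \<partial>lebesgue) / v \<le> J / v"
    unfolding J_def using sub by (intro divide_right_mono_ennreal nn_integral_mono mult_left_mono) (auto simp: indicator_def)
  also have "J / v = (V / v) * (J / V)"
    using V v ennreal_mult_divide_eq[of V J] by (cases V; cases v; cases J)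
      (auto simp: divide_ennreal ennreal_mult'[symmetric] ennreal_top_divide ennreal_top_mult ennreal_mult_top)
  finally have "(\<integral>\<^sup>+x. ennreal (cmod (u x) powr p) * indicator (ball w \<rho>) x \<partial>lebesgue) / v \<le> V / v * (J / V)" .
  from ennreal_powr_mono[OF _ this, of "1 / p"]
  show ?thesis
    using \<open>0 < p\<close> by (simp add: ball_enorm_eq[OF u] ball_enorm_eq[OF u'] ennreal_powr_mult V_def v_def J_def)
qed

text \<open>The mean value inequality followed by Jensen's inequality.\<close>

lemma cmod_le_ball_enorm:
  fixes h :: "complex ^ 'n \<Rightarrow> complex"
  assumes p: "1 \<le> p" and r: "0 < r" and h: "h \<in> holomorphic_funs (ball z r)"
  shows "ennreal (cmod (h z)) \<le> ball_enorm p z r h"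
proof -
  have [measurable]: "h \<in> borel_measurable (lebesgue_on (ball z r))"
    by (rule holomorphic_funs_measurable[OF h]) simp
  note V = emeasure_lebesgue_ball[OF r, of z]
  have "ennreal (cmod (h z)) = ennreal (cmod (h z)) * emeasure lebesgue (ball z r) / emeasure lebesgue (ball z r)"
    using V by (simp add: ennreal_mult_divide_eq)
  also have "\<dots> \<le> (\<integral>\<^sup>+w. ennreal (cmod (h w)) * indicator (ball z r) w \<partial>lebesgue) / emeasure lebesgue (ball z r)"
    using cmod_times_volume_le_ball_integral[OF h]
    by (intro divide_right_mono_ennreal) (simp add: nn_integral_completion)
  also have "\<dots> = (\<integral>\<^sup>+w. ennreal (cmod (h w)) \<partial>average_measure (ball z r))"
    by (subst nn_integral_average_measure) simp_all
  also have "\<dots> \<le> ball_enorm p z r h"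
    unfolding ball_enorm_def by (rule nn_integral_le_Lp_enorm[OF p emeasure_average_ball[OF r]]) simp
  finally show ?thesis .
qed

text \<open>On half of the ball the mean value inequality bounds all terms by the summable averaged norms, so the
  series converges uniformly there by the Weierstrass test.\<close>

lemma holomorphic_funs_suminf_of_summable_norms:
  fixes g :: "nat \<Rightarrow> complex ^ 'n \<Rightarrow> complex"
  assumes p: "1 \<le> p" and op: "open V" and g: "\<And>j. g j \<in> holomorphic_funs V"
    and fin: "\<And>w. w \<in> V \<Longrightarrow> \<exists>r>0. ball w r \<subseteq> V \<and>
      (\<Sum>j. ball_enorm p w r (g j)) < top"
  shows "(\<lambda>w. \<Sum>j. g j w) \<in> holomorphic_funs V" "\<And>w. w \<in> V \<Longrightarrow> summable (\<lambda>j. g j w)"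
proof -
  have main: "\<exists>d M. 0 < d \<and> ball w d \<subseteq> V \<and> summable M \<and> (\<forall>y\<in>ball w d. \<forall>j. cmod (g j y) \<le> M j)" if w: "w \<in> V" for w
  proof -
    obtain r where r: "0 < r" "ball w r \<subseteq> V"
      "(\<Sum>j. ball_enorm p w r (g j)) < top"
      using fin[OF w] by blast
    define N where "N j = ball_enorm p w r (g j)" for j
    have meas: "g j \<in> borel_measurable (lebesgue_on (ball w r))" for j
      by (rule holomorphic_funs_measurable[OF holomorphic_funs_subset[OF g r(2)]]) simp
    have sumN: "(\<Sum>j. N j) < top" using r(3) by (simp add: N_def)
    have Nfin: "N j < top" for j
      using ennreal_suminf_lessD[OF sumN] .
    have Nr: "N j = ennreal (enn2real (N j))" for j using Nfin by simp
    have sumr: "summable (\<lambda>j. enn2real (N j))"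
      using sumN Nr by (intro summable_suminf_not_top) (auto simp: less_top)
    define C where "C = ennreal_powr (emeasure lebesgue (ball w r) / emeasure lebesgue (ball w (r/2))) (1 / p)"
    have Ctop: "C < top"
      using emeasure_lebesgue_ball[of r w] emeasure_lebesgue_ball[of "r/2" w] r(1)
      by (simp add: C_def ennreal_divide_eq_top_iff flip: less_top)
    have "cmod (g j y) \<le> enn2real C * enn2real (N j)" if y: "y \<in> ball w (r/2)" for y j
    proof -
      have sub: "ball y (r/2) \<subseteq> ball w r" 
      proof
        fix x assume "x \<in> ball y (r/2)"
        then show "x \<in> ball w r" using dist_triangle[of w x y] y by simp
      qed
      have "ennreal (cmod (g j y)) \<le> ball_enorm p y (r/2) (g j)"
        using r by (intro cmod_le_ball_enorm p holomorphic_funs_subset[OF g] order_trans[OF sub]) auto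
      also have "\<dots> \<le> C * N j"
        using ball_enorm_subball[OF _ r(1) _ sub meas[of j], of p] r p
        by (simp add: C_def N_def emeasure_ball)
      also have "\<dots> = ennreal (enn2real C * enn2real (N j))"
        using Ctop Nfin[of j] by (simp add: ennreal_mult')
      finally show ?thesis by (simp add: ennreal_le_iff)
    qed
    then have "\<exists>C\<ge>0. \<forall>y\<in>ball w (r/2). \<forall>j. cmod (g j y) \<le> C * enn2real (N j)"
      by (intro exI[of _ "enn2real C"]) auto
    then obtain C where C: "0 \<le> C" "\<And>y j. y \<in> ball w (r/2) \<Longrightarrow> cmod (g j y) \<le> C * enn2real (N j)" by blast
    then show ?thesis
      using r(1,2) sumr by (intro exI[of _ "r/2"] exI[of _ "\<lambda>j. C * enn2real (N j)"])
        (auto intro!: summable_mult simp: subset_eq)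
  qed
  show "summable (\<lambda>j. g j w)" if w: "w \<in> V" for w
  proof -
    obtain d M where "0 < d" "summable M" "\<forall>y\<in>ball w d. \<forall>j. cmod (g j y) \<le> M j"
      using main[OF w] by blast
    then show ?thesis by (intro summable_comparison_test[of "\<lambda>j. g j w" M] exI[of _ 0]) simp_all
  qed
  show "(\<lambda>w. \<Sum>j. g j w) \<in> holomorphic_funs V"
  proof (rule holomorphic_funs_uniform_limit[OF op, where f="\<lambda>n w. \<Sum>j<n. g j w"])
    show "(\<lambda>w. \<Sum>j<n. g j w) \<in> holomorphic_funs V" for n by (intro holomorphic_funs_sum g)
    fix w assume w: "w \<in> V"
    obtain d M where d: "0 < d" "ball w d \<subseteq> V" "summable M" "\<forall>y\<in>ball w d. \<forall>j. cmod (g j y) \<le> M j"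
      using main[OF w] by blast
    have "uniform_limit (ball w d) (\<lambda>n w. \<Sum>j<n. g j w) (\<lambda>w. \<Sum>j. g j w) sequentially"
      by (rule Weierstrass_m_test[OF _ d(3)]) (use d(4) in auto)
    with d show "\<exists>d>0. ball w d \<subseteq> V \<and> uniform_limit (ball w d) (\<lambda>n w. \<Sum>j<n. g j w) (\<lambda>w. \<Sum>j. g j w) sequentially" by blast
  qed
qed

section \<open>Functions that are almost everywhere holomorphic; parameter integrals\<close>

text \<open>The localised version of \<open>entire_ae\<close>.\<close>

definition ae_holomorphic :: "(complex ^ 'n) set \<Rightarrow> (complex ^ 'n \<Rightarrow> complex) set" where
  "ae_holomorphic \<Omega> = {f. \<exists>h\<in>holomorphic_funs \<Omega>. AE z in lebesgue. z \<in> \<Omega> \<longrightarrow> f z = h z}"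

lemma entire_ae_eq: "entire_ae = ae_holomorphic UNIV"
  by (simp add: entire_ae_def ae_holomorphic_def)

lemma ae_holomorphicI:
  "h \<in> holomorphic_funs \<Omega> \<Longrightarrow> AE z in lebesgue. z \<in> \<Omega> \<longrightarrow> f z = h z \<Longrightarrow> f \<in> ae_holomorphic \<Omega>"
  unfolding ae_holomorphic_def by blast

lemma ae_holomorphicE:
  assumes "f \<in> ae_holomorphic \<Omega>"
  obtains h where "h \<in> holomorphic_funs \<Omega>" "AE z in lebesgue. z \<in> \<Omega> \<longrightarrow> f z = h z"
  using assms unfolding ae_holomorphic_def by blast

lemma holomorphic_funs_imp_ae_holomorphic: "h \<in> holomorphic_funs \<Omega> \<Longrightarrow> h \<in> ae_holomorphic \<Omega>"
  by (rule ae_holomorphicI) auto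

lemma ae_holomorphic_subset:
  assumes "f \<in> ae_holomorphic \<Omega>" "\<Omega>' \<subseteq> \<Omega>" shows "f \<in> ae_holomorphic \<Omega>'"
proof -
  obtain h where h: "h \<in> holomorphic_funs \<Omega>" "AE z in lebesgue. z \<in> \<Omega> \<longrightarrow> f z = h z"
    using assms(1) by (rule ae_holomorphicE)
  show ?thesis
    by (rule ae_holomorphicI[OF holomorphic_funs_subset[OF h(1) assms(2)]])
       (use h(2) assms(2) in \<open>auto elim!: eventually_mono\<close>)
qed

lemma ae_holomorphic_cong:
  assumes "g \<in> ae_holomorphic \<Omega>" "AE z in lebesgue. z \<in> \<Omega> \<longrightarrow> f z = g z"
  shows "f \<in> ae_holomorphic \<Omega>"
proof -
  obtain h where h: "h \<in> holomorphic_funs \<Omega>" "AE z in lebesgue. z \<in> \<Omega> \<longrightarrow> g z = h z"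
    using assms(1) by (rule ae_holomorphicE)
  from assms(2) h(2) have "AE z in lebesgue. z \<in> \<Omega> \<longrightarrow> f z = h z" by eventually_elim auto
  with h(1) show ?thesis by (rule ae_holomorphicI)
qed

lemma ae_holomorphic_add:
  assumes "f \<in> ae_holomorphic \<Omega>" "g \<in> ae_holomorphic \<Omega>"
  shows "(\<lambda>z. f z + g z) \<in> ae_holomorphic \<Omega>"
proof -
  obtain h where h: "h \<in> holomorphic_funs \<Omega>" "AE z in lebesgue. z \<in> \<Omega> \<longrightarrow> f z = h z"
    using assms(1) by (rule ae_holomorphicE)
  obtain k where k: "k \<in> holomorphic_funs \<Omega>" "AE z in lebesgue. z \<in> \<Omega> \<longrightarrow> g z = k z"
    using assms(2) by (rule ae_holomorphicE)
  from h(2) k(2) have "AE z in lebesgue. z \<in> \<Omega> \<longrightarrow> f z + g z = h z + k z" by eventually_elim auto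
  with holomorphic_funs_add[OF h(1) k(1)] show ?thesis by (rule ae_holomorphicI)
qed

lemma ae_holomorphic_cmult:
  assumes "f \<in> ae_holomorphic \<Omega>" shows "(\<lambda>z. c * f z) \<in> ae_holomorphic \<Omega>"
proof -
  obtain h where h: "h \<in> holomorphic_funs \<Omega>" "AE z in lebesgue. z \<in> \<Omega> \<longrightarrow> f z = h z"
    using assms(1) by (rule ae_holomorphicE)
  from h(2) have "AE z in lebesgue. z \<in> \<Omega> \<longrightarrow> c * f z = c * h z" by eventually_elim auto
  with holomorphic_funs_cmult[OF h(1)] show ?thesis by (rule ae_holomorphicI)
qed

lemma ae_holomorphic_diff:
  assumes "f \<in> ae_holomorphic \<Omega>" "g \<in> ae_holomorphic \<Omega>"
  shows "(\<lambda>z. f z - g z) \<in> ae_holomorphic \<Omega>"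
  using ae_holomorphic_add[OF assms(1) ae_holomorphic_cmult[OF assms(2), of "-1"]] by simp

lemma open_AE_imp_empty:
  fixes U :: "'a::euclidean_space set"
  assumes "open U" "AE z in lebesgue. z \<notin> U" shows "U = {}"
proof (rule ccontr)
  assume "U \<noteq> {}"
  with open_not_negligible[OF assms(1)] have "\<not> negligible U" by blast
  moreover have "U \<in> null_sets lebesgue"
    using assms AE_iff_null_sets[of U lebesgue] by simp
  ultimately show False by (simp add: negligible_iff_null_sets)
qed

lemma AE_imp_dense:
  fixes Z :: "'a::euclidean_space set"
  assumes "AE z in lebesgue. z \<in> Z" "0 < e" shows "\<exists>z\<in>Z. dist z p < e"
proof (rule ccontr)
  assume *: "\<not> ?thesis"
  have "ball p e = {}"
    by (rule open_AE_imp_empty) (use assms(1) * in \<open>auto simp: dist_commute elim!: eventually_mono\<close>)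
  with assms(2) show False by simp
qed

lemma continuous_AE_eq_imp_eq:
  fixes f g :: "'a::euclidean_space \<Rightarrow> complex"
  assumes "open U" "continuous_on U f" "continuous_on U g"
    and ae: "AE z in lebesgue. z \<in> U \<longrightarrow> f z = g z" and z: "z \<in> U"
  shows "f z = g z"
proof -
  have "open (U \<inter> (\<lambda>z. f z - g z) -` (- {0}))"
    using assms(1-3) by (intro continuous_open_preimage continuous_intros) auto
  moreover have "AE z in lebesgue. z \<notin> U \<inter> (\<lambda>z. f z - g z) -` (- {0})"
    using ae by eventually_elim auto
  ultimately have "U \<inter> (\<lambda>z. f z - g z) -` (- {0}) = {}" by (rule open_AE_imp_empty)
  with z show ?thesis by auto
qed

text \<open>By Lindelof's theorem countably many of the sets have the same union.\<close>

lemma AE_in_Union_open: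
  fixes \<U> :: "'a::euclidean_space set set"
  assumes op: "\<And>U. U \<in> \<U> \<Longrightarrow> open U" and ae: "\<And>U. U \<in> \<U> \<Longrightarrow> AE z in lebesgue. z \<in> U \<longrightarrow> P z"
  shows "AE z in lebesgue. z \<in> \<Union>\<U> \<longrightarrow> P z"
proof -
  obtain \<V> where V: "\<V> \<subseteq> \<U>" "countable \<V>" "\<Union>\<V> = \<Union>\<U>"
    using Lindelof[of \<U>] op by metis
  have "AE z in lebesgue. \<forall>U\<in>\<V>. z \<in> U \<longrightarrow> P z"
    using V ae by (subst AE_ball_countable) auto
  then show ?thesis by eventually_elim (use V(3) in auto)
qed

text \<open>Two holomorphic representatives of \<open>f\<close> agree on the overlap of their domains, because they are
  continuous and agree almost everywhere. So they define one holomorphic function, and a countable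
  subcover shows that it represents \<open>f\<close>.\<close>

lemma ae_holomorphic_local:
  fixes f :: "complex ^ 'n \<Rightarrow> complex"
  assumes loc: "\<And>z. z \<in> \<Omega> \<Longrightarrow> \<exists>U. open U \<and> z \<in> U \<and> f \<in> ae_holomorphic U"
  shows "f \<in> ae_holomorphic \<Omega>"
proof -
  have "\<forall>z\<in>\<Omega>. \<exists>U h. open U \<and> z \<in> U \<and> h \<in> holomorphic_funs U \<and> (AE w in lebesgue. w \<in> U \<longrightarrow> f w = h w)"
    using loc unfolding ae_holomorphic_def by blast
  from bchoice[OF this] obtain U where
    "\<forall>z\<in>\<Omega>. \<exists>h. open (U z) \<and> z \<in> U z \<and> h \<in> holomorphic_funs (U z) \<and> (AE w in lebesgue. w \<in> U z \<longrightarrow> f w = h w)" ..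
  from bchoice[OF this] obtain h where
    *: "\<forall>z\<in>\<Omega>. open (U z) \<and> z \<in> U z \<and> h z \<in> holomorphic_funs (U z) \<and> (AE w in lebesgue. w \<in> U z \<longrightarrow> f w = h z w)" ..
  have U: "open (U z)" "z \<in> U z" and h: "h z \<in> holomorphic_funs (U z)"
    and ae: "AE w in lebesgue. w \<in> U z \<longrightarrow> f w = h z w" if "z \<in> \<Omega>" for z
    using * that by simp_all
  have agree: "h y w = h z w" if "y \<in> \<Omega>" "z \<in> \<Omega>" "w \<in> U y" "w \<in> U z" for y z w
  proof (rule continuous_AE_eq_imp_eq[of "U y \<inter> U z"])
    show "continuous_on (U y \<inter> U z) (h y)" "continuous_on (U y \<inter> U z) (h z)"
      using holomorphic_funs_imp_continuous_on[OF h] that(1,2) by (auto intro: continuous_on_subset)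
    show "AE w in lebesgue. w \<in> U y \<inter> U z \<longrightarrow> h y w = h z w"
      using ae[OF that(1)] ae[OF that(2)] by eventually_elim auto
  qed (use that U in auto)
  define k where "k w = h (SOME z. z \<in> \<Omega> \<and> w \<in> U z) w" for w
  have k: "k w = h z w" if "z \<in> \<Omega>" "w \<in> U z" for z w
    unfolding k_def using someI[of "\<lambda>z. z \<in> \<Omega> \<and> w \<in> U z" z] that by (intro agree) auto
  have "k \<in> holomorphic_funs \<Omega>"
  proof (rule holomorphic_funs_local)
    fix z assume z: "z \<in> \<Omega>"
    show "\<exists>V g. open V \<and> z \<in> V \<and> g \<in> holomorphic_funs V \<and> (\<forall>w\<in>V. k w = g w)"
      by (intro exI[of _ "U z"] exI[of _ "h z"]) (use U[OF z] h[OF z] k[OF z] in simp)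
  qed
  moreover have "AE w in lebesgue. w \<in> \<Union>(U ` \<Omega>) \<longrightarrow> f w = k w"
  proof (rule AE_in_Union_open)
    fix V assume "V \<in> U ` \<Omega>"
    then obtain z where z: "z \<in> \<Omega>" "V = U z" by blast
    with U show "open V" by simp
    show "AE w in lebesgue. w \<in> V \<longrightarrow> f w = k w"
      using ae[OF z(1)] by eventually_elim (use k z in auto)
  qed
  then have "AE w in lebesgue. w \<in> \<Omega> \<longrightarrow> f w = k w"
    by eventually_elim (use U(2) in auto)
  ultimately show ?thesis by (rule ae_holomorphicI)
qed

text \<open>Splitting the unit interval into \<open>N\<close> pieces, the error on each is at most \<open>e / N\<close>.\<close>

lemma riemann_sum_error:
  fixes \<phi> :: "real \<Rightarrow> complex"
  assumes cont: "continuous_on {0..1} \<phi>" and N: "0 < N"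
    and osc: "\<And>s t. s \<in> {0..1} \<Longrightarrow> t \<in> {0..1} \<Longrightarrow> \<bar>s - t\<bar> \<le> 1 / real N \<Longrightarrow> cmod (\<phi> s - \<phi> t) \<le> e"
  shows "cmod (integral {0..1} \<phi> - (\<Sum>j<N. \<phi> (real j / real N) / of_nat N)) \<le> e"
proof -
  define x where "x m = real m / real N" for m
  have xs: "x (Suc m) = x m + 1 / real N" for m by (simp add: x_def add_divide_distrib)
  have main: "cmod (integral {0..x m} \<phi> - (\<Sum>j<m. \<phi> (x j) / of_nat N)) \<le> e * x m" if "m \<le> N" for m
    using that
  proof (induction m)
    case (Suc m)
    have x01: "0 \<le> x m" "x m \<le> x (Suc m)" "x (Suc m) \<le> 1"
      using Suc.prems N by (auto simp: x_def field_simps)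
    have c1: "continuous_on {0..x (Suc m)} \<phi>" and c2: "continuous_on {x m..x (Suc m)} \<phi>"
      using x01 by (auto intro: continuous_on_subset[OF cont])
    have "integral {0..x (Suc m)} \<phi> = integral {0..x m} \<phi> + integral {x m..x (Suc m)} \<phi>"
      using x01 c1 by (intro Henstock_Kurzweil_Integration.integral_combine[symmetric] integrable_continuous_interval) auto
    moreover have "integral {x m..x (Suc m)} (\<lambda>t. \<phi> t - \<phi> (x m)) = integral {x m..x (Suc m)} \<phi> - \<phi> (x m) / of_nat N"
      using x01 c2 by (subst integral_diff)
        (auto intro!: integrable_continuous_interval simp: xs scaleR_conv_of_real divide_inverse mult.commute)
    moreover have "cmod (integral {x m..x (Suc m)} (\<lambda>t. \<phi> t - \<phi> (x m))) \<le> e * (x (Suc m) - x m)"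
      using x01 c2 by (intro integral_bound continuous_intros osc) (auto simp: xs)
    moreover have "cmod (integral {0..x m} \<phi> - (\<Sum>j<m. \<phi> (x j) / of_nat N)) \<le> e * x m"
      using Suc by simp
    moreover have "e * x m + e * (x (Suc m) - x m) = e * x (Suc m)" by (simp add: algebra_simps)
    moreover have "integral {0..x (Suc m)} \<phi> - (\<Sum>j<Suc m. \<phi> (x j) / of_nat N) =
      (integral {0..x m} \<phi> - (\<Sum>j<m. \<phi> (x j) / of_nat N)) + integral {x m..x (Suc m)} (\<lambda>t. \<phi> t - \<phi> (x m))"
      using calculation by simp
    ultimately show ?case
      by (metis (no_types, lifting) add_mono norm_triangle_le)
  qed (simp add: x_def)
  from main[of N] N show ?thesis by (simp add: x_def)
qed

text \<open>Riemann sums are finite sums of holomorphic functions and converge locally uniformly, by uniform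
  continuity of the integrand on compact sets.\<close>

lemma holomorphic_funs_integral:
  fixes \<Phi> :: "complex ^ 'n \<Rightarrow> real \<Rightarrow> complex"
  assumes op: "open V" and cont: "continuous_on (V \<times> {0..1}) (\<lambda>(w, t). \<Phi> w t)"
    and hol: "\<And>t. t \<in> {0..1} \<Longrightarrow> (\<lambda>w. \<Phi> w t) \<in> holomorphic_funs V"
  shows "(\<lambda>w. integral {0..1} (\<Phi> w)) \<in> holomorphic_funs V"
proof (rule holomorphic_funs_uniform_limit[OF op,
    where f="\<lambda>N w. \<Sum>j<Suc N. (1 / of_nat (Suc N)) * \<Phi> w (real j / real (Suc N))"])
  show "(\<lambda>w. \<Sum>j<Suc N. (1 / of_nat (Suc N)) * \<Phi> w (real j / real (Suc N))) \<in> holomorphic_funs V" for N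
    by (intro holomorphic_funs_sum holomorphic_funs_cmult hol) auto
  fix z assume "z \<in> V"
  then obtain d where d: "0 < d" "cball z d \<subseteq> V" using op open_contains_cball by blast
  have cpt: "continuous_on (cball z d \<times> {0..1}) (\<lambda>(w, t). \<Phi> w t)"
    by (rule continuous_on_subset[OF cont]) (use d in auto)
  have uc: "uniformly_continuous_on (cball z d \<times> {0..1}) (\<lambda>(w, t). \<Phi> w t)"
    by (rule compact_uniformly_continuous[OF cpt]) (intro compact_Times compact_cball compact_Icc)
  have "uniform_limit (ball z d) (\<lambda>N w. \<Sum>j<Suc N. (1 / of_nat (Suc N)) * \<Phi> w (real j / real (Suc N)))
      (\<lambda>w. integral {0..1} (\<Phi> w)) sequentially"
  proof (rule uniform_limitI)
    fix e :: real assume "0 < e"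
    then obtain \<delta> where \<delta>: "0 < \<delta>" "\<And>p q. p \<in> cball z d \<times> {0..1} \<Longrightarrow> q \<in> cball z d \<times> {0..1} \<Longrightarrow>
        dist q p < \<delta> \<Longrightarrow> dist (case q of (w, t) \<Rightarrow> \<Phi> w t) (case p of (w, t) \<Rightarrow> \<Phi> w t) < e / 2"
      using uc unfolding uniformly_continuous_on_def by (metis half_gt_zero)
    have "\<forall>\<^sub>F N in sequentially. 1 / real (Suc N) < \<delta>"
      using LIMSEQ_inverse_real_of_nat \<delta>(1) by (auto simp: inverse_eq_divide intro: order_tendstoD)
    then show "\<forall>\<^sub>F N in sequentially. \<forall>w\<in>ball z d. dist (\<Sum>j<Suc N. (1 / of_nat (Suc N)) * \<Phi> w (real j / real (Suc N)))
        (integral {0..1} (\<Phi> w)) < e"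
    proof eventually_elim
      case (elim N)
      show ?case
      proof
        fix w assume w: "w \<in> ball z d"
        have "cmod (integral {0..1} (\<Phi> w) - (\<Sum>j<Suc N. \<Phi> w (real j / real (Suc N)) / of_nat (Suc N))) \<le> e / 2"
        proof (rule riemann_sum_error)
          show "continuous_on {0..1} (\<Phi> w)"
            by (rule continuous_on_compose2[OF cpt, of _ "\<lambda>t. (w, t)", simplified]) (use w in \<open>auto intro!: continuous_intros\<close>)
          fix s t :: real assume st: "s \<in> {0..1}" "t \<in> {0..1}" "\<bar>s - t\<bar> \<le> 1 / real (Suc N)"
          have "dist (w, s) (w, t) < \<delta>" using st elim by (simp add: dist_Pair_Pair dist_real_def)
          from \<delta>(2)[OF _ _ this] st w show "cmod (\<Phi> w s - \<Phi> w t) \<le> e / 2"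
            by (simp add: dist_norm)
        qed simp
        with \<open>0 < e\<close> show "dist (\<Sum>j<Suc N. (1 / of_nat (Suc N)) * \<Phi> w (real j / real (Suc N)))
            (integral {0..1} (\<Phi> w)) < e"
          by (simp add: dist_norm norm_minus_commute)
      qed
    qed
  qed
  with d show "\<exists>d>0. ball z d \<subseteq> V \<and> uniform_limit (ball z d)
      (\<lambda>N w. \<Sum>j<Suc N. (1 / of_nat (Suc N)) * \<Phi> w (real j / real (Suc N))) (\<lambda>w. integral {0..1} (\<Phi> w)) sequentially"
    by (intro exI[of _ d]) (auto intro: order_trans[OF ball_subset_cball])
qed

section \<open>Approximation by entire functions\<close>

text \<open>The part of degree \<open>k\<close> in the Taylor expansion of \<open>h\<close> at \<open>0\<close>, read off on the line through \<open>0\<close> and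
  \<open>w\<close>. For small \<open>c\<close> the point \<open>c *s w\<close> lies in any given ball about \<open>0\<close>, so this is meaningful for
  every \<open>w\<close> as soon as \<open>h\<close> is holomorphic near \<open>0\<close>.\<close>

definition homogeneous_part :: "nat \<Rightarrow> (complex ^ 'n \<Rightarrow> complex) \<Rightarrow> complex ^ 'n \<Rightarrow> complex" where
  "homogeneous_part k h w = (deriv ^^ k) (\<lambda>c. h (c *s w)) 0 / fact k"

lemma continuous_on_holomorphic_funs_compose:
  assumes "h \<in> holomorphic_funs \<Omega>" "continuous_on S f" "f ` S \<subseteq> \<Omega>"
  shows "continuous_on S (\<lambda>x. h (f x))"
  using continuous_on_compose2[OF holomorphic_funs_imp_continuous_on[OF assms(1)] assms(2)] assms(3) by blast

lemma holomorphic_funs_scale: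
  assumes h: "h \<in> holomorphic_funs \<Omega>" and op: "open \<Omega>"
  shows "(\<lambda>w. h (c *s w)) \<in> holomorphic_funs {w. c *s w \<in> \<Omega>}"
proof (rule holomorphic_funsI_lines)
  show "open {w. c *s w \<in> \<Omega>}"
    using open_vimage[OF op, of "\<lambda>w. c *s w"] by (simp add: vimage_def continuous_on_complex_line)
  show "continuous_on {w. c *s w \<in> \<Omega>} (\<lambda>w. h (c *s w))"
    by (rule continuous_on_holomorphic_funs_compose[OF h]) (auto intro!: continuous_intros)
  fix z v
  show "(\<lambda>d. h (c *s (z + d *s v))) holomorphic_on {d. z + d *s v \<in> {w. c *s w \<in> \<Omega>}}"
    using holomorphic_funs_along_line[OF h, of "c *s z" "c *s v"]
    by (simp add: vector_add_ldistrib vector_smult_assoc mult.commute)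
qed

text \<open>Cauchy's formula on a circle of radius \<open>\<epsilon>\<close> writes the Taylor coefficient as a parameter integral.
  Given a bound for \<open>w\<close>, a small \<open>\<epsilon>\<close> keeps the circle inside the ball where \<open>h\<close> is holomorphic.\<close>

lemma homogeneous_part_entire:
  fixes h :: "complex ^ 'n \<Rightarrow> complex"
  assumes h: "h \<in> holomorphic_funs (ball 0 R)" and R: "0 < R"
  shows "homogeneous_part k h \<in> holomorphic_funs UNIV"
proof (rule holomorphic_funs_local)
  fix z :: "complex ^ 'n"
  define L where "L = norm z + 1"
  define \<epsilon> where "\<epsilon> = R / (2 * L)"
  have L: "0 < L" by (simp add: L_def add_nonneg_pos)
  have \<epsilon>: "0 < \<epsilon>" using L R by (simp add: \<epsilon>_def)
  define e where "e t = of_real \<epsilon> * exp (2 * of_real pi * \<i> * of_real t)" for t :: real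
  have e: "cmod (e t) = \<epsilon>" "e t \<noteq> 0" for t using \<epsilon> by (simp_all add: e_def norm_mult)
  have inb: "c *s w \<in> ball 0 R" if "norm w < L" "cmod c \<le> \<epsilon>" for c and w :: "complex ^ 'n"
  proof -
    have "cmod c * norm w \<le> \<epsilon> * L" using that \<epsilon> by (intro mult_mono) auto
    also have "\<dots> < R" using L R by (simp add: \<epsilon>_def)
    finally show ?thesis by (simp add: norm_vector_scalar_mult)
  qed
  have ce: "continuous_on S e" for S unfolding e_def by (intro continuous_intros)
  have "(\<lambda>w. integral {0..1} (\<lambda>t. (1 / e t ^ k) * h (e t *s w))) \<in> holomorphic_funs (ball 0 L)"
  proof (rule holomorphic_funs_integral)
    show "continuous_on (ball 0 L \<times> {0..1}) (\<lambda>(w, t). (1 / e t ^ k) * h (e t *s w))"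
      unfolding case_prod_beta
      by (intro continuous_intros continuous_on_holomorphic_funs_compose[OF h] continuous_on_compose2[OF ce[of UNIV]])
         (use inb e in \<open>auto simp: dist_norm\<close>)
    show "(\<lambda>w. (1 / e t ^ k) * h (e t *s w)) \<in> holomorphic_funs (ball 0 L)" for t
      by (intro holomorphic_funs_cmult holomorphic_funs_subset[OF holomorphic_funs_scale[OF h]])
         (use inb e in auto)
  qed simp
  moreover have "homogeneous_part k h w = integral {0..1} (\<lambda>t. (1 / e t ^ k) * h (e t *s w))" if w: "w \<in> ball 0 L" for w
  proof -
    have hol: "(\<lambda>c. h (c *s w)) holomorphic_on cball 0 \<epsilon>"
    proof -
      have "cball 0 \<epsilon> \<subseteq> {c. 0 + c *s w \<in> ball 0 R}" using inb[of w] w by (auto simp: subset_eq)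
      from holomorphic_on_subset[OF holomorphic_funs_along_line[OF h] this] show ?thesis by simp
    qed
    have "(deriv ^^ k) (\<lambda>c. h (c *s w)) 0
        = (fact k) / (2 * pi * \<i>) * contour_integral (circlepath 0 \<epsilon>) (\<lambda>u. h (u *s w) / (u - 0) ^ Suc k)"
      using hol \<epsilon> by (intro Cauchy_higher_derivative_integral_circlepath)
        (auto intro: holomorphic_on_imp_continuous_on holomorphic_on_subset)
    moreover have "contour_integral (circlepath 0 \<epsilon>) (\<lambda>u. h (u *s w) / (u - 0) ^ Suc k) =
       integral {0..1} (\<lambda>t. (2 * pi * \<i>) * ((1 / e t ^ k) * h (e t *s w)))"
      unfolding contour_integral_integral
    proof (rule integral_cong)
      fix t :: real assume t: "t \<in> {0..1}"
      have ct: "circlepath 0 \<epsilon> t = e t" by (simp add: circlepath e_def)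
      have "vector_derivative (circlepath 0 \<epsilon>) (at t) = 2 * pi * \<i> * e t"
        by (simp add: vector_derivative_circlepath del: vector_derivative_part_circlepath) (simp add: e_def)
      then show "h (circlepath 0 \<epsilon> t *s w) / (circlepath 0 \<epsilon> t - 0) ^ Suc k * vector_derivative (circlepath 0 \<epsilon>) (at t)
          = 2 * pi * \<i> * (1 / e t ^ k * h (e t *s w))"
        using e[of t] by (simp add: ct field_simps)
    qed
    ultimately show ?thesis
      unfolding homogeneous_part_def by (simp only: integral_mult_right) simp
  qed
  ultimately show "\<exists>U g. open U \<and> z \<in> U \<and> g \<in> holomorphic_funs U \<and> (\<forall>w\<in>U. homogeneous_part k h w = g w)"
    by (intro exI[of _ "ball 0 L"] exI conjI) (auto simp: L_def)
qed

text \<open>Partial sums of the expansion into homogeneous parts. On the smaller ball the discs in the lines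
  have a radius \<open>\<rho> > 1\<close>, and Cauchy's estimates give a geometric series.\<close>

lemma entire_approximation:
  fixes h :: "complex ^ 'n \<Rightarrow> complex"
  assumes h: "h \<in> holomorphic_funs (ball 0 R)" and r: "0 < r" "r < R" and e: "0 < e"
  shows "\<exists>p\<in>holomorphic_funs UNIV. \<forall>w\<in>ball 0 r. cmod (h w - p w) \<le> e"
proof -
  \<comment> \<open>The discs of radius \<open>\<rho>\<close> in the lines through points of norm less than \<open>r\<close> stay inside \<open>R\<close>.\<close>
  define \<rho> where "\<rho> = (r + R) / (2 * r)"
  have \<rho>: "1 < \<rho>" "r * \<rho> < R" using r by (auto simp: \<rho>_def field_simps)
  have "compact (h ` cball 0 (r * \<rho>))"
    using \<rho> by (intro compact_continuous_image continuous_on_subset[OF holomorphic_funs_imp_continuous_on[OF h]]) auto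
  then obtain M where M: "0 < M" "\<And>w. w \<in> cball 0 (r * \<rho>) \<Longrightarrow> cmod (h w) \<le> M"
    using compact_imp_bounded bounded_pos by (metis imageI)
  have inb: "c *s w \<in> cball 0 (r * \<rho>)" if "norm w < r" "cmod c \<le> \<rho>" for c and w :: "complex ^ 'n"
  proof -
    have "cmod c * norm w \<le> \<rho> * r" using that \<rho> by (intro mult_mono) auto
    then show ?thesis by (simp add: norm_vector_scalar_mult mult.commute)
  qed
  have hol: "(\<lambda>c. h (c *s w)) holomorphic_on cball 0 \<rho>" if "w \<in> ball 0 r" for w
  proof -
    have "cball 0 \<rho> \<subseteq> {c. 0 + c *s w \<in> ball 0 R}"
    proof
      fix c :: complex assume "c \<in> cball 0 \<rho>"
      then have "norm (c *s w) \<le> r * \<rho>" using inb[of w c] that by simp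
      then show "c \<in> {c. 0 + c *s w \<in> ball 0 R}" using \<rho>(2) by simp
    qed
    from holomorphic_on_subset[OF holomorphic_funs_along_line[OF h] this] show ?thesis by simp
  qed
  have bound: "cmod (homogeneous_part k h w) \<le> M * (1 / \<rho>) ^ k" if w: "w \<in> ball 0 r" for k w
  proof -
    have "cmod ((deriv ^^ k) (\<lambda>c. h (c *s w)) 0) \<le> fact k * M / \<rho> ^ k"
    proof (rule Cauchy_inequality)
      show "(\<lambda>c. h (c *s w)) holomorphic_on ball 0 \<rho>"
        by (rule holomorphic_on_subset[OF hol[OF w]]) auto
      show "continuous_on (cball 0 \<rho>) (\<lambda>c. h (c *s w))" by (rule holomorphic_on_imp_continuous_on[OF hol[OF w]])
      fix c :: complex assume "norm (0 - c) = \<rho>"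
      then show "cmod (h (c *s w)) \<le> M" using w by (intro M inb) auto
    qed (use \<rho> in auto)
    then show ?thesis by (simp add: homogeneous_part_def norm_divide field_simps)
  qed
  have sums: "(\<lambda>k. homogeneous_part k h w) sums h w" if w: "w \<in> ball 0 r" for w
    using holomorphic_power_series[of "\<lambda>c. h (c *s w)" 0 \<rho> 1] holomorphic_on_subset[OF hol[OF w], of "ball 0 \<rho>"] \<rho>
    by (simp add: homogeneous_part_def)
  have "uniform_limit (ball 0 r) (\<lambda>N w. \<Sum>k<N. homogeneous_part k h w) (\<lambda>w. \<Sum>k. homogeneous_part k h w) sequentially"
  proof (rule Weierstrass_m_test)
    show "summable (\<lambda>k. M * (1 / \<rho>) ^ k)" using \<rho> by (intro summable_mult summable_geometric) auto
  qed (use bound in auto)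
  from uniform_limitD[OF this e] obtain N where
    "\<forall>w\<in>ball 0 r. dist (\<Sum>k<N. homogeneous_part k h w) (\<Sum>k. homogeneous_part k h w) < e"
    using eventually_happens[of _ sequentially] by auto
  then have "\<forall>w\<in>ball 0 r. cmod (h w - (\<Sum>k<N. homogeneous_part k h w)) \<le> e"
    using sums_unique[OF sums] by (metis dist_commute dist_norm less_imp_le)
  moreover have "(\<lambda>w. \<Sum>k<N. homogeneous_part k h w) \<in> holomorphic_funs UNIV"
    using r by (intro holomorphic_funs_sum homogeneous_part_entire[OF h]) auto
  ultimately show ?thesis by (intro bexI[of _ "\<lambda>w. \<Sum>k<N. homogeneous_part k h w"])
qed

section \<open>Splitting a holomorphic function on the overlap of two boxes\<close>

lemma mem_box_vec: "x \<in> box a b \<longleftrightarrow> (\<forall>j. x $ j \<in> box (a $ j) (b $ j :: complex))"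
  unfolding mem_box by (auto simp: Basis_vec_def inner_axis)

definition vec_upd :: "complex ^ 'n \<Rightarrow> 'n \<Rightarrow> complex \<Rightarrow> complex ^ 'n" where
  "vec_upd w i \<zeta> = (\<chi> j. if j = i then \<zeta> else w $ j)"

lemma vec_upd_nth [simp]: "vec_upd w i \<zeta> $ j = (if j = i then \<zeta> else w $ j)"
  by (simp add: vec_upd_def)

lemma continuous_on_vec_upd [continuous_intros]:
  "continuous_on S f \<Longrightarrow> continuous_on S g \<Longrightarrow> continuous_on S (\<lambda>x. vec_upd (f x) i (g x))"
  unfolding vec_upd_def continuous_on_def
  by (intro ballI vec_tendstoI) (simp add: tendsto_vec_nth)

lemma vec_upd_line: "vec_upd (w + c *s v) i \<zeta> = vec_upd w i \<zeta> + c *s vec_upd v i 0"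
  by (simp add: vec_eq_iff)

lemma vec_upd_line': "vec_upd w i (\<zeta> + c) = vec_upd w i \<zeta> + c *s axis i 1"
  by (simp add: vec_eq_iff axis_def)

text \<open>The contribution of one edge of a rectangle to Cauchy's integral formula in the \<open>i\<close>-th coordinate.\<close>

definition edge_integral :: "(complex ^ 'n \<Rightarrow> complex) \<Rightarrow> 'n \<Rightarrow> complex \<Rightarrow> complex \<Rightarrow> complex ^ 'n \<Rightarrow> complex" where
  "edge_integral g i p q w = contour_integral (linepath p q) (\<lambda>\<zeta>. g (vec_upd w i \<zeta>) / (\<zeta> - w $ i)) / (2 * pi * \<i>)"

text \<open>The Cauchy kernel is singular on the edge only, so the \<open>i\<close>-th coordinate may move anywhere off the
  edge; this is what makes the contribution of an edge holomorphic far beyond the rectangle.\<close>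

lemma edge_integral_holomorphic:
  fixes g :: "complex ^ 'n \<Rightarrow> complex" and a b :: "complex ^ 'n"
  assumes g: "g \<in> holomorphic_funs (box a b)" and pq: "p \<in> box (a $ i) (b $ i)" "q \<in> box (a $ i) (b $ i)"
  shows "edge_integral g i p q \<in> holomorphic_funs {w. (\<forall>j. j \<noteq> i \<longrightarrow> w $ j \<in> box (a $ j) (b $ j)) \<and> w $ i \<notin> closed_segment p q}"
    (is "_ \<in> holomorphic_funs ?W")
proof -
  have seg: "linepath p q t \<in> closed_segment p q" if "t \<in> {0..1}" for t
    using that linepath_in_path by blast
  have cl: "continuous_on S (\<lambda>x. linepath p q (snd x))" for S :: "((complex ^ 'n) \<times> real) set"
    by (intro continuous_on_compose2[OF continuous_on_linepath[of UNIV]] continuous_intros) auto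
  have sub: "closed_segment p q \<subseteq> box (a $ i) (b $ i)"
    using pq by (simp add: closed_segment_subset)
  have inb: "vec_upd w i \<zeta> \<in> box a b" if "w \<in> ?W" "\<zeta> \<in> closed_segment p q" for w \<zeta>
    using that sub by (auto simp: mem_box_vec)
  have op: "open ?W"
  proof -
    have "?W = (\<Inter>j\<in>UNIV - {i}. (\<lambda>w. w $ j) -` box (a $ j) (b $ j)) \<inter> (\<lambda>w. w $ i) -` (- closed_segment p q)"
      by auto
    also have "open \<dots>"
      by (intro open_Int open_INT ballI open_vimage_vec_nth open_Compl closed_segment) auto
    finally show ?thesis .
  qed
  have "(\<lambda>w. integral {0..1} (\<lambda>t. g (vec_upd w i (linepath p q t)) / (linepath p q t - w $ i))) \<in> holomorphic_funs ?W"
  proof (rule holomorphic_funs_integral[OF op])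
    show "continuous_on (?W \<times> {0..1}) (\<lambda>(w, t). g (vec_upd w i (linepath p q t)) / (linepath p q t - w $ i))"
      unfolding case_prod_beta
    proof (intro continuous_intros continuous_on_holomorphic_funs_compose[OF g])
      show "(\<lambda>x. vec_upd (fst x) i (linepath p q (snd x))) ` (?W \<times> {0..1}) \<subseteq> box a b"
        using inb seg by auto
      show "\<forall>x\<in>?W \<times> {0..1}. linepath p q (snd x) - fst x $ i \<noteq> 0"
      proof
        fix x :: "(complex ^ 'n) \<times> real" assume "x \<in> ?W \<times> {0..1}"
        then show "linepath p q (snd x) - fst x $ i \<noteq> 0"
          using seg[of "snd x"] by (cases x) fastforce
      qed
    qed (rule cl)+
    fix t :: real assume t: "t \<in> {0..1}"
    define \<zeta> where "\<zeta> = linepath p q t"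
    have \<zeta>: "\<zeta> \<in> closed_segment p q" using seg[OF t] by (simp add: \<zeta>_def)
    have "(\<lambda>w. g (vec_upd w i \<zeta>) / (\<zeta> - w $ i)) \<in> holomorphic_funs ?W"
    proof (rule holomorphic_funsI_lines[OF op])
      show "continuous_on ?W (\<lambda>w. g (vec_upd w i \<zeta>) / (\<zeta> - w $ i))"
      proof (intro continuous_intros continuous_on_holomorphic_funs_compose[OF g])
        show "(\<lambda>w. vec_upd w i \<zeta>) ` ?W \<subseteq> box a b" using inb \<zeta> by blast
      qed (use \<zeta> in auto)
      fix z v
      have "(\<lambda>c. g (vec_upd (z + c *s v) i \<zeta>)) holomorphic_on {c. z + c *s v \<in> ?W}"
        unfolding vec_upd_line
        by (rule holomorphic_on_subset[OF holomorphic_funs_along_line[OF g]])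
           (use inb \<zeta> in \<open>auto simp: vec_upd_line[symmetric]\<close>)
      then show "(\<lambda>c. g (vec_upd (z + c *s v) i \<zeta>) / (\<zeta> - (z + c *s v) $ i)) holomorphic_on {c. z + c *s v \<in> ?W}"
        using \<zeta> by (intro holomorphic_on_divide) (auto intro!: holomorphic_intros)
    qed
    then show "(\<lambda>w. g (vec_upd w i (linepath p q t)) / (linepath p q t - w $ i)) \<in> holomorphic_funs ?W"
      by (simp add: \<zeta>_def)
  qed
  note holomorphic_funs_cmult[OF this, of "(q - p) / (2 * pi * \<i>)"]
  moreover have "edge_integral g i p q = (\<lambda>w. (q - p) / (2 * pi * \<i>) *
      integral {0..1} (\<lambda>t. g (vec_upd w i (linepath p q t)) / (linepath p q t - w $ i)))"
    by (rule ext) (simp only: edge_integral_def contour_integral_integral vector_derivative_linepath_at integral_mult_left, simp)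
  ultimately show ?thesis by simp
qed

lemma edge_integral_sum:
  fixes g :: "complex ^ 'n \<Rightarrow> complex" and a b :: "complex ^ 'n"
  assumes g: "g \<in> holomorphic_funs (box a b)" and pq: "cbox p q \<subseteq> box (a $ i) (b $ i)"
    and w: "\<And>j. j \<noteq> i \<Longrightarrow> w $ j \<in> box (a $ j) (b $ j)" "w $ i \<in> box p q"
  shows "g w = edge_integral g i p (Complex (Re q) (Im p)) w + edge_integral g i (Complex (Re q) (Im p)) q w
    + edge_integral g i q (Complex (Re p) (Im q)) w + edge_integral g i (Complex (Re p) (Im q)) p w"
proof -
  define f where "f \<zeta> = g (vec_upd w i \<zeta>)" for \<zeta>
  let ?B = "box (a $ i) (b $ i)"
  have hol: "f holomorphic_on ?B"
  proof -
    have "(\<lambda>c. g (vec_upd w i 0 + c *s axis i 1)) holomorphic_on ?B"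
      by (rule holomorphic_on_subset[OF holomorphic_funs_along_line[OF g]])
         (use w(1) in \<open>auto simp: vec_upd_line'[symmetric] mem_box_vec\<close>)
    then show ?thesis unfolding f_def[abs_def] by (simp add: vec_upd_line'[symmetric])
  qed
  have pq': "Re p < Re q" "Im p < Im q" using w(2) by (auto simp: in_box_complex_iff)
  have wB: "w $ i \<in> ?B" using w(2) pq box_subset_cbox by blast
  have im: "path_image (rectpath p q) \<subseteq> ?B - {w $ i}"
    using path_image_rectpath_cbox_minus_box[of p q] pq' pq w(2) by auto
  have "((\<lambda>\<zeta>. f \<zeta> / (\<zeta> - w $ i)) has_contour_integral (2*pi * \<i> * winding_number (rectpath p q) (w $ i) * f (w $ i))) (rectpath p q)"
    by (rule Cauchy_integral_formula_convex_simple[OF _ hol]) (use im wB in \<open>auto simp: interior_open[OF open_box]\<close>)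
  moreover have "winding_number (rectpath p q) (w $ i) = 1"
    by (rule winding_number_rectpath[OF w(2)])
  moreover have "f (w $ i) = g w"
  proof -
    have "vec_upd w i (w $ i) = w" by (simp add: vec_eq_iff)
    then show ?thesis by (simp add: f_def)
  qed
  ultimately have ci: "((\<lambda>\<zeta>. f \<zeta> / (\<zeta> - w $ i)) has_contour_integral (2*pi * \<i> * g w)) (rectpath p q)" by simp
  let ?F = "\<lambda>\<zeta>. f \<zeta> / (\<zeta> - w $ i)"
  let ?p' = "Complex (Re q) (Im p)" and ?q' = "Complex (Re p) (Im q)"
  have rp: "rectpath p q = linepath p ?p' +++ linepath ?p' q +++ linepath q ?q' +++ linepath ?q' p"
    by (simp add: rectpath_def Let_def)
  have pim: "path_image (rectpath p q) = closed_segment p ?p' \<union> closed_segment ?p' q \<union> closed_segment q ?q' \<union> closed_segment ?q' p"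
    unfolding rp by (auto simp: path_image_join)
  have int: "?F contour_integrable_on linepath x y" if "closed_segment x y \<subseteq> path_image (rectpath p q)" for x y
    by (rule contour_integrable_continuous_linepath, rule holomorphic_on_imp_continuous_on,
        intro holomorphic_on_divide holomorphic_on_subset[OF hol] holomorphic_intros) (use that im in auto)
  have ints: "?F contour_integrable_on linepath p ?p'" "?F contour_integrable_on linepath ?p' q"
    "?F contour_integrable_on linepath q ?q'" "?F contour_integrable_on linepath ?q' p"
    by (rule int; auto simp: pim)+
  have "2*pi * \<i> * g w = contour_integral (rectpath p q) ?F"
    using contour_integral_unique[OF ci] by simp
  also have "\<dots> = contour_integral (linepath p ?p') ?F + (contour_integral (linepath ?p' q) ?F +
     (contour_integral (linepath q ?q') ?F + contour_integral (linepath ?q' p) ?F))"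
    unfolding rp using ints by (simp add: contour_integrable_joinI)
  finally show ?thesis
    unfolding edge_integral_def f_def[symmetric] by (simp add: field_simps)
qed

text \<open>Of the four edges of the rectangle in the plane of the coordinate to which \<open>e\<close> belongs, the one where
  \<open>e\<close> is largest gives \<open>g1\<close>, which is therefore holomorphic below this edge. The other three give \<open>g2\<close>:
  the opposite edge is harmless above it, and the two remaining edges are avoided because the other real
  coordinate in this plane stays strictly inside its range.\<close>

lemma additive_splitting:
  fixes g :: "complex ^ 'n \<Rightarrow> complex" and a b :: "complex ^ 'n"
  assumes g: "g \<in> holomorphic_funs (box a b)" and e: "e \<in> Basis" and \<delta>: "0 < \<delta>"
    and ab: "\<And>k. k \<in> Basis \<Longrightarrow> a \<bullet> k + \<delta> < b \<bullet> k - \<delta>"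
  shows "\<exists>g1 g2.
     g1 \<in> holomorphic_funs {w. (\<forall>k\<in>Basis - {e}. a \<bullet> k + \<delta> < w \<bullet> k \<and> w \<bullet> k < b \<bullet> k - \<delta>) \<and> w \<bullet> e < b \<bullet> e - \<delta>} \<and>
     g2 \<in> holomorphic_funs {w. (\<forall>k\<in>Basis - {e}. a \<bullet> k + \<delta> < w \<bullet> k \<and> w \<bullet> k < b \<bullet> k - \<delta>) \<and> a \<bullet> e + \<delta> < w \<bullet> e} \<and>
     (\<forall>w\<in>box (a + \<delta> *\<^sub>R One) (b - \<delta> *\<^sub>R One). g w = g1 w + g2 w)"
proof -
  obtain i u where iu: "e = axis i u" "u \<in> Basis" using e by (auto simp: Basis_vec_def)
  have u: "u = 1 \<or> u = \<i>" using iu(2) by (auto simp: Basis_complex_def)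
  have axis_Basis: "axis j 1 \<in> (Basis :: (complex ^ 'n) set)" "axis j \<i> \<in> (Basis :: (complex ^ 'n) set)" for j
    by (auto simp: Basis_vec_def Basis_complex_def)
  have axis_inner: "x \<bullet> axis j 1 = Re (x $ j)" "x \<bullet> axis j \<i> = Im (x $ j)" for x :: "complex ^ 'n" and j
    by (simp_all add: inner_axis inner_complex_def)
  define p where "p = a $ i + Complex \<delta> \<delta>"
  define q where "q = b $ i - Complex \<delta> \<delta>"
  have abR: "Re (a $ j) + \<delta> < Re (b $ j) - \<delta>" "Im (a $ j) + \<delta> < Im (b $ j) - \<delta>" for j
    using ab[OF axis_Basis(1)[of j]] ab[OF axis_Basis(2)[of j]] by (simp_all add: axis_inner)
  have pq: "cbox p q \<subseteq> box (a $ i) (b $ i)"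
    using \<delta> by (auto simp: in_box_complex_iff in_cbox_complex_iff p_def q_def)
  let ?D1 = "{w. (\<forall>k\<in>Basis - {e}. a \<bullet> k + \<delta> < w \<bullet> k \<and> w \<bullet> k < b \<bullet> k - \<delta>) \<and> w \<bullet> e < b \<bullet> e - \<delta>}"
  let ?D2 = "{w. (\<forall>k\<in>Basis - {e}. a \<bullet> k + \<delta> < w \<bullet> k \<and> w \<bullet> k < b \<bullet> k - \<delta>) \<and> a \<bullet> e + \<delta> < w \<bullet> e}"
  let ?R = "box (a + \<delta> *\<^sub>R One) (b - \<delta> *\<^sub>R One)"
  let ?p' = "Complex (Re q) (Im p)" and ?q' = "Complex (Re p) (Im q)"
  let ?W = "\<lambda>x y. {w. (\<forall>j. j \<noteq> i \<longrightarrow> w $ j \<in> box (a $ j) (b $ j)) \<and> w $ i \<notin> closed_segment x y}"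
  have corners: "p \<in> box (a $ i) (b $ i)" "q \<in> box (a $ i) (b $ i)" "?p' \<in> box (a $ i) (b $ i)" "?q' \<in> box (a $ i) (b $ i)"
    using abR[of i] \<delta> by (auto simp: in_box_complex_iff p_def q_def)
  have hol: "edge_integral g i x y \<in> holomorphic_funs D"
    if "x \<in> box (a $ i) (b $ i)" "y \<in> box (a $ i) (b $ i)" "D \<subseteq> ?W x y" for x y D
    using edge_integral_holomorphic[OF g that(1,2)] that(3) by (rule holomorphic_funs_subset)
  have other: "w $ j \<in> box (a $ j) (b $ j)"
    if "\<forall>k\<in>Basis - {e}. a \<bullet> k + \<delta> < w \<bullet> k \<and> w \<bullet> k < b \<bullet> k - \<delta>" "j \<noteq> i" for w j
  proof -
    have "axis j 1 \<noteq> e" "axis j \<i> \<noteq> e" using that(2) u by (auto simp: iu axis_eq_axis)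
    then show ?thesis
      using that(1)[rule_format, of "axis j 1"] that(1)[rule_format, of "axis j \<i>"] \<delta> axis_Basis[of j]
      by (simp add: axis_inner in_box_complex_iff)
  qed
  have segR: "Re z = Re x" if "z \<in> closed_segment x y" "Re x = Re y" for x y z
    using that by (auto simp: closed_segment_def left_diff_distrib)
  have segI: "Im z = Im x" if "z \<in> closed_segment x y" "Im x = Im y" for x y z
    using that by (auto simp: closed_segment_def left_diff_distrib)
  have inR: "w $ i \<in> box p q \<and> (\<forall>j. j \<noteq> i \<longrightarrow> w $ j \<in> box (a $ j) (b $ j))" if "w \<in> ?R" for w
  proof -
    have *: "a \<bullet> k + \<delta> < w \<bullet> k \<and> w \<bullet> k < b \<bullet> k - \<delta>" if "k \<in> Basis" for k
      using \<open>w \<in> ?R\<close> that by (auto simp: mem_box inner_simps)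
    then show ?thesis
      using other[of w] *[OF axis_Basis(1)[of i]] *[OF axis_Basis(2)[of i]]
      by (auto simp: axis_inner in_box_complex_iff p_def q_def)
  qed
  have sum: "g w = edge_integral g i p ?p' w + edge_integral g i ?p' q w
    + edge_integral g i q ?q' w + edge_integral g i ?q' p w" if "w \<in> ?R" for w
    using inR[OF that] by (intro edge_integral_sum[OF g pq]) auto
  have holR: "edge_integral g i x y \<in> holomorphic_funs D"
    if "x \<in> box (a $ i) (b $ i)" "y \<in> box (a $ i) (b $ i)" "Re x = Re y"
      "\<And>w. w \<in> D \<Longrightarrow> (\<forall>k\<in>Basis - {e}. a \<bullet> k + \<delta> < w \<bullet> k \<and> w \<bullet> k < b \<bullet> k - \<delta>) \<and> Re (w $ i) \<noteq> Re x" for x y D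
    using that(4) other segR[OF _ that(3)] by (intro hol that(1,2)) blast
  have holI: "edge_integral g i x y \<in> holomorphic_funs D"
    if "x \<in> box (a $ i) (b $ i)" "y \<in> box (a $ i) (b $ i)" "Im x = Im y"
      "\<And>w. w \<in> D \<Longrightarrow> (\<forall>k\<in>Basis - {e}. a \<bullet> k + \<delta> < w \<bullet> k \<and> w \<bullet> k < b \<bullet> k - \<delta>) \<and> Im (w $ i) \<noteq> Im x" for x y D
    using that(4) other segI[OF _ that(3)] by (intro hol that(1,2)) blast
  from u show ?thesis
  proof
    assume u: "u = 1"
    have im: "a \<bullet> axis i \<i> + \<delta> < w \<bullet> axis i \<i> \<and> w \<bullet> axis i \<i> < b \<bullet> axis i \<i> - \<delta>"
      if "\<forall>k\<in>Basis - {e}. a \<bullet> k + \<delta> < w \<bullet> k \<and> w \<bullet> k < b \<bullet> k - \<delta>" for w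
      using that axis_Basis[of i] by (auto simp: iu u axis_eq_axis)
    have D2: "Re p < Re (w $ i) \<and> Im p < Im (w $ i) \<and> Im (w $ i) < Im q" if "w \<in> ?D2" for w
      using that im[of w] by (simp add: iu u axis_inner p_def q_def)
    have 1: "edge_integral g i ?p' q \<in> holomorphic_funs ?D1"
      by (rule holR[OF corners(3,2)]) (simp_all add: iu u axis_inner q_def)
    have "edge_integral g i p ?p' \<in> holomorphic_funs ?D2" "edge_integral g i q ?q' \<in> holomorphic_funs ?D2"
      by (rule holI; use corners D2 in fastforce)+
    moreover have "edge_integral g i ?q' p \<in> holomorphic_funs ?D2"
      by (rule holR; use corners D2 in fastforce)
    ultimately have 2: "(\<lambda>w. edge_integral g i p ?p' w + edge_integral g i q ?q' w + edge_integral g i ?q' p w) \<in> holomorphic_funs ?D2"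
      by (intro holomorphic_funs_add)
    show ?thesis
      by (intro exI conjI, rule 1, rule 2) (use sum in \<open>simp add: algebra_simps\<close>)
  next
    assume u: "u = \<i>"
    have re: "a \<bullet> axis i 1 + \<delta> < w \<bullet> axis i 1 \<and> w \<bullet> axis i 1 < b \<bullet> axis i 1 - \<delta>"
      if "\<forall>k\<in>Basis - {e}. a \<bullet> k + \<delta> < w \<bullet> k \<and> w \<bullet> k < b \<bullet> k - \<delta>" for w
      using that axis_Basis[of i] by (auto simp: iu u axis_eq_axis)
    have D2: "Im p < Im (w $ i) \<and> Re p < Re (w $ i) \<and> Re (w $ i) < Re q" if "w \<in> ?D2" for w
      using that re[of w] by (simp add: iu u axis_inner p_def q_def)
    have 1: "edge_integral g i q ?q' \<in> holomorphic_funs ?D1"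
      by (rule holI[OF corners(2,4)]) (simp_all add: iu u axis_inner q_def)
    have "edge_integral g i ?p' q \<in> holomorphic_funs ?D2" "edge_integral g i ?q' p \<in> holomorphic_funs ?D2"
      by (rule holR; use corners D2 in fastforce)+
    moreover have "edge_integral g i p ?p' \<in> holomorphic_funs ?D2"
      by (rule holI; use corners D2 in fastforce)
    ultimately have 2: "(\<lambda>w. edge_integral g i p ?p' w + edge_integral g i ?p' q w + edge_integral g i ?q' p w) \<in> holomorphic_funs ?D2"
      by (intro holomorphic_funs_add)
    show ?thesis
      by (intro exI conjI, rule 1, rule 2) (use sum in \<open>simp add: algebra_simps\<close>)
  qed
qed

section \<open>The additive Cousin problem\<close>

text \<open>\<open>F\<close> solves the additive Cousin problem on \<open>U\<close> for the local data \<open>\<Phi> z\<close> on the unit balls about the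
  points \<open>z\<close> of \<open>Z\<close>.\<close>

definition glues_on :: "(complex ^ 'n) set \<Rightarrow> (complex ^ 'n \<Rightarrow> complex ^ 'n \<Rightarrow> complex) \<Rightarrow> (complex ^ 'n) set \<Rightarrow>
    (complex ^ 'n \<Rightarrow> complex) \<Rightarrow> bool" where
  "glues_on Z \<Phi> U F \<longleftrightarrow> (\<forall>z\<in>Z. (\<lambda>w. F w - \<Phi> z w) \<in> ae_holomorphic (U \<inter> ball z 1))"

lemma glues_on_subset: "glues_on Z \<Phi> U F \<Longrightarrow> V \<subseteq> U \<Longrightarrow> glues_on Z \<Phi> V F"
  unfolding glues_on_def by (blast intro: ae_holomorphic_subset)

context
  fixes Z :: "(complex ^ 'n) set" and \<Phi> :: "complex ^ 'n \<Rightarrow> complex ^ 'n \<Rightarrow> complex"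
  assumes cover: "\<And>p. \<exists>z\<in>Z. dist z p < 1 / 2"
    and cocycle: "\<And>z z'. z \<in> Z \<Longrightarrow> z' \<in> Z \<Longrightarrow> (\<lambda>w. \<Phi> z w - \<Phi> z' w) \<in> ae_holomorphic (ball z 1 \<inter> ball z' 1)"
begin

lemma glues_on_diff:
  assumes "open U" "glues_on Z \<Phi> U F" "glues_on Z \<Phi> U G"
  shows "(\<lambda>w. F w - G w) \<in> ae_holomorphic U"
proof (rule ae_holomorphic_local)
  fix p assume p: "p \<in> U"
  obtain z where z: "z \<in> Z" "dist z p < 1 / 2" using cover by blast
  have "(\<lambda>w. (F w - \<Phi> z w) - (G w - \<Phi> z w)) \<in> ae_holomorphic (U \<inter> ball z 1)"
    by (rule ae_holomorphic_diff) (use assms z in \<open>auto simp: glues_on_def\<close>)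
  then have "(\<lambda>w. F w - G w) \<in> ae_holomorphic (U \<inter> ball z 1)" by simp
  moreover have "open (U \<inter> ball z 1)" "p \<in> U \<inter> ball z 1" using assms p z by auto
  ultimately show "\<exists>V. open V \<and> p \<in> V \<and> (\<lambda>w. F w - G w) \<in> ae_holomorphic V" by blast
qed

lemma glues_on_ball_half: "\<exists>F. glues_on Z \<Phi> (ball p (1 / 2)) F"
proof -
  obtain z where z: "z \<in> Z" "dist z p < 1 / 2" using cover by blast
  have "ball p (1 / 2) \<subseteq> ball z 1"
  proof
    fix x assume "x \<in> ball p (1 / 2)"
    then show "x \<in> ball z 1" using dist_triangle[of z x p] z by simp
  qed
  then have "(\<lambda>w. \<Phi> z w - \<Phi> z' w) \<in> ae_holomorphic (ball p (1 / 2) \<inter> ball z' 1)" if "z' \<in> Z" for z'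
    using ae_holomorphic_subset[OF cocycle[OF z(1) that]] by blast
  then show ?thesis unfolding glues_on_def by blast
qed

definition glueable_near_box :: "complex ^ 'n \<Rightarrow> complex ^ 'n \<Rightarrow> bool" where
  "glueable_near_box a b \<longleftrightarrow> (\<exists>\<eta>>0. \<exists>F. glues_on Z \<Phi> (box (a - \<eta> *\<^sub>R One) (b + \<eta> *\<^sub>R One)) F)"

text \<open>The two solutions differ by a holomorphic function on the overlap of slightly enlarged boxes. After
  splitting it as \<open>g1 + g2\<close> on a smaller enlargement, \<open>F1 - g1\<close> and \<open>F2 + g2\<close> agree almost everywhere on
  the overlap.\<close>

lemma glueable_near_box_merge:
  assumes e: "e \<in> Basis" and ab: "\<And>k. k \<in> Basis \<Longrightarrow> a \<bullet> k \<le> b \<bullet> k" and c: "a \<bullet> e \<le> c" "c \<le> b \<bullet> e"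
    and left: "glueable_near_box a (b + (c - b \<bullet> e) *\<^sub>R e)"
    and right: "glueable_near_box (a + (c - a \<bullet> e) *\<^sub>R e) b"
  shows "glueable_near_box a b"
proof -
  define a' where "a' = a + (c - a \<bullet> e) *\<^sub>R e"
  define b' where "b' = b + (c - b \<bullet> e) *\<^sub>R e"
  have a'k: "a' \<bullet> k = (if k = e then c else a \<bullet> k)" and b'k: "b' \<bullet> k = (if k = e then c else b \<bullet> k)"
    if "k \<in> Basis" for k using that e by (auto simp: a'_def b'_def inner_simps inner_Basis)
  obtain \<eta>1 F1 where 1: "0 < \<eta>1" "glues_on Z \<Phi> (box (a - \<eta>1 *\<^sub>R One) (b' + \<eta>1 *\<^sub>R One)) F1"
    using left unfolding glueable_near_box_def b'_def by blast
  obtain \<eta>2 F2 where 2: "0 < \<eta>2" "glues_on Z \<Phi> (box (a' - \<eta>2 *\<^sub>R One) (b + \<eta>2 *\<^sub>R One)) F2"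
    using right unfolding glueable_near_box_def a'_def by blast
  define \<eta> where "\<eta> = min \<eta>1 \<eta>2"
  have \<eta>: "0 < \<eta>" "\<eta> \<le> \<eta>1" "\<eta> \<le> \<eta>2" using 1 2 by (auto simp: \<eta>_def)
  define L where "L t = box (a - t *\<^sub>R One) (b' + t *\<^sub>R One)" for t
  define R where "R t = box (a' - t *\<^sub>R One) (b + t *\<^sub>R One)" for t
  have inL: "x \<in> L t \<longleftrightarrow> (\<forall>k\<in>Basis. a \<bullet> k - t < x \<bullet> k \<and> x \<bullet> k < b' \<bullet> k + t)" for x t
    by (auto simp: L_def mem_box inner_simps)
  have inR: "x \<in> R t \<longleftrightarrow> (\<forall>k\<in>Basis. a' \<bullet> k - t < x \<bullet> k \<and> x \<bullet> k < b \<bullet> k + t)" for x t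
    by (auto simp: R_def mem_box inner_simps)
  have gL: "glues_on Z \<Phi> (L \<eta>) F1"
    by (rule glues_on_subset[OF 1(2)]) (use \<eta> in \<open>auto simp: L_def mem_box inner_simps\<close>, (fastforce+)?)
  have gR: "glues_on Z \<Phi> (R \<eta>) F2"
    by (rule glues_on_subset[OF 2(2)]) (use \<eta> in \<open>auto simp: R_def mem_box inner_simps\<close>, (fastforce+)?)
  define \<alpha> where "\<alpha> = a' - \<eta> *\<^sub>R One"
  define \<beta> where "\<beta> = b' + \<eta> *\<^sub>R One"
  have \<alpha>k: "\<alpha> \<bullet> k = a' \<bullet> k - \<eta>" and \<beta>k: "\<beta> \<bullet> k = b' \<bullet> k + \<eta>" if "k \<in> Basis" for k
    using that by (simp_all add: \<alpha>_def \<beta>_def inner_simps)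
  have sub: "box \<alpha> \<beta> \<subseteq> L \<eta> \<inter> R \<eta>"
  proof
    fix x assume x: "x \<in> box \<alpha> \<beta>"
    have "a \<bullet> k - \<eta> < x \<bullet> k \<and> x \<bullet> k < b' \<bullet> k + \<eta> \<and> a' \<bullet> k - \<eta> < x \<bullet> k \<and> x \<bullet> k < b \<bullet> k + \<eta>" if k: "k \<in> Basis" for k
    proof -
      have "a' \<bullet> k - \<eta> < x \<bullet> k \<and> x \<bullet> k < b' \<bullet> k + \<eta>" using x k by (auto simp: mem_box \<alpha>k \<beta>k)
      moreover have "a \<bullet> k \<le> a' \<bullet> k" "b' \<bullet> k \<le> b \<bullet> k" using c by (auto simp: a'k[OF k] b'k[OF k])
      ultimately show ?thesis by linarith
    qed
    then show "x \<in> L \<eta> \<inter> R \<eta>" by (simp add: inL inR)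
  qed
  have "(\<lambda>w. F1 w - F2 w) \<in> ae_holomorphic (box \<alpha> \<beta>)"
    by (rule glues_on_diff[OF open_box]) (use gL gR sub in \<open>auto intro: glues_on_subset\<close>)
  then obtain g where g: "g \<in> holomorphic_funs (box \<alpha> \<beta>)" "AE w in lebesgue. w \<in> box \<alpha> \<beta> \<longrightarrow> F1 w - F2 w = g w"
    by (rule ae_holomorphicE)
  have wide: "\<alpha> \<bullet> k + \<eta> / 2 < \<beta> \<bullet> k - \<eta> / 2" if k: "k \<in> Basis" for k
    using \<eta> ab[OF k] by (auto simp: \<alpha>k[OF k] \<beta>k[OF k] a'k[OF k] b'k[OF k])
  obtain g1 g2 where
    g1: "g1 \<in> holomorphic_funs {w. (\<forall>k\<in>Basis - {e}. \<alpha> \<bullet> k + \<eta> / 2 < w \<bullet> k \<and> w \<bullet> k < \<beta> \<bullet> k - \<eta> / 2) \<and> w \<bullet> e < \<beta> \<bullet> e - \<eta> / 2}"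
    and g2: "g2 \<in> holomorphic_funs {w. (\<forall>k\<in>Basis - {e}. \<alpha> \<bullet> k + \<eta> / 2 < w \<bullet> k \<and> w \<bullet> k < \<beta> \<bullet> k - \<eta> / 2) \<and> \<alpha> \<bullet> e + \<eta> / 2 < w \<bullet> e}"
    and g12: "\<forall>w\<in>box (\<alpha> + (\<eta> / 2) *\<^sub>R One) (\<beta> - (\<eta> / 2) *\<^sub>R One). g w = g1 w + g2 w"
    using additive_splitting[OF g(1) e _ wide] \<eta> by auto
  have g1: "g1 \<in> holomorphic_funs (L (\<eta> / 2))"
  proof (rule holomorphic_funs_subset[OF g1], clarify, intro conjI ballI)
    fix x assume x: "x \<in> L (\<eta> / 2)"
    fix k assume k: "k \<in> Basis - {e}"
    with x have "a \<bullet> k - \<eta> / 2 < x \<bullet> k \<and> x \<bullet> k < b' \<bullet> k + \<eta> / 2" by (simp add: inL)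
    with k show "\<alpha> \<bullet> k + \<eta> / 2 < x \<bullet> k" "x \<bullet> k < \<beta> \<bullet> k - \<eta> / 2" by (simp_all add: \<alpha>k \<beta>k a'k)
  next
    fix x assume x: "x \<in> L (\<eta> / 2)"
    then have "x \<bullet> e < b' \<bullet> e + \<eta> / 2" using e by (simp add: inL)
    then show "x \<bullet> e < \<beta> \<bullet> e - \<eta> / 2" using e by (simp add: \<beta>k)
  qed
  have g2: "g2 \<in> holomorphic_funs (R (\<eta> / 2))"
  proof (rule holomorphic_funs_subset[OF g2], clarify, intro conjI ballI)
    fix x assume x: "x \<in> R (\<eta> / 2)"
    fix k assume k: "k \<in> Basis - {e}"
    with x have "a' \<bullet> k - \<eta> / 2 < x \<bullet> k \<and> x \<bullet> k < b \<bullet> k + \<eta> / 2" by (simp add: inR)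
    with k show "\<alpha> \<bullet> k + \<eta> / 2 < x \<bullet> k" "x \<bullet> k < \<beta> \<bullet> k - \<eta> / 2" by (simp_all add: \<alpha>k \<beta>k b'k)
  next
    fix x assume x: "x \<in> R (\<eta> / 2)"
    then have "a' \<bullet> e - \<eta> / 2 < x \<bullet> e" using e by (simp add: inR)
    then show "\<alpha> \<bullet> e + \<eta> / 2 < x \<bullet> e" using e by (simp add: \<alpha>k)
  qed
  \<comment> \<open>The case distinction is immaterial up to a null set: on the overlap both values agree almost everywhere.\<close>
  define F where "F w = (if w \<in> L (\<eta> / 2) then F1 w - g1 w else F2 w + g2 w)" for w
  have FR: "AE w in lebesgue. w \<in> R (\<eta> / 2) \<longrightarrow> F w = F2 w + g2 w"
    using g(2)
  proof eventually_elim
    case (elim w)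
    show ?case
    proof (intro impI)
      assume w: "w \<in> R (\<eta> / 2)"
      show "F w = F2 w + g2 w"
      proof (cases "w \<in> L (\<eta> / 2)")
        case True
        have *: "\<alpha> \<bullet> k + \<eta> / 2 < w \<bullet> k \<and> w \<bullet> k < \<beta> \<bullet> k - \<eta> / 2" if k: "k \<in> Basis" for k
        proof -
          have "a' \<bullet> k - \<eta> / 2 < w \<bullet> k" "w \<bullet> k < b' \<bullet> k + \<eta> / 2"
            using True w k by (simp_all add: inL inR)
          then show ?thesis using k by (simp add: \<alpha>k \<beta>k)
        qed
        then have "w \<in> box (\<alpha> + (\<eta> / 2) *\<^sub>R One) (\<beta> - (\<eta> / 2) *\<^sub>R One)"
          by (simp add: mem_box inner_simps)
        moreover have "w \<in> box \<alpha> \<beta>" using * \<eta>(1) by (fastforce simp: mem_box)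
        ultimately have "F1 w - F2 w = g1 w + g2 w" using elim g12 by simp
        then show ?thesis using True by (simp add: F_def algebra_simps)
      qed (simp add: F_def)
    qed
  qed
  have mono: "L (\<eta> / 2) \<subseteq> L \<eta>" "R (\<eta> / 2) \<subseteq> R \<eta>"
    using \<eta>(1) by (fastforce simp: inL inR)+
  have opL: "open (L t)" "open (R t)" for t unfolding L_def R_def by (rule open_box)+
  have on_L: "(\<lambda>w. F w - \<Phi> z w) \<in> ae_holomorphic (L (\<eta> / 2) \<inter> ball z 1)" if z: "z \<in> Z" for z
  proof (rule ae_holomorphic_cong)
    have "(\<lambda>w. F1 w - \<Phi> z w) \<in> ae_holomorphic (L (\<eta> / 2) \<inter> ball z 1)"
      using gL z mono(1) by (auto simp: glues_on_def intro: ae_holomorphic_subset)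
    then show "(\<lambda>w. (F1 w - \<Phi> z w) - g1 w) \<in> ae_holomorphic (L (\<eta> / 2) \<inter> ball z 1)"
      by (rule ae_holomorphic_diff)
         (auto intro: holomorphic_funs_imp_ae_holomorphic holomorphic_funs_subset[OF g1])
  qed (simp add: F_def)
  have on_R: "(\<lambda>w. F w - \<Phi> z w) \<in> ae_holomorphic (R (\<eta> / 2) \<inter> ball z 1)" if z: "z \<in> Z" for z
  proof (rule ae_holomorphic_cong)
    have "(\<lambda>w. F2 w - \<Phi> z w) \<in> ae_holomorphic (R (\<eta> / 2) \<inter> ball z 1)"
      using gR z mono(2) by (auto simp: glues_on_def intro: ae_holomorphic_subset)
    then show "(\<lambda>w. (F2 w - \<Phi> z w) + g2 w) \<in> ae_holomorphic (R (\<eta> / 2) \<inter> ball z 1)"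
      by (rule ae_holomorphic_add)
         (auto intro: holomorphic_funs_imp_ae_holomorphic holomorphic_funs_subset[OF g2])
    show "AE w in lebesgue. w \<in> R (\<eta> / 2) \<inter> ball z 1 \<longrightarrow> F w - \<Phi> z w = (F2 w - \<Phi> z w) + g2 w"
      using FR by eventually_elim auto
  qed
  have union: "box (a - (\<eta> / 2) *\<^sub>R One) (b + (\<eta> / 2) *\<^sub>R One) \<subseteq> L (\<eta> / 2) \<union> R (\<eta> / 2)"
  proof
    fix x assume "x \<in> box (a - (\<eta> / 2) *\<^sub>R One) (b + (\<eta> / 2) *\<^sub>R One)"
    then have x: "a \<bullet> k - \<eta> / 2 < x \<bullet> k \<and> x \<bullet> k < b \<bullet> k + \<eta> / 2" if "k \<in> Basis" for k
      using that by (simp add: mem_box inner_simps)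
    show "x \<in> L (\<eta> / 2) \<union> R (\<eta> / 2)"
    proof (cases "x \<bullet> e < c + \<eta> / 2")
      case True
      then have "x \<in> L (\<eta> / 2)" using x by (auto simp: inL b'k)
      then show ?thesis ..
    next
      case False
      then have "x \<in> R (\<eta> / 2)" using x \<eta>(1) by (auto simp: inR a'k)
      then show ?thesis ..
    qed
  qed
  have "glues_on Z \<Phi> (L (\<eta> / 2) \<union> R (\<eta> / 2)) F"
    unfolding glues_on_def
  proof (intro ballI ae_holomorphic_local)
    fix z p assume z: "z \<in> Z" and p: "p \<in> (L (\<eta> / 2) \<union> R (\<eta> / 2)) \<inter> ball z 1"
    then consider "p \<in> L (\<eta> / 2) \<inter> ball z 1" | "p \<in> R (\<eta> / 2) \<inter> ball z 1" by blast
    then show "\<exists>U. open U \<and> p \<in> U \<and> (\<lambda>w. F w - \<Phi> z w) \<in> ae_holomorphic U"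
    proof cases
      case 1 then show ?thesis using on_L[OF z] opL by (meson open_Int open_ball)
    next
      case 2 then show ?thesis using on_R[OF z] opL by (meson open_Int open_ball)
    qed
  qed
  with union have "glues_on Z \<Phi> (box (a - (\<eta> / 2) *\<^sub>R One) (b + (\<eta> / 2) *\<^sub>R One)) F"
    by (rule glues_on_subset[rotated])
  then show ?thesis using \<eta>(1) unfolding glueable_near_box_def by (intro exI[of _ "\<eta> / 2"]) auto
qed

text \<open>A box with short sides fits into a ball of radius 1/2, on which one of the local data is a solution.\<close>

lemma glueable_near_small_box:
  assumes \<delta>: "0 < \<delta>" "real DIM(complex ^ 'n) * \<delta> \<le> 1 / 8"
    and small: "\<And>k. k \<in> Basis \<Longrightarrow> b \<bullet> k - a \<bullet> k \<le> \<delta>"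
  shows "glueable_near_box a b"
proof -
  obtain F where F: "glues_on Z \<Phi> (ball a (1 / 2)) F" using glues_on_ball_half by blast
  have "box (a - \<delta> *\<^sub>R One) (b + \<delta> *\<^sub>R One) \<subseteq> ball a (1 / 2)"
  proof
    fix x assume "x \<in> box (a - \<delta> *\<^sub>R One) (b + \<delta> *\<^sub>R One)"
    then have x: "a \<bullet> k - \<delta> < x \<bullet> k \<and> x \<bullet> k < b \<bullet> k + \<delta>" if "k \<in> Basis" for k
      using that by (simp add: mem_box inner_simps)
    have "norm (x - a) \<le> (\<Sum>k\<in>Basis. \<bar>(x - a) \<bullet> k\<bar>)" by (rule norm_le_l1)
    also have "\<dots> \<le> (\<Sum>k\<in>(Basis :: (complex ^ 'n) set). 2 * \<delta>)"
    proof (rule sum_mono)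
      fix k :: "complex ^ 'n" assume "k \<in> Basis"
      with x[of k] small[of k] \<delta>(1) show "\<bar>(x - a) \<bullet> k\<bar> \<le> 2 * \<delta>" by (simp add: inner_simps abs_le_iff)
    qed
    also have "\<dots> = 2 * (real DIM(complex ^ 'n) * \<delta>)" by (simp only: sum_constant mult.left_commute)
    also have "\<dots> \<le> 1 / 4" using \<delta>(2) by linarith
    finally show "x \<in> ball a (1 / 2)" by (simp add: dist_norm norm_minus_commute)
  qed
  then show ?thesis
    unfolding glueable_near_box_def using \<delta>(1) glues_on_subset[OF F] by blast
qed

text \<open>Induction on the set \<open>D\<close> of directions in which the box may be long. A long side in a new direction is
  cut into \<open>N\<close> pieces of length at most \<open>\<delta>\<close>, which are merged one after the other.\<close>

lemma glueable_near_box_of_some_thin_sides: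
  assumes \<delta>: "0 < \<delta>" "real DIM(complex ^ 'n) * \<delta> \<le> 1 / 8"
    and "finite D" "D \<subseteq> Basis" "\<And>k. k \<in> Basis \<Longrightarrow> a \<bullet> k \<le> b \<bullet> k"
    "\<And>k. k \<in> Basis - D \<Longrightarrow> b \<bullet> k - a \<bullet> k \<le> \<delta>"
  shows "glueable_near_box a b"
  using assms(3-)
proof (induction D arbitrary: a b rule: finite_induct)
  case empty
  then show ?case by (intro glueable_near_small_box[OF \<delta>]) auto
next
  case (insert e D)
  have e: "e \<in> Basis" using insert.prems by simp
  have "glueable_near_box a b"
    if "\<And>k. k \<in> Basis \<Longrightarrow> a \<bullet> k \<le> b \<bullet> k" "\<And>k. k \<in> Basis - insert e D \<Longrightarrow> b \<bullet> k - a \<bullet> k \<le> \<delta>"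
      "b \<bullet> e - a \<bullet> e \<le> real N * \<delta>" for N a
    using that
  proof (induction N arbitrary: a)
    case 0
    then have "b \<bullet> k - a \<bullet> k \<le> \<delta>" if "k \<in> Basis - D" for k
      using that \<delta>(1) by (cases "k = e") auto
    then show ?case using 0 insert.prems(1) by (intro insert.IH) auto
  next
    case (Suc N)
    show ?case
    proof (cases "b \<bullet> e - a \<bullet> e \<le> \<delta>")
      case True
      then have "b \<bullet> k - a \<bullet> k \<le> \<delta>" if "k \<in> Basis - D" for k
        using that Suc.prems(2)[of k] by (cases "k = e") auto
      then show ?thesis using Suc.prems(1) insert.prems(1) by (intro insert.IH) auto
    next
      case False
      define c where "c = a \<bullet> e + \<delta>"
      have c: "a \<bullet> e \<le> c" "c \<le> b \<bullet> e" using False \<delta>(1) by (auto simp: c_def)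
      have bk: "(b + (c - b \<bullet> e) *\<^sub>R e) \<bullet> k = (if k = e then c else b \<bullet> k)"
        and ak: "(a + (c - a \<bullet> e) *\<^sub>R e) \<bullet> k = (if k = e then c else a \<bullet> k)" if "k \<in> Basis" for k
        using that e by (auto simp: inner_simps inner_Basis)
      show ?thesis
      proof (rule glueable_near_box_merge[OF e Suc.prems(1) c])
        show "glueable_near_box a (b + (c - b \<bullet> e) *\<^sub>R e)"
        proof (rule insert.IH)
          show "D \<subseteq> Basis" using insert.prems by simp
          show "a \<bullet> k \<le> (b + (c - b \<bullet> e) *\<^sub>R e) \<bullet> k" if "k \<in> Basis" for k
            using Suc.prems(1)[OF that] c that by (simp add: bk)
          show "(b + (c - b \<bullet> e) *\<^sub>R e) \<bullet> k - a \<bullet> k \<le> \<delta>" if "k \<in> Basis - D" for k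
            using Suc.prems(2)[of k] that bk[of k] by (cases "k = e") (auto simp add: c_def)
        qed
        show "glueable_near_box (a + (c - a \<bullet> e) *\<^sub>R e) b"
        proof (rule Suc.IH)
          show "(a + (c - a \<bullet> e) *\<^sub>R e) \<bullet> k \<le> b \<bullet> k" if "k \<in> Basis" for k
            using Suc.prems(1)[OF that] c that by (simp add: ak)
          show "b \<bullet> k - (a + (c - a \<bullet> e) *\<^sub>R e) \<bullet> k \<le> \<delta>" if "k \<in> Basis - insert e D" for k
            using Suc.prems(2)[OF that] that by (simp add: ak)
          show "b \<bullet> e - (a + (c - a \<bullet> e) *\<^sub>R e) \<bullet> e \<le> real N * \<delta>"
            using Suc.prems(3) e by (simp add: ak c_def algebra_simps)
        qed
      qed
    qed
  qed
  moreover obtain N :: nat where "(b \<bullet> e - a \<bullet> e) / \<delta> \<le> real N" using real_arch_simple by blast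
  then have "b \<bullet> e - a \<bullet> e \<le> real N * \<delta>" using \<delta>(1) by (simp add: field_simps)
  ultimately show ?case using insert.prems by auto
qed

lemma glues_on_ball: "\<exists>F. glues_on Z \<Phi> (ball 0 r) F"
proof (cases "0 < r")
  case True
  have "glueable_near_box (- r *\<^sub>R One) (r *\<^sub>R One)"
  proof (rule glueable_near_box_of_some_thin_sides)
    have "0 < real DIM(complex ^ 'n)" using DIM_positive[where 'a="complex ^ 'n"] by linarith
    then show "0 < 1 / (8 * real DIM(complex ^ 'n))" "real DIM(complex ^ 'n) * (1 / (8 * real DIM(complex ^ 'n))) \<le> 1 / 8"
      by (simp_all del: DIM_cart)
    show "Basis \<subseteq> (Basis :: (complex ^ 'n) set)" ..
  qed (use True in auto)
  then obtain \<eta> F where \<eta>: "0 < \<eta>" "glues_on Z \<Phi> (box (- r *\<^sub>R One - \<eta> *\<^sub>R One) (r *\<^sub>R One + \<eta> *\<^sub>R One)) F"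
    unfolding glueable_near_box_def by blast
  have "ball 0 r \<subseteq> box (- r *\<^sub>R One - \<eta> *\<^sub>R One) (r *\<^sub>R One + \<eta> *\<^sub>R One :: complex ^ 'n)"
  proof
    fix x :: "complex ^ 'n" assume "x \<in> ball 0 r"
    then have "\<bar>x \<bullet> k\<bar> < r" if "k \<in> Basis" for k
      using Basis_le_norm[OF that, of x] by simp
    then show "x \<in> box (- r *\<^sub>R One - \<eta> *\<^sub>R One) (r *\<^sub>R One + \<eta> *\<^sub>R One)"
      using \<eta>(1) by (fastforce simp: mem_box inner_simps abs_less_iff)
  qed
  from glues_on_subset[OF \<eta>(2) this] show ?thesis by blast
next
  case False
  then have empty: "ball (0 :: complex ^ 'n) r = {}" by simp
  have "f \<in> ae_holomorphic {}" for f :: "complex ^ 'n \<Rightarrow> complex"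
    by (rule ae_holomorphicI[OF holomorphic_funs_const[of 0]]) simp
  then show ?thesis unfolding glues_on_def empty Int_empty_left by blast
qed

text \<open>Mittag-Leffler argument. Solutions \<open>F m\<close> on growing balls differ by holomorphic functions \<open>d m\<close>, which
  entire functions \<open>p m\<close> approximate up to \<open>1 / 2 ^ m\<close> on smaller balls. Subtracting \<open>p 0 + ... + p (m - 1)\<close>
  from \<open>F m\<close> keeps a solution and makes the sequence converge, and on a fixed ball the limit differs
  from \<open>F m\<close> by a uniformly convergent series of holomorphic functions.\<close>

lemma exists_global_gluing: "\<exists>F. glues_on Z \<Phi> UNIV F"
proof -
  have "\<forall>m. \<exists>F. glues_on Z \<Phi> (ball 0 (real m + 2)) F" using glues_on_ball by blast
  from choice[OF this] obtain F where F: "\<And>m. glues_on Z \<Phi> (ball 0 (real m + 2)) (F m)" by blast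
  have "(\<lambda>w. F (Suc m) w - F m w) \<in> ae_holomorphic (ball 0 (real m + 2))" for m
    by (rule glues_on_diff[OF open_ball glues_on_subset[OF F[of "Suc m"]] F]) auto
  then have "\<forall>m. \<exists>d. d \<in> holomorphic_funs (ball 0 (real m + 2)) \<and>
      (AE w in lebesgue. w \<in> ball 0 (real m + 2) \<longrightarrow> F (Suc m) w - F m w = d w)"
    unfolding ae_holomorphic_def by blast
  from choice[OF this] obtain d where d: "\<And>m. d m \<in> holomorphic_funs (ball 0 (real m + 2))"
    and dF: "\<And>m. AE w in lebesgue. w \<in> ball 0 (real m + 2) \<longrightarrow> F (Suc m) w - F m w = d m w" by blast
  have "\<forall>m. \<exists>p. p \<in> holomorphic_funs UNIV \<and> (\<forall>w\<in>ball 0 (real m + 1). cmod (d m w - p w) \<le> (1 / 2) ^ m)"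
  proof
    fix m :: nat
    show "\<exists>p. p \<in> holomorphic_funs UNIV \<and> (\<forall>w\<in>ball 0 (real m + 1). cmod (d m w - p w) \<le> (1 / 2) ^ m)"
      using entire_approximation[OF d[of m], of "real m + 1" "(1 / 2) ^ m"] by fastforce
  qed
  from choice[OF this] obtain p where p: "\<And>m. p m \<in> holomorphic_funs UNIV"
    and dp: "\<And>m w. w \<in> ball 0 (real m + 1) \<Longrightarrow> cmod (d m w - p m w) \<le> (1 / 2) ^ m" by blast
  define s where "s k w = F k w - (\<Sum>j<k. p j w)" for k w
  define G where "G w = lim (\<lambda>k. s k w)" for w
  define T where "T m w = (\<Sum>i. d (m + i) w - p (m + i) w)" for m w
  have bnd: "cmod (d (m + i) w - p (m + i) w) \<le> (1 / 2) ^ i" if "w \<in> ball 0 (real m + 1)" for m i w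
  proof -
    have "cmod (d (m + i) w - p (m + i) w) \<le> (1 / 2) ^ (m + i)" using that by (intro dp) auto
    also have "\<dots> \<le> (1 / 2) ^ i" by (rule power_decreasing) auto
    finally show ?thesis .
  qed
  have T: "T m \<in> holomorphic_funs (ball 0 (real m + 1))" for m
  proof (rule holomorphic_funs_uniform_limit[where f="\<lambda>n w. \<Sum>i<n. d (m + i) w - p (m + i) w"])
    show "(\<lambda>w. \<Sum>i<n. d (m + i) w - p (m + i) w) \<in> holomorphic_funs (ball 0 (real m + 1))" for n
      by (intro holomorphic_funs_sum holomorphic_funs_diff holomorphic_funs_subset[OF d] holomorphic_funs_subset[OF p]) auto
    fix z :: "complex ^ 'n" assume "z \<in> ball 0 (real m + 1)"
    then obtain e where e: "0 < e" "ball z e \<subseteq> ball 0 (real m + 1)"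
      using open_contains_ball open_ball by blast
    have "uniform_limit (ball z e) (\<lambda>n w. \<Sum>i<n. d (m + i) w - p (m + i) w) (T m) sequentially"
      unfolding T_def
      by (rule Weierstrass_m_test[of _ _ "\<lambda>i. (1 / 2) ^ i"]) (use bnd[of _ m] e in \<open>auto intro!: summable_geometric\<close>)
    with e show "\<exists>d'>0. ball z d' \<subseteq> ball 0 (real m + 1) \<and>
        uniform_limit (ball z d') (\<lambda>n w. \<Sum>i<n. d (m + i) w - p (m + i) w) (T m) sequentially" by blast
  qed simp
  have G: "AE w in lebesgue. w \<in> ball 0 (real m + 1) \<longrightarrow> G w - F m w = T m w - (\<Sum>j<m. p j w)" for m
  proof -
    have "AE w in lebesgue. \<forall>k. w \<in> ball 0 (real k + 2) \<longrightarrow> F (Suc k) w - F k w = d k w"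
      using dF by (simp add: AE_all_countable)
    then show ?thesis
    proof eventually_elim
      case (elim w)
      show ?case
      proof
        assume w: "w \<in> ball 0 (real m + 1)"
        have step: "s (m + i) w = s m w + (\<Sum>i<i. d (m + i) w - p (m + i) w)" for i
        proof (induction i)
          case (Suc i)
          have "F (Suc (m + i)) w - F (m + i) w = d (m + i) w" using elim w by simp
          then have "s (Suc (m + i)) w = s (m + i) w + (d (m + i) w - p (m + i) w)"
            by (simp add: s_def algebra_simps)
          with Suc show ?case by simp
        qed simp
        have "summable (\<lambda>i. d (m + i) w - p (m + i) w)"
          by (rule summable_comparison_test[of _ "\<lambda>i. (1 / 2) ^ i"])
             (use bnd[OF w] in \<open>auto intro!: summable_geometric exI[of _ 0]\<close>)
        then have "(\<lambda>i. s (m + i) w) \<longlonglongrightarrow> s m w + T m w"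
          unfolding step T_def by (intro tendsto_intros summable_LIMSEQ)
        then have "(\<lambda>k. s k w) \<longlonglongrightarrow> s m w + T m w"
          by (simp add: add.commute[of m] LIMSEQ_ignore_initial_segment LIMSEQ_offset)
        then have "G w = s m w + T m w" unfolding G_def by (rule limI)
        then show "G w - F m w = T m w - (\<Sum>j<m. p j w)" by (simp add: s_def)
      qed
    qed
  qed
  have "glues_on Z \<Phi> UNIV G"
    unfolding glues_on_def
  proof
    fix z assume z: "z \<in> Z"
    obtain m :: nat where m: "norm z < real m" using reals_Archimedean2 by blast
    have sub: "ball z 1 \<subseteq> ball 0 (real m + 1)"
    proof
      fix x assume "x \<in> ball z 1"
      then show "x \<in> ball 0 (real m + 1)" using dist_triangle[of 0 x z] m by simp
    qed
    have "(\<lambda>w. G w - F m w) \<in> ae_holomorphic (ball 0 (real m + 1))"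
      by (rule ae_holomorphicI[OF _ G])
         (intro holomorphic_funs_diff T holomorphic_funs_sum holomorphic_funs_subset[OF p], simp)
    then have 1: "(\<lambda>w. G w - F m w) \<in> ae_holomorphic (ball z 1)"
      by (rule ae_holomorphic_subset[OF _ sub])
    have "(\<lambda>w. F m w - \<Phi> z w) \<in> ae_holomorphic (ball 0 (real m + 2) \<inter> ball z 1)"
      using F[of m] z by (auto simp: glues_on_def)
    then have 2: "(\<lambda>w. F m w - \<Phi> z w) \<in> ae_holomorphic (ball z 1)"
      by (rule ae_holomorphic_subset) (use sub in auto)
    from ae_holomorphic_add[OF 1 2] show "(\<lambda>w. G w - \<Phi> z w) \<in> ae_holomorphic (UNIV \<inter> ball z 1)" by simp
  qed
  then show ?thesis by blast
qed

end

section \<open>Upper semicontinuity of the local distance to holomorphic functions\<close>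

lemma nn_integral_lborel_dilate:
  fixes z :: "'a::euclidean_space"
  assumes t: "0 < t" and [measurable]: "u \<in> borel_measurable borel"
  shows "(\<integral>\<^sup>+w. u (z + t *\<^sub>R (w - z)) \<partial>lborel) = ennreal ((1 / t) ^ DIM('a)) * (\<integral>\<^sup>+w. u w \<partial>lborel)"
proof -
  have "(\<integral>\<^sup>+w. u w \<partial>lborel) = (\<integral>\<^sup>+w. u w \<partial>density (distr lborel borel (\<lambda>x. (z - t *\<^sub>R z) + t *\<^sub>R x)) (\<lambda>_. \<bar>t\<bar> ^ DIM('a)))"
    using t by (subst lborel_affine[of t "z - t *\<^sub>R z"]) auto
  also have "\<dots> = ennreal (t ^ DIM('a)) * (\<integral>\<^sup>+w. u (z + t *\<^sub>R (w - z)) \<partial>lborel)"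
    using t by (simp add: nn_integral_density nn_integral_distr nn_integral_cmult algebra_simps)
  finally have "ennreal ((1 / t) ^ DIM('a)) * (\<integral>\<^sup>+w. u w \<partial>lborel)
      = ennreal ((1 / t) ^ DIM('a)) * (ennreal (t ^ DIM('a)) * (\<integral>\<^sup>+w. u (z + t *\<^sub>R (w - z)) \<partial>lborel))" by simp
  also have "\<dots> = (\<integral>\<^sup>+w. u (z + t *\<^sub>R (w - z)) \<partial>lborel)"
    using t by (simp add: mult.assoc[symmetric] ennreal_mult'[symmetric] power_mult_distrib[symmetric])
  finally show ?thesis by simp
qed

text \<open>The error is estimated by three terms: a uniformly small one on the concentric ball of radius \<open>r2\<close>,
  the mass of \<open>h\<close> near the boundary, and the mass of the dilated function there. A change of variables
  bounds the last one by a constant multiple of the mass of \<open>h\<close> outside a ball of radius \<open>r < r2\<close>, since a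
  dilation by a factor close to \<open>1\<close> moves points outside radius \<open>r2\<close> only slightly.\<close>

lemma dilation_Lp_close:
  fixes h :: "'a::euclidean_space \<Rightarrow> complex"
  assumes q: "1 \<le> q" and cont: "continuous_on (ball z 1) h"
    and fin: "(\<integral>\<^sup>+w. ennreal (cmod (h w) powr q) * indicator (ball z 1) w \<partial>lborel) < top" and \<epsilon>: "0 < \<epsilon>"
  shows "\<exists>t. 0 < t \<and> t < 1 \<and>
    Lp_enorm lborel q (\<lambda>w. ennreal (cmod (h w - h (z + t *\<^sub>R (w - z)))) * indicator (ball z 1) w) \<le> ennreal \<epsilon>"
proof -
  have q0: "0 < q" using q by simp
  define A where "A w = ennreal (cmod (indicator (ball z 1) w *\<^sub>R h w))" for w
  have Aeq: "A w = ennreal (cmod (h w)) * indicator (ball z 1) w" for w by (simp add: A_def indicator_def)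
  have [measurable]: "(\<lambda>w. indicator (ball z 1) w *\<^sub>R h w) \<in> borel_measurable borel"
    by (rule borel_measurable_continuous_on_indicator[OF _ cont]) simp
  have [measurable]: "A \<in> borel_measurable borel" unfolding A_def by measurable
  have [measurable]: "ball z r \<in> sets borel" "- ball z r \<in> sets borel" for r by simp_all
  define s where "s r w = A w * indicator (- ball z r) w" for r w
  have [measurable]: "s r \<in> borel_measurable borel" for r
    unfolding s_def by measurable
  define V where "V = Lp_enorm lborel q (indicator (ball z 1))"
  have "V < top"
  proof -
    have "ennreal_powr (indicator (ball z 1) w) q = indicator (ball z 1) w" for w
      using ennreal_powr_ennreal[of 1 q] by (cases "w \<in> ball z 1") (simp_all del: ennreal_powr_ennreal)
    then have "V = ennreal_powr (emeasure lborel (ball z 1)) (1 / q)"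
      by (simp add: V_def Lp_enorm_def)
    then show ?thesis using emeasure_lborel_ball_finite[of z 1] by (simp add: less_top)
  qed
  then obtain v where v: "V = ennreal v" "0 \<le> v" by (cases V) auto
  define C where "C = (2 ^ DIM('a)) powr (1 / q)"
  have C: "0 < C" by (simp add: C_def)
  define \<delta> where "\<delta> = \<epsilon> / (2 * (1 + C))"
  define \<eta> where "\<eta> = \<epsilon> / (2 * (v + 1))"
  have \<delta>: "0 < \<delta>" and \<eta>: "0 < \<eta>" using \<epsilon> C v by (simp_all add: \<delta>_def \<eta>_def)
  have "\<exists>r. 0 < r \<and> r < 1 \<and> Lp_enorm lborel q (s r) \<le> ennreal \<delta>"
  proof -
    define r where "r n = 1 - 1 / (real n + 2)" for n :: nat
    have r: "0 < r n" "r n < 1" for n by (auto simp: r_def field_simps)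
    have mono_r: "r m \<le> r n" if "m \<le> n" for m n using that by (auto simp: r_def intro!: divide_left_mono)
    have dec: "decseq (\<lambda>n w. ennreal_powr (s (r n) w) q)"
    proof (intro decseq_SucI le_funI)
      fix n w
      show "ennreal_powr (s (r (Suc n)) w) q \<le> ennreal_powr (s (r n) w) q"
        using mono_r[of n "Suc n"] by (intro ennreal_powr_mono q0) (auto simp: s_def indicator_def)
    qed
    have "(\<integral>\<^sup>+w. ennreal_powr (A w) q \<partial>lborel) < top"
    proof -
      have "ennreal_powr (A w) q = ennreal (cmod (h w) powr q) * indicator (ball z 1) w" for w
        by (simp add: Aeq indicator_def)
      with fin show ?thesis by simp
    qed
    moreover have "(\<integral>\<^sup>+w. ennreal_powr (s (r 0) w) q \<partial>lborel) \<le> (\<integral>\<^sup>+w. ennreal_powr (A w) q \<partial>lborel)"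
      by (intro nn_integral_mono ennreal_powr_mono q0) (simp add: s_def indicator_def)
    ultimately have fin0: "(\<integral>\<^sup>+w. ennreal_powr (s (r 0) w) q \<partial>lborel) < \<infinity>" by (simp add: le_less_trans)
    have "(INF n. ennreal_powr (s (r n) w) q) = 0" for w
    proof -
      have "\<exists>n. s (r n) w = 0"
      proof (cases "w \<in> ball z 1")
        case True
        then have "\<forall>\<^sub>F n in sequentially. dist z w < r n"
          unfolding r_def by (intro order_tendstoD(1)[of _ 1]) (real_asymp, simp)
        then obtain n where "dist z w < r n" using eventually_happens by force
        then show ?thesis by (intro exI[of _ n]) (simp add: s_def)
      qed (simp add: s_def Aeq)
      then obtain n where "s (r n) w = 0" ..
      then have "(INF n. ennreal_powr (s (r n) w) q) \<le> 0" by (intro INF_lower2[of n]) auto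
      then show ?thesis by simp
    qed
    then have "(INF n. (\<integral>\<^sup>+w. ennreal_powr (s (r n) w) q \<partial>lborel)) = 0"
      using nn_integral_monotone_convergence_INF_decseq[OF dec _ fin0] by simp
    also have "\<dots> < ennreal (\<delta> powr q)" using \<delta> by simp
    finally obtain n where "(\<integral>\<^sup>+w. ennreal_powr (s (r n) w) q \<partial>lborel) < ennreal (\<delta> powr q)"
      by (auto simp: INF_less_iff)
    then have "Lp_enorm lborel q (s (r n)) \<le> ennreal \<delta>"
      using q0 \<delta> by (simp add: Lp_enorm_le_iff)
    with r show ?thesis by blast
  qed
  then obtain r where r: "0 < r" "r < 1" "Lp_enorm lborel q (s r) \<le> ennreal \<delta>" by blast
  define r2 where "r2 = (1 + r) / 2"
  have r2: "r < r2" "r2 < 1" using r by (auto simp: r2_def)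
  have "uniformly_continuous_on (cball z r2) h"
    using r2 by (intro compact_uniformly_continuous continuous_on_subset[OF cont]) auto
  then obtain d where d: "0 < d" "\<And>x y. x \<in> cball z r2 \<Longrightarrow> y \<in> cball z r2 \<Longrightarrow> dist y x < d \<Longrightarrow> dist (h y) (h x) < \<eta>"
    unfolding uniformly_continuous_on_def using \<eta> by metis
  define t where "t = max (1 / 2) (max (r / r2) (1 - d / 2))"
  have t: "1 / 2 \<le> t" "r \<le> t * r2" "1 - t < d" "t < 1" "0 < t"
  proof -
    have "r / r2 \<le> t" "1 - d / 2 \<le> t" by (simp_all add: t_def)
    moreover have "r / r2 < 1" using r r2 by simp
    ultimately show "1 / 2 \<le> t" "r \<le> t * r2" "1 - t < d" "t < 1" "0 < t"
      using r r2 d(1) by (simp_all add: t_def pos_divide_le_eq less_max_iff_disj)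
  qed
  define T where "T w = z + t *\<^sub>R (w - z)" for w
  have dT: "dist z (T w) = t * dist z w" for w
    using t by (simp add: T_def dist_norm norm_minus_commute)
  have pt: "ennreal (cmod (h w - h (T w))) * indicator (ball z 1) w
      \<le> ennreal \<eta> * indicator (ball z 1) w + (s r w + s r (T w))" for w
  proof (cases "w \<in> ball z 1")
    case True
    then have w1: "dist z w < 1" by simp
    have TB: "T w \<in> ball z 1" using w1 t dT[of w] mult_strict_mono[of t 1 "dist z w" 1] by simp
    show ?thesis
    proof (cases "w \<in> ball z r2")
      case True
      then have wr: "dist z w < r2" by simp
      have "t * dist z w \<le> 1 * dist z w" using t by (intro mult_right_mono) auto
      then have Tr: "T w \<in> cball z r2" using wr dT[of w] by simp
      have "w - T w = (1 - t) *\<^sub>R (w - z)" by (simp add: T_def algebra_simps)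
      then have "dist w (T w) = (1 - t) * dist z w" using t by (simp add: dist_norm norm_minus_commute)
      also have "\<dots> \<le> (1 - t) * 1" using t w1 by (intro mult_left_mono) auto
      also have "\<dots> < d" using t by simp
      finally have "dist (h w) (h (T w)) < \<eta>" using Tr wr by (intro d(2)) auto
      then have "ennreal (cmod (h w - h (T w))) \<le> ennreal \<eta>" by (intro ennreal_leI) (simp add: dist_norm)
      then show ?thesis using w1 by (simp add: add_increasing2)
    next
      case False
      then have "r2 \<le> dist z w" by simp
      then have "t * r2 \<le> t * dist z w" using t by (intro mult_left_mono) auto
      then have "r \<le> dist z (T w)" "r \<le> dist z w" using t(2) dT[of w] r2 \<open>r2 \<le> dist z w\<close> by auto
      then have "s r w = ennreal (cmod (h w))" "s r (T w) = ennreal (cmod (h (T w)))"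
        using w1 TB by (simp_all add: s_def Aeq)
      moreover have "ennreal (cmod (h w - h (T w))) \<le> ennreal (cmod (h w)) + ennreal (cmod (h (T w)))"
        using norm_triangle_ineq4[of "h w" "h (T w)"] by (simp add: ennreal_plus[symmetric] ennreal_leI del: ennreal_plus)
      ultimately show ?thesis using w1 by (simp add: add_increasing)
    qed
  qed simp
  have [measurable]: "T \<in> borel_measurable borel"
    unfolding T_def by (intro borel_measurable_continuous_onI continuous_intros)
  have sT: "Lp_enorm lborel q (\<lambda>w. s r (T w)) \<le> ennreal C * ennreal \<delta>"
  proof -
    have "(\<integral>\<^sup>+w. ennreal_powr (s r (T w)) q \<partial>lborel) = ennreal ((1 / t) ^ DIM('a)) * (\<integral>\<^sup>+w. ennreal_powr (s r w) q \<partial>lborel)"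
      unfolding T_def using t by (intro nn_integral_lborel_dilate[of t "\<lambda>w. ennreal_powr (s r w) q"]) auto
    also have "\<dots> \<le> ennreal (2 ^ DIM('a)) * (\<integral>\<^sup>+w. ennreal_powr (s r w) q \<partial>lborel)"
      using t by (intro mult_right_mono ennreal_leI power_mono) (auto simp: field_simps)
    also have "\<dots> \<le> ennreal (2 ^ DIM('a)) * ennreal_powr (ennreal \<delta>) q"
      using r(3) q0 by (intro mult_left_mono) (auto simp: Lp_enorm_le_iff)
    also have "\<dots> = ennreal_powr (ennreal C * ennreal \<delta>) q"
    proof -
      have "ennreal_powr (ennreal C) q = ennreal (2 ^ DIM('a))"
        using q0 by (simp add: C_def powr_powr)
      then show ?thesis using q0 by (simp add: ennreal_powr_mult)
    qed
    finally show ?thesis using q0 by (simp add: Lp_enorm_le_iff)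
  qed
  have "Lp_enorm lborel q (\<lambda>w. ennreal (cmod (h w - h (T w))) * indicator (ball z 1) w)
      \<le> Lp_enorm lborel q (\<lambda>w. ennreal \<eta> * indicator (ball z 1) w + (s r w + s r (T w)))"
    by (intro Lp_enorm_mono_AE q0 AE_I2 pt)
  also have "\<dots> \<le> Lp_enorm lborel q (\<lambda>w. ennreal \<eta> * indicator (ball z 1) w) + Lp_enorm lborel q (\<lambda>w. s r w + s r (T w))"
    by (rule Lp_enorm_add[OF q]) simp_all
  also have "\<dots> \<le> ennreal \<eta> * V + (Lp_enorm lborel q (s r) + Lp_enorm lborel q (\<lambda>w. s r (T w)))"
  proof (rule add_mono)
    show "Lp_enorm lborel q (\<lambda>w. ennreal \<eta> * indicator (ball z 1) w) \<le> ennreal \<eta> * V"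
      by (subst Lp_enorm_cmult) (simp_all add: q0 V_def borel_measurable_indicator)
    show "Lp_enorm lborel q (\<lambda>w. s r w + s r (T w)) \<le> Lp_enorm lborel q (s r) + Lp_enorm lborel q (\<lambda>w. s r (T w))"
      by (rule Lp_enorm_add[OF q]) simp_all
  qed
  also have "\<dots> \<le> ennreal \<eta> * ennreal v + (ennreal \<delta> + ennreal C * ennreal \<delta>)"
    using r(3) sT by (intro add_mono) (auto simp: v)
  also have "\<dots> = ennreal (\<eta> * v + (\<delta> + C * \<delta>))"
    using \<eta> \<delta> C v by (simp add: ennreal_mult'[symmetric] ennreal_plus[symmetric] del: ennreal_plus)
  also have "\<dots> \<le> ennreal \<epsilon>"
  proof (rule ennreal_leI)
    have "2 * (1 + C) \<noteq> 0" using C by simp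
    then have "\<epsilon> = \<delta> * (2 * (1 + C))" unfolding \<delta>_def by (metis nonzero_divide_eq_eq)
    then have "\<delta> + C * \<delta> = \<epsilon> / 2" by (simp add: algebra_simps)
    moreover have "\<eta> * v \<le> \<eta> * (v + 1)" using \<eta> by simp
    moreover have "2 * (v + 1) \<noteq> 0" using v by simp
    then have "\<epsilon> = \<eta> * (2 * (v + 1))" unfolding \<eta>_def by (metis nonzero_divide_eq_eq)
    then have "\<eta> * (v + 1) = \<epsilon> / 2" by (simp add: algebra_simps)
    ultimately show "\<eta> * v + (\<delta> + C * \<delta>) \<le> \<epsilon>" by linarith
  qed
  finally show ?thesis using t unfolding T_def by blast
qed

lemma IDA_G_eq:
  assumes q: "0 < q" and f: "f \<in> borel_measurable (lebesgue_on (ball z 1))"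
  shows "IDA_G q 1 f z = (INF h\<in>holomorphic_funs (ball z 1). ball_enorm q z 1 (\<lambda>w. f w - h w))"
  unfolding IDA_G_def
proof (intro INF_cong refl)
  fix h assume "h \<in> holomorphic_funs (ball z 1)"
  then have "h \<in> borel_measurable (lebesgue_on (ball z 1))" by (rule holomorphic_funs_measurable) simp
  with f have "(\<lambda>w. f w - h w) \<in> borel_measurable (lebesgue_on (ball z 1))" by simp
  from ball_enorm_eq[OF this]
  show "ennreal_powr ((\<integral>\<^sup>+w\<in>ball z 1. ennreal (cmod (f w - h w) powr q) \<partial>lebesgue) / emeasure lebesgue (ball z 1)) (1 / q)
     = ball_enorm q z 1 (\<lambda>w. f w - h w)" by simp
qed

lemma LlocD:
  assumes "f \<in> Lloc q"
  shows "f \<in> borel_measurable lebesgue" "f \<in> borel_measurable (lebesgue_on S)"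
    "compact K \<Longrightarrow> (\<integral>\<^sup>+w\<in>K. ennreal (cmod (f w) powr q) \<partial>lebesgue) < \<infinity>"
  using assms by (auto simp: Lloc_def measurable_restrict_space1)

lemma Lloc_ball_enorm_finite:
  assumes q: "0 < q" and r: "0 < r" and f: "f \<in> Lloc q"
  shows "ball_enorm q p r f < top"
proof -
  have "(\<integral>\<^sup>+w\<in>ball p r. ennreal (cmod (f w) powr q) \<partial>lebesgue) \<le> (\<integral>\<^sup>+w\<in>cball p r. ennreal (cmod (f w) powr q) \<partial>lebesgue)"
    by (intro nn_integral_mono mult_left_mono) (auto simp: indicator_def)
  also have "\<dots> < top" using LlocD(3)[OF f compact_cball] by simp
  finally show ?thesis using LlocD(2)[OF f] by (simp add: ball_enorm_finite_iff[OF r])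
qed

text \<open>The dilation of a nearly optimal function by a factor \<open>t < 1\<close> is holomorphic on the ball of radius
  \<open>1 / t\<close>.\<close>

lemma IDA_G_less_by_larger_ball:
  fixes f :: "complex ^ 'n \<Rightarrow> complex"
  assumes q: "1 \<le> q" and f: "f \<in> Lloc q" and less: "IDA_G q 1 f z < a"
  shows "\<exists>R>1. \<exists>k\<in>holomorphic_funs (ball z R). ball_enorm q z 1 (\<lambda>w. f w - k w) < a"
proof -
  have q0: "0 < q" using q by simp
  note fm [measurable] = LlocD(2)[OF f]
  obtain h where h: "h \<in> holomorphic_funs (ball z 1)" and ha: "ball_enorm q z 1 (\<lambda>w. f w - h w) < a"
    using less by (auto simp: IDA_G_eq[OF q0 fm] INF_less_iff)
  have hm [measurable]: "h \<in> borel_measurable (lebesgue_on (ball z 1))"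
    by (rule holomorphic_funs_measurable[OF h]) simp
  obtain \<epsilon> where \<epsilon>: "0 < \<epsilon>" "ball_enorm q z 1 (\<lambda>w. f w - h w) + ennreal \<epsilon> < a"
  proof -
    obtain b where b: "ball_enorm q z 1 (\<lambda>w. f w - h w) = ennreal b" "0 \<le> b" using ha by (cases "ball_enorm q z 1 (\<lambda>w. f w - h w)") auto
    show ?thesis
    proof (cases a)
      case (real c)
      then show ?thesis using ha b by (intro that[of "(c - b) / 2"])
        (auto simp: ennreal_plus[symmetric] ennreal_less_iff field_simps simp del: ennreal_plus)
    next
      case top
      then show ?thesis by (intro that[of 1]) (auto simp: b)
    qed
  qed
  define V where "V = emeasure lebesgue (ball z 1)"
  have V: "V \<noteq> 0" "V \<noteq> top" using emeasure_lebesgue_ball[of 1 z] by (simp_all add: V_def)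
  \<comment> \<open>The factor by which the averaged norm differs from the norm for Lebesgue measure.\<close>
  define c where "c = enn2real (ennreal_powr (1 / V) (1 / q))"
  have c: "ennreal_powr (1 / V) (1 / q) = ennreal c" "0 \<le> c"
    using V by (auto simp: c_def ennreal_divide_eq_top_iff less_top[symmetric])
  have hfin: "ball_enorm q z 1 h < top"
  proof -
    have "ball_enorm q z 1 (\<lambda>w. f w - (f w - h w)) \<le> ball_enorm q z 1 f + ball_enorm q z 1 (\<lambda>w. f w - h w)"
      by (rule ball_enorm_diff_triangle[OF q]) measurable
    also have "\<dots> < top"
      using Lloc_ball_enorm_finite[OF q0 _ f, of 1 z] ha
      by (auto simp: less_top[symmetric])
    finally show ?thesis by simp
  qed
  have "(\<integral>\<^sup>+w. ennreal (cmod (h w) powr q) * indicator (ball z 1) w \<partial>lborel) < top"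
    using hfin V by (simp add: ball_enorm_eq[OF hm] V_def[symmetric] nn_integral_completion ennreal_divide_eq_top_iff flip: less_top)
  from dilation_Lp_close[OF q holomorphic_funs_imp_continuous_on[OF h] this, of "\<epsilon> / (c + 1)"]
  obtain t where t: "0 < t" "t < 1" and
    close: "Lp_enorm lborel q (\<lambda>w. ennreal (cmod (h w - h (z + t *\<^sub>R (w - z)))) * indicator (ball z 1) w) \<le> ennreal (\<epsilon> / (c + 1))"
    using \<epsilon>(1) c(2) by auto
  define k where "k w = h (z + t *\<^sub>R (w - z))" for w
  have k: "k \<in> holomorphic_funs (ball z (1 / t))"
    unfolding k_def
  proof (rule holomorphic_funs_subset[OF holomorphic_funs_dilate[OF h]], rule subsetI)
    fix x assume "x \<in> ball z (1 / t)"
    then have "t * norm (x - z) < 1" using t by (simp add: dist_norm norm_minus_commute field_simps)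
    then show "x \<in> {w. z + t *\<^sub>R (w - z) \<in> ball z 1}" using t by (simp add: dist_norm)
  qed
  have R: "1 < 1 / t" using t by simp
  have km [measurable]: "k \<in> borel_measurable (lebesgue_on (ball z 1))"
    by (rule holomorphic_funs_measurable[OF holomorphic_funs_subset[OF k]]) (use R in auto)
  have "ball_enorm q z 1 (\<lambda>w. h w - k w) = ennreal c * Lp_enorm lborel q (\<lambda>w. ennreal (cmod (h w - k w)) * indicator (ball z 1) w)"
  proof -
    have "ball_enorm q z 1 (\<lambda>w. h w - k w) = ennreal_powr
      ((1 / V) * (\<integral>\<^sup>+w. ennreal (cmod (h w - k w) powr q) * indicator (ball z 1) w \<partial>lborel)) (1 / q)"
      by (simp add: ball_enorm_eq V_def nn_integral_completion divide_ennreal_def mult.commute)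
    also have "(\<lambda>w. ennreal (cmod (h w - k w) powr q) * indicator (ball z 1) w)
       = (\<lambda>w. ennreal_powr (ennreal (cmod (h w - k w)) * indicator (ball z 1) w) q)"
      by (auto simp: indicator_def)
    finally show ?thesis using q0 by (simp add: ennreal_powr_mult c Lp_enorm_def)
  qed
  also have "\<dots> \<le> ennreal c * ennreal (\<epsilon> / (c + 1))"
    using close by (intro mult_left_mono) (simp_all add: k_def)
  also have "\<dots> \<le> ennreal \<epsilon>"
    using c(2) \<epsilon>(1) by (simp add: ennreal_mult'[symmetric] field_simps ennreal_leI)
  finally have hk: "ball_enorm q z 1 (\<lambda>w. h w - k w) \<le> ennreal \<epsilon>" .
  have "ball_enorm q z 1 (\<lambda>w. f w - k w) \<le> ball_enorm q z 1 (\<lambda>w. f w - h w) + ball_enorm q z 1 (\<lambda>w. h w - k w)"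
    using ball_enorm_triangle[OF q, of "\<lambda>w. f w - h w" z 1 "\<lambda>w. h w - k w"] by simp
  also have "\<dots> \<le> ball_enorm q z 1 (\<lambda>w. f w - h w) + ennreal \<epsilon>" using hk by (rule add_left_mono)
  also have "\<dots> < a" by (rule \<epsilon>(2))
  finally show ?thesis using k R by blast
qed

text \<open>An approximation \<open>k\<close> that is holomorphic beyond the closed unit ball competes for all nearby balls. Its
  error there is at most the integral over a slightly larger concentric ball, and these integrals decrease
  to the integral over the closed ball, which the sphere does not change.\<close>

lemma open_IDA_G_less:
  fixes f :: "complex ^ 'n \<Rightarrow> complex"
  assumes q: "1 \<le> q" and f: "f \<in> Lloc q"
  shows "open {z. IDA_G q 1 f z < a}"
  unfolding open_contains_ball
proof
  fix z assume "z \<in> {z. IDA_G q 1 f z < a}"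
  then have "IDA_G q 1 f z < a" by simp
  from IDA_G_less_by_larger_ball[OF q f this] obtain R k where R: "1 < R"
    and k: "k \<in> holomorphic_funs (ball z R)" and ka: "ball_enorm q z 1 (\<lambda>w. f w - k w) < a" by blast
  have q0: "0 < q" using q by simp
  \<comment> \<open>Radii that decrease to 1 and stay below \<open>R\<close>.\<close>
  define \<rho> where "\<rho> n = 1 + (R - 1) / (real n + 2)" for n :: nat
  have \<rho>: "1 < \<rho> n" "\<rho> n < R" for n
  proof -
    show "1 < \<rho> n" using R by (simp add: \<rho>_def)
    have "(R - 1) / (real n + 2) < (R - 1) / 1" using R by (intro divide_strict_left_mono) auto
    then show "\<rho> n < R" by (simp add: \<rho>_def)
  qed
  have \<rho>_mono: "\<rho> n \<le> \<rho> m" if "m \<le> n" for m n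
    using that R by (auto simp: \<rho>_def intro!: divide_left_mono)
  have fm [measurable]: "f \<in> borel_measurable (lebesgue_on S)" for S by (rule LlocD(2)[OF f])
  have km: "k \<in> borel_measurable (lebesgue_on (ball z R))"
    by (rule holomorphic_funs_measurable[OF k]) simp
  define u where "u n w = ennreal (cmod (f w - k w) powr q) * indicator (ball z (\<rho> n)) w" for n w
  have um: "u n \<in> borel_measurable lebesgue" for n
  proof -
    have "k \<in> borel_measurable (lebesgue_on (ball z (\<rho> n)))"
      by (rule measurable_restrict_mono[OF km]) (use \<rho>(2)[of n] in auto)
    then have "(\<lambda>w. ennreal (cmod (f w - k w) powr q)) \<in> borel_measurable (lebesgue_on (ball z (\<rho> n)))"
      by measurable
    then show ?thesis
      unfolding u_def[abs_def] by (subst (asm) borel_measurable_restrict_space_iff_ennreal) auto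
  qed
  have ufin: "(\<integral>\<^sup>+w. u 0 w \<partial>lebesgue) < \<infinity>"
  proof -
    have "compact (k ` cball z (\<rho> 0))"
      using \<rho>(2)[of 0] by (intro compact_continuous_image continuous_on_subset[OF holomorphic_funs_imp_continuous_on[OF k]]) auto
    then obtain M where M: "\<And>w. w \<in> cball z (\<rho> 0) \<Longrightarrow> cmod (k w) \<le> M" "0 < M"
      using compact_imp_bounded bounded_pos by (metis imageI)
    have "u 0 w \<le> ennreal (2 powr q) * (ennreal (cmod (f w) powr q) * indicator (cball z (\<rho> 0)) w
         + ennreal (M powr q) * indicator (cball z (\<rho> 0)) w)" for w
    proof (cases "w \<in> ball z (\<rho> 0)")
      case True
      then have kM: "cmod (k w) \<le> M" by (intro M) auto
      have "cmod (f w - k w) \<le> 2 * max (cmod (f w)) M"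
        using norm_triangle_ineq4[of "f w" "k w"] kM by linarith
      then have "cmod (f w - k w) powr q \<le> (2 * max (cmod (f w)) M) powr q"
        using q0 by (intro powr_mono2) auto
      also have "\<dots> \<le> 2 powr q * (cmod (f w) powr q + M powr q)"
        using M(2) by (auto simp: powr_mult max_def)
      finally show ?thesis using True
        by (simp add: u_def ennreal_mult'[symmetric] ennreal_plus[symmetric] ennreal_leI del: ennreal_plus)
    qed (simp add: u_def)
    then have "(\<integral>\<^sup>+w. u 0 w \<partial>lebesgue) \<le> (\<integral>\<^sup>+w. ennreal (2 powr q) * (ennreal (cmod (f w) powr q) * indicator (cball z (\<rho> 0)) w
         + ennreal (M powr q) * indicator (cball z (\<rho> 0)) w) \<partial>lebesgue)"
      by (rule nn_integral_mono)
    also have "\<dots> = ennreal (2 powr q) * ((\<integral>\<^sup>+w. ennreal (cmod (f w) powr q) * indicator (cball z (\<rho> 0)) w \<partial>lebesgue)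
         + ennreal (M powr q) * emeasure lebesgue (cball z (\<rho> 0)))"
    proof -
      define A B :: "complex ^ 'n \<Rightarrow> ennreal"
        where AB: "A = (\<lambda>w. ennreal (cmod (f w) powr q) * indicator (cball z (\<rho> 0)) w)"
          "B = (\<lambda>w. ennreal (M powr q) * indicator (cball z (\<rho> 0)) w)"
      have m: "A \<in> borel_measurable lebesgue" "B \<in> borel_measurable lebesgue"
        unfolding AB using LlocD(1)[OF f]
        by (intro borel_measurable_times_ennreal borel_measurable_indicator; simp)+
      have "(\<integral>\<^sup>+w. ennreal (2 powr q) * (A w + B w) \<partial>lebesgue)
          = ennreal (2 powr q) * ((\<integral>\<^sup>+w. A w \<partial>lebesgue) + (\<integral>\<^sup>+w. B w \<partial>lebesgue))"
        by (simp only: nn_integral_cmult[OF borel_measurable_add[OF m]] nn_integral_add[OF m])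
      moreover have "(\<integral>\<^sup>+w. B w \<partial>lebesgue) = ennreal (M powr q) * emeasure lebesgue (cball z (\<rho> 0))"
        unfolding AB by (rule nn_integral_cmult_indicator) simp
      ultimately show ?thesis by (simp only: AB)
    qed
    also have "\<dots> < \<infinity>"
      using LlocD(3)[OF f compact_cball[of z "\<rho> 0"]] emeasure_lborel_cball_finite[of z "\<rho> 0"]
      by (simp add: ennreal_mult_less_top)
    finally show ?thesis .
  qed
  define V where "V = emeasure lebesgue (ball z 1)"
  have V: "V \<noteq> 0" "V \<noteq> top" using emeasure_lebesgue_ball[of 1 z] by (simp_all add: V_def)
  have dec: "decseq u"
  proof (intro decseq_SucI le_funI)
    fix n w
    show "u (Suc n) w \<le> u n w"
      using \<rho>_mono[of n "Suc n"] by (auto simp: u_def indicator_def)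
  qed
  have inf_u: "(INF n. u n w) = ennreal (cmod (f w - k w) powr q) * indicator (cball z 1) w" for w
  proof (cases "w \<in> cball z 1")
    case True
    then have "u n w = ennreal (cmod (f w - k w) powr q)" for n using \<rho>(1)[of n] by (simp add: u_def)
    with True show ?thesis by simp
  next
    case False
    then have "\<forall>\<^sub>F n in sequentially. \<rho> n < dist z w"
      unfolding \<rho>_def by (intro order_tendstoD(2)[of _ 1]) (real_asymp, simp)
    then obtain n where "\<rho> n < dist z w" using eventually_happens by force
    then have "(INF n. u n w) \<le> 0" by (intro INF_lower2[of n]) (auto simp: u_def)
    with False show ?thesis by simp
  qed
  have "(INF n. (\<integral>\<^sup>+w. u n w \<partial>lebesgue)) = (\<integral>\<^sup>+w. ennreal (cmod (f w - k w) powr q) * indicator (cball z 1) w \<partial>lebesgue)"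
    using nn_integral_monotone_convergence_INF_decseq[OF dec um ufin] by (simp add: inf_u)
  also have "\<dots> = (\<integral>\<^sup>+w. ennreal (cmod (f w - k w) powr q) * indicator (ball z 1) w \<partial>lebesgue)"
  proof (rule nn_integral_cong_AE)
    have "AE w in lebesgue. w \<notin> sphere z 1"
      using AE_not_in[of "sphere z 1" lebesgue] negligible_sphere[of z 1]
      by (simp only: negligible_iff_null_sets)
    then show "AE w in lebesgue. ennreal (cmod (f w - k w) powr q) * indicator (cball z 1) w
        = ennreal (cmod (f w - k w) powr q) * indicator (ball z 1) w"
      by eventually_elim (auto simp: indicator_def)
  qed
  also have "\<dots> < V * ennreal_powr a q"
  proof -
    have "k \<in> borel_measurable (lebesgue_on (ball z 1))"
      by (rule measurable_restrict_mono[OF km]) (use R in auto)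
    then have "(\<integral>\<^sup>+w. ennreal (cmod (f w - k w) powr q) * indicator (ball z 1) w \<partial>lebesgue) / V < ennreal_powr a q"
      using ka by (subst (asm) ball_enorm_eq) (simp_all add: ennreal_powr_less_iff[OF q0] V_def)
    then show ?thesis using V by (simp add: divide_less_ennreal less_top mult.commute[of V])
  qed
  finally obtain n where n: "(\<integral>\<^sup>+w. u n w \<partial>lebesgue) < V * ennreal_powr a q"
    by (auto simp: INF_less_iff)
  have "IDA_G q 1 f y < a" if y: "y \<in> ball z (\<rho> n - 1)" for y
  proof -
    have sub: "ball y 1 \<subseteq> ball z (\<rho> n)"
    proof
      fix x assume "x \<in> ball y 1"
      then show "x \<in> ball z (\<rho> n)" using y dist_triangle[of z x y] by simp
    qed
    then have subR: "ball y 1 \<subseteq> ball z R" using \<rho>(2)[of n] by auto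
    have ky: "k \<in> holomorphic_funs (ball y 1)" by (rule holomorphic_funs_subset[OF k subR])
    have "k \<in> borel_measurable (lebesgue_on (ball y 1))" by (rule measurable_restrict_mono[OF km subR])
    then have "(\<lambda>w. f w - k w) \<in> borel_measurable (lebesgue_on (ball y 1))" by simp
    note eq = ball_enorm_eq[OF this]
    have Vy: "emeasure lebesgue (ball y 1) = V" by (simp add: V_def emeasure_ball)
    have "(\<integral>\<^sup>+w. ennreal (cmod (f w - k w) powr q) * indicator (ball y 1) w \<partial>lebesgue) \<le> (\<integral>\<^sup>+w. u n w \<partial>lebesgue)"
      unfolding u_def using sub by (intro nn_integral_mono mult_left_mono) (auto simp: indicator_def)
    also note n
    finally have "(\<integral>\<^sup>+w. ennreal (cmod (f w - k w) powr q) * indicator (ball y 1) w \<partial>lebesgue) / V < ennreal_powr a q"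
      using V by (simp add: divide_less_ennreal less_top mult.commute[of V])
    then have "ball_enorm q y 1 (\<lambda>w. f w - k w) < a"
      unfolding eq Vy by (simp add: ennreal_powr_less_iff[OF q0])
    then show ?thesis using ky by (auto simp: IDA_G_eq[OF q0 fm] INF_less_iff)
  qed
  then show "\<exists>e>0. ball z e \<subseteq> {z. IDA_G q 1 f z < a}"
    using \<rho>(1)[of n] by (intro exI[of _ "\<rho> n - 1"]) auto
qed

lemma IDA_G_measurable:
  assumes "1 \<le> q" "f \<in> Lloc q"
  shows "IDA_G q 1 f \<in> borel_measurable lebesgue"
proof -
  have "IDA_G q 1 f \<in> borel_measurable borel"
    by (rule borel_measurableI_less) (simp add: open_IDA_G_less[OF assms])
  then show ?thesis by (simp add: measurable_completion)
qed

section \<open>The local distance as a seminorm and its kernel\<close>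

text \<open>Finitely many of the balls cover a compact set.\<close>

lemma Lloc_local:
  fixes f :: "complex ^ 'n \<Rightarrow> complex"
  assumes q: "0 < q" and f: "f \<in> borel_measurable lebesgue"
    and fin: "\<And>p. \<exists>r>0. ball_enorm q p r f < top"
  shows "f \<in> Lloc q"
proof -
  have fm: "f \<in> borel_measurable (lebesgue_on S)" for S using f by (rule measurable_restrict_space1)
  have "\<forall>p. \<exists>r>0. ball_enorm q p r f < top"
    using fin by (rule allI)
  from choice[OF this] obtain r where r: "\<And>p. 0 < r p" "\<And>p. ball_enorm q p (r p) f < top"
    by blast
  have "(\<integral>\<^sup>+w\<in>K. ennreal (cmod (f w) powr q) \<partial>lebesgue) < \<infinity>" if K: "compact K" for K
  proof -
    have "K \<subseteq> (\<Union>p\<in>UNIV. ball p (r p))"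
    proof
      fix x
      show "x \<in> (\<Union>p\<in>UNIV. ball p (r p))" using r(1)[of x] by (intro UN_I[of x]) auto
    qed
    from compactE_image[OF K _ this] obtain P where P: "finite P" "K \<subseteq> (\<Union>p\<in>P. ball p (r p))"
      by auto
    have "(\<integral>\<^sup>+w\<in>K. ennreal (cmod (f w) powr q) \<partial>lebesgue)
        \<le> (\<integral>\<^sup>+w. (\<Sum>p\<in>P. ennreal (cmod (f w) powr q) * indicator (ball p (r p)) w) \<partial>lebesgue)"
    proof (rule nn_integral_mono)
      fix w
      show "ennreal (cmod (f w) powr q) * indicator K w \<le> (\<Sum>p\<in>P. ennreal (cmod (f w) powr q) * indicator (ball p (r p)) w)"
      proof (cases "w \<in> K")
        case True
        then obtain p where p: "p \<in> P" "w \<in> ball p (r p)" using P by blast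
        have "ennreal (cmod (f w) powr q) * indicator (ball p (r p)) w \<le> (\<Sum>p\<in>P. ennreal (cmod (f w) powr q) * indicator (ball p (r p)) w)"
          by (rule member_le_sum[OF p(1) _ P(1)]) simp
        with True p(2) show ?thesis by simp
      qed simp
    qed
    also have "\<dots> = (\<Sum>p\<in>P. \<integral>\<^sup>+w. ennreal (cmod (f w) powr q) * indicator (ball p (r p)) w \<partial>lebesgue)"
      using f by (intro nn_integral_sum borel_measurable_times_ennreal borel_measurable_indicator) simp_all
    also have "\<dots> < \<infinity>"
      using r(2) by (simp add: ball_enorm_finite_iff[OF r(1) fm] P(1))
    finally show ?thesis .
  qed
  with f show ?thesis by (simp add: Lloc_def)
qed

lemma holomorphic_ball_enorm_finite:
  assumes q: "0 < q" and r: "0 < r" and h: "h \<in> holomorphic_funs \<Omega>" and sub: "cball p r \<subseteq> \<Omega>"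
  shows "ball_enorm q p r h < top"
proof -
  have "compact (h ` cball p r)"
    by (intro compact_continuous_image continuous_on_subset[OF holomorphic_funs_imp_continuous_on[OF h] sub] compact_cball)
  then obtain M where "\<And>w. w \<in> cball p r \<Longrightarrow> cmod (h w) \<le> M"
    using compact_imp_bounded bounded_iff by (metis imageI)
  then show ?thesis by (intro ball_enorm_bounded_finite[OF q r, of _ _ M]) auto
qed

lemma Lloc_add:
  fixes f g :: "complex ^ 'n \<Rightarrow> complex"
  assumes q: "1 \<le> q" and f: "f \<in> Lloc q" and g: "g \<in> Lloc q"
  shows "(\<lambda>w. f w + g w) \<in> Lloc q"
proof (rule Lloc_local)
  show "(\<lambda>w. f w + g w) \<in> borel_measurable lebesgue" using LlocD(1)[OF f] LlocD(1)[OF g] by simp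
  fix p :: "complex ^ 'n"
  have "ball_enorm q p 1 (\<lambda>w. f w + g w) < top"
    using ball_enorm_triangle[OF q LlocD(2)[OF f] LlocD(2)[OF g], of p 1]
      Lloc_ball_enorm_finite[of q 1 f p] Lloc_ball_enorm_finite[of q 1 g p] q f g
    by (meson ennreal_add_less_top le_less_trans less_le_trans zero_less_one)
  then show "\<exists>r>0. ball_enorm q p r (\<lambda>w. f w + g w) < top"
    using zero_less_one by blast
qed (use q in simp)

lemma Lloc_cmult:
  fixes f :: "complex ^ 'n \<Rightarrow> complex"
  assumes q: "1 \<le> q" and f: "f \<in> Lloc q"
  shows "(\<lambda>w. c * f w) \<in> Lloc q"
proof (rule Lloc_local)
  show "(\<lambda>w. c * f w) \<in> borel_measurable lebesgue" using LlocD(1)[OF f] by simp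
  fix p :: "complex ^ 'n"
  have [measurable]: "f \<in> borel_measurable (lebesgue_on (ball p 1))" by (rule LlocD(2)[OF f])
  have "ball_enorm q p 1 (\<lambda>w. c * f w)
      = ennreal (cmod c) * ball_enorm q p 1 f"
    using q by (intro ball_enorm_cmult) simp_all
  also have "\<dots> < top" using Lloc_ball_enorm_finite[of q 1 f p] q f by (simp add: ennreal_mult_less_top)
  finally show "\<exists>r>0. ball_enorm q p r (\<lambda>w. c * f w) < top"
    using zero_less_one by blast
qed (use q in simp)

lemma Lloc_diff:
  assumes "1 \<le> q" "f \<in> Lloc q" "g \<in> Lloc q" shows "(\<lambda>w. f w - g w) \<in> Lloc q"
  using Lloc_add[OF assms(1,2) Lloc_cmult[OF assms(1,3), of "-1"]] by simp

lemma ae_holomorphic_measurable: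
  fixes f :: "complex ^ 'n \<Rightarrow> complex"
  assumes f: "f \<in> ae_holomorphic \<Omega>" and \<Omega>: "\<Omega> \<in> sets lebesgue"
  shows "f \<in> borel_measurable (lebesgue_on \<Omega>)"
proof -
  obtain h where h: "h \<in> holomorphic_funs \<Omega>" "AE z in lebesgue. z \<in> \<Omega> \<longrightarrow> f z = h z"
    using f by (rule ae_holomorphicE)
  have "(\<lambda>x. if x \<in> \<Omega> then h x else 0) \<in> borel_measurable lebesgue"
    by (rule borel_measurable_if_I[OF holomorphic_funs_measurable[OF h(1) \<Omega>] \<Omega>])
  moreover have "AE x in lebesgue. (if x \<in> \<Omega> then h x else 0) = (if x \<in> \<Omega> then f x else 0)"
    using h(2) by eventually_elim auto
  ultimately have "(\<lambda>x. if x \<in> \<Omega> then f x else 0) \<in> borel_measurable lebesgue"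
    by (rule borel_measurable_AE)
  then show ?thesis by (rule borel_measurable_if_D)
qed

lemma entire_ae_subset_Lloc:
  assumes q: "1 \<le> q" and f: "f \<in> entire_ae" shows "f \<in> Lloc q"
proof (rule Lloc_local)
  have fU: "f \<in> ae_holomorphic UNIV" using f by (simp add: entire_ae_eq)
  show "f \<in> borel_measurable lebesgue"
    using ae_holomorphic_measurable[OF fU] by simp
  obtain h where h: "h \<in> holomorphic_funs UNIV" "AE z in lebesgue. z \<in> UNIV \<longrightarrow> f z = h z"
    using fU by (rule ae_holomorphicE)
  fix p
  have "ball_enorm q p 1 f = ball_enorm q p 1 h"
    by (rule ball_enorm_cong_AE) (use h(2) in \<open>auto elim!: eventually_mono\<close>)
  also have "\<dots> < top" by (rule holomorphic_ball_enorm_finite[OF _ _ h(1)]) (use q in auto)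
  finally show "\<exists>r>0. ball_enorm q p r f < top"
    using zero_less_one by blast
qed (use q in simp)

lemma IDA_G_le:
  assumes q: "0 < q" and f: "f \<in> borel_measurable (lebesgue_on (ball z 1))"
    and h: "h \<in> holomorphic_funs (ball z 1)"
  shows "IDA_G q 1 f z \<le> ball_enorm q z 1 (\<lambda>w. f w - h w)"
  unfolding IDA_G_eq[OF q f] using h by (rule INF_lower)

text \<open>Sums of nearly optimal functions compete for the sum.\<close>

lemma IDA_G_add:
  assumes q: "1 \<le> q" and f [measurable]: "f \<in> borel_measurable (lebesgue_on (ball z 1))"
    and g [measurable]: "g \<in> borel_measurable (lebesgue_on (ball z 1))"
  shows "IDA_G q 1 (\<lambda>w. f w + g w) z \<le> IDA_G q 1 f z + IDA_G q 1 g z"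
proof (rule ennreal_le_epsilon)
  fix e :: real assume fin: "IDA_G q 1 f z + IDA_G q 1 g z < top" and e: "0 < e"
  have q0: "0 < q" using q by simp
  have ex: "\<exists>h\<in>holomorphic_funs (ball z 1). ball_enorm q z 1 (\<lambda>w. k w - h w) < IDA_G q 1 k z + ennreal (e / 2)"
    if "k \<in> borel_measurable (lebesgue_on (ball z 1))" "IDA_G q 1 k z < top" for k
  proof -
    have "IDA_G q 1 k z < IDA_G q 1 k z + ennreal (e / 2)"
      using that(2) e by (simp add: ennreal_add_left_cancel_less[of _ 0, simplified] less_top)
    then show ?thesis unfolding IDA_G_eq[OF q0 that(1)] INF_less_iff .
  qed
  obtain h where h: "h \<in> holomorphic_funs (ball z 1)" "ball_enorm q z 1 (\<lambda>w. f w - h w) < IDA_G q 1 f z + ennreal (e / 2)"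
    using ex[OF f] fin by (auto simp: less_top)
  obtain k where k: "k \<in> holomorphic_funs (ball z 1)" "ball_enorm q z 1 (\<lambda>w. g w - k w) < IDA_G q 1 g z + ennreal (e / 2)"
    using ex[OF g] fin by (auto simp: less_top)
  have [measurable]: "h \<in> borel_measurable (lebesgue_on (ball z 1))" "k \<in> borel_measurable (lebesgue_on (ball z 1))"
    using holomorphic_funs_measurable[OF h(1)] holomorphic_funs_measurable[OF k(1)] by simp_all
  have "IDA_G q 1 (\<lambda>w. f w + g w) z \<le> ball_enorm q z 1 (\<lambda>w. (f w + g w) - (h w + k w))"
    by (rule IDA_G_le[OF q0 _ holomorphic_funs_add[OF h(1) k(1)]]) simp
  also have "\<dots> = ball_enorm q z 1 (\<lambda>w. (f w - h w) + (g w - k w))" by (simp add: algebra_simps)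
  also have "\<dots> \<le> ball_enorm q z 1 (\<lambda>w. f w - h w) + ball_enorm q z 1 (\<lambda>w. g w - k w)"
    by (rule ball_enorm_triangle[OF q]) simp_all
  also have "\<dots> \<le> (IDA_G q 1 f z + ennreal (e / 2)) + (IDA_G q 1 g z + ennreal (e / 2))"
    using h(2) k(2) by (intro add_mono) auto
  also have "\<dots> = IDA_G q 1 f z + IDA_G q 1 g z + (ennreal (e / 2) + ennreal (e / 2))" by (simp add: ac_simps)
  also have "ennreal (e / 2) + ennreal (e / 2) = ennreal e" using e by (simp add: ennreal_plus[symmetric] del: ennreal_plus)
  finally show "IDA_G q 1 (\<lambda>w. f w + g w) z \<le> IDA_G q 1 f z + IDA_G q 1 g z + ennreal e" .
qed

lemma IDA_G_ae_holomorphic: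
  assumes q: "1 \<le> q" and f: "f \<in> ae_holomorphic (ball z 1)"
  shows "IDA_G q 1 f z = 0"
proof -
  obtain h where h: "h \<in> holomorphic_funs (ball z 1)" "AE w in lebesgue. w \<in> ball z 1 \<longrightarrow> f w = h w"
    using f by (rule ae_holomorphicE)
  have "ball_enorm q z 1 (\<lambda>w. f w - h w) = 0" by (rule ball_enorm_eq_0[OF _ h(2)]) simp
  then show ?thesis
    using IDA_G_le[OF _ ae_holomorphic_measurable[OF f] h(1), of q] q by simp
qed

text \<open>One inequality follows by scaling the competitors; applied to \<open>1 / c\<close> it gives the other.\<close>

lemma IDA_G_cmult:
  assumes q: "1 \<le> q" and f [measurable]: "f \<in> borel_measurable (lebesgue_on (ball z 1))"
  shows "IDA_G q 1 (\<lambda>w. c * f w) z = ennreal (cmod c) * IDA_G q 1 f z"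
proof (cases "c = 0")
  case True
  have "(\<lambda>w. 0) \<in> ae_holomorphic (ball z 1)"
    by (intro holomorphic_funs_imp_ae_holomorphic holomorphic_funs_const)
  with True show ?thesis using IDA_G_ae_holomorphic[OF q] by simp
next
  case False
  have q0: "0 < q" using q by simp
  have le: "ennreal (1 / cmod c) * IDA_G q 1 (\<lambda>w. c * g w) z \<le> IDA_G q 1 g z"
    if c: "c \<noteq> 0" and g [measurable]: "g \<in> borel_measurable (lebesgue_on (ball z 1))" for c g
    unfolding IDA_G_eq[OF q0 g]
  proof (rule INF_greatest)
    fix h assume h: "h \<in> holomorphic_funs (ball z 1)"
    have [measurable]: "h \<in> borel_measurable (lebesgue_on (ball z 1))"
      using holomorphic_funs_measurable[OF h] by simp
    have "IDA_G q 1 (\<lambda>w. c * g w) z \<le> ball_enorm q z 1 (\<lambda>w. c * g w - c * h w)"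
      by (rule IDA_G_le[OF q0 _ holomorphic_funs_cmult[OF h]]) simp
    also have "\<dots> = ennreal (cmod c) * ball_enorm q z 1 (\<lambda>w. g w - h w)"
      using ball_enorm_cmult[OF q0, of "\<lambda>w. g w - h w" z 1 c] by (simp add: right_diff_distrib)
    finally have "ennreal (1 / cmod c) * IDA_G q 1 (\<lambda>w. c * g w) z \<le> ennreal (1 / cmod c) * (ennreal (cmod c) * ball_enorm q z 1 (\<lambda>w. g w - h w))"
      by (rule mult_left_mono) simp
    also have "\<dots> = ball_enorm q z 1 (\<lambda>w. g w - h w)"
      using c by (simp add: mult.assoc[symmetric] ennreal_mult'[symmetric])
    finally show "ennreal (1 / cmod c) * IDA_G q 1 (\<lambda>w. c * g w) z \<le> ball_enorm q z 1 (\<lambda>w. g w - h w)" .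
  qed
  show ?thesis
  proof (rule antisym)
    have "ennreal (cmod c) * (ennreal (1 / cmod c) * IDA_G q 1 (\<lambda>w. c * f w) z) \<le> ennreal (cmod c) * IDA_G q 1 f z"
      by (rule mult_left_mono[OF le[OF False f]]) simp
    then show "IDA_G q 1 (\<lambda>w. c * f w) z \<le> ennreal (cmod c) * IDA_G q 1 f z"
      using False by (simp add: mult.assoc[symmetric] ennreal_mult'[symmetric])
    have "ennreal (1 / cmod (1 / c)) * IDA_G q 1 (\<lambda>w. (1 / c) * (c * f w)) z \<le> IDA_G q 1 (\<lambda>w. c * f w) z"
      by (rule le) (use False in auto)
    then show "ennreal (cmod c) * IDA_G q 1 f z \<le> IDA_G q 1 (\<lambda>w. c * f w) z"
      using False by (simp add: norm_divide)
  qed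
qed

text \<open>Minkowski's inequality bounds the norm of the sum of the absolute values, which is therefore finite
  almost everywhere.\<close>

lemma ball_enorm_suminf:
  fixes u :: "nat \<Rightarrow> complex ^ 'n \<Rightarrow> complex"
  assumes q: "1 \<le> q" and u [measurable]: "\<And>j. u j \<in> borel_measurable (lebesgue_on (ball z 1))"
    and fin: "(\<Sum>j. ball_enorm q z 1 (u j)) < top"
  shows "AE w in lebesgue. w \<in> ball z 1 \<longrightarrow> summable (\<lambda>j. cmod (u j w))"
    and "ball_enorm q z 1 (\<lambda>w. \<Sum>j. u j w) \<le> (\<Sum>j. ball_enorm q z 1 (u j))"
proof -
  let ?M = "average_measure (ball z 1)"
  have q0: "0 < q" using q by simp
  have le: "Lp_enorm ?M q (\<lambda>w. \<Sum>j. ennreal (cmod (u j w))) \<le> (\<Sum>j. ball_enorm q z 1 (u j))"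
    unfolding ball_enorm_def by (rule Lp_enorm_suminf[OF q]) simp
  have "AE w in ?M. (\<Sum>j. ennreal (cmod (u j w))) < top"
    by (rule Lp_enorm_finite_AE[OF q0]) (use le fin in \<open>auto simp: le_less_trans\<close>)
  then have sm: "AE w in ?M. summable (\<lambda>j. cmod (u j w))"
    by eventually_elim (auto intro!: summable_suminf_not_top simp: less_top)
  then show "AE w in lebesgue. w \<in> ball z 1 \<longrightarrow> summable (\<lambda>j. cmod (u j w))"
    by (simp add: AE_average_ball)
  from sm have "AE w in ?M. ennreal (cmod (\<Sum>j. u j w)) \<le> (\<Sum>j. ennreal (cmod (u j w)))"
  proof eventually_elim
    case (elim w)
    have "ennreal (cmod (\<Sum>j. u j w)) \<le> ennreal (\<Sum>j. cmod (u j w))"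
      using summable_norm[OF elim] by (rule ennreal_leI)
    also have "\<dots> = (\<Sum>j. ennreal (cmod (u j w)))"
      by (rule suminf_ennreal2[symmetric]) (use elim in auto)
    finally show ?case .
  qed
  then have "ball_enorm q z 1 (\<lambda>w. \<Sum>j. u j w) \<le> Lp_enorm ?M q (\<lambda>w. \<Sum>j. ennreal (cmod (u j w)))"
    unfolding ball_enorm_def by (rule Lp_enorm_mono_AE[OF q0])
  with le show "ball_enorm q z 1 (\<lambda>w. \<Sum>j. u j w) \<le> (\<Sum>j. ball_enorm q z 1 (u j))" by (rule order_trans[rotated])
qed

lemma ball_enorm_sum_subball_finite:
  fixes u :: "nat \<Rightarrow> complex ^ 'n \<Rightarrow> complex"
  assumes q: "0 < q" and u: "\<And>j. u j \<in> borel_measurable (lebesgue_on (ball z 1))"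
    and fin: "(\<Sum>j. ball_enorm q z 1 (u j)) < top" and r: "0 < r" "ball w r \<subseteq> ball z 1"
  shows "(\<Sum>j. ball_enorm q w r (u j)) < top"
proof -
  define C where "C = ennreal_powr (emeasure lebesgue (ball z 1) / emeasure lebesgue (ball w r)) (1 / q)"
  have C: "C < top"
    using emeasure_lebesgue_ball[of 1 z] emeasure_lebesgue_ball[of r w] r(1)
    by (simp add: C_def ennreal_divide_eq_top_iff flip: less_top)
  have "(\<Sum>j. ball_enorm q w r (u j)) \<le> (\<Sum>j. C * ball_enorm q z 1 (u j))"
    unfolding C_def by (intro suminf_le ball_enorm_subball q r) (use u in auto)
  also have "\<dots> = C * (\<Sum>j. ball_enorm q z 1 (u j))" by simp
  also have "\<dots> < top" using C fin by (simp add: ennreal_mult_less_top)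
  finally show ?thesis .
qed

text \<open>Choose holomorphic \<open>h k\<close> whose distance to \<open>f\<close> is at most \<open>1 / 2 ^ k\<close>. Their differences have summable
  norms, so \<open>h k\<close> converges locally uniformly to a holomorphic function, and also almost everywhere
  to \<open>f\<close>.\<close>

lemma IDA_G_eq_0_imp_ae_holomorphic:
  fixes f :: "complex ^ 'n \<Rightarrow> complex"
  assumes q: "1 \<le> q" and f [measurable]: "f \<in> borel_measurable (lebesgue_on (ball z 1))" and 0: "IDA_G q 1 f z = 0"
  shows "f \<in> ae_holomorphic (ball z 1)"
proof -
  have q0: "0 < q" using q by simp
  have "\<forall>k::nat. \<exists>h. h \<in> holomorphic_funs (ball z 1) \<and> ball_enorm q z 1 (\<lambda>w. f w - h w) < ennreal ((1 / 2) ^ k)"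
  proof
    fix k :: nat
    have "IDA_G q 1 f z < ennreal ((1 / 2) ^ k)" using 0 by simp
    then show "\<exists>h. h \<in> holomorphic_funs (ball z 1) \<and> ball_enorm q z 1 (\<lambda>w. f w - h w) < ennreal ((1 / 2) ^ k)"
      unfolding IDA_G_eq[OF q0 f] INF_less_iff by blast
  qed
  from choice[OF this] obtain h where h: "\<And>k. h k \<in> holomorphic_funs (ball z 1)"
    and fh: "\<And>k::nat. ball_enorm q z 1 (\<lambda>w. f w - h k w) < ennreal ((1 / 2) ^ k)" by blast
  have [measurable]: "h k \<in> borel_measurable (lebesgue_on (ball z 1))" for k
    using holomorphic_funs_measurable[OF h] by simp
  have geo: "(\<Sum>k. ennreal ((1 / 2) ^ k)) < top"
  proof -
    have "(\<Sum>k. ennreal ((1 / 2) ^ k)) = ennreal (\<Sum>k. (1 / 2) ^ k)"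
      by (rule suminf_ennreal2) (simp_all add: summable_geometric)
    then show ?thesis by (simp only: ennreal_less_top)
  qed
  have le: "ball_enorm q z 1 (\<lambda>w. f w - h k w) \<le> ennreal ((1 / 2) ^ k)" for k
    using fh[of k] by (rule less_imp_le)
  have le': "ball_enorm q z 1 (\<lambda>w. f w - h (Suc k) w) \<le> ennreal ((1 / 2) ^ k)" for k
    by (rule order_trans[OF le ennreal_leI]) simp
  have sum_fh: "(\<Sum>k. ball_enorm q z 1 (\<lambda>w. f w - h k w)) < top"
    by (rule le_less_trans[OF suminf_le[OF le] geo]) simp_all
  have sum_fh': "(\<Sum>k. ball_enorm q z 1 (\<lambda>w. f w - h (Suc k) w)) < top"
    by (rule le_less_trans[OF suminf_le[OF le'] geo]) simp_all
  define g where "g k w = h (Suc k) w - h k w" for k w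
  have g: "g k \<in> holomorphic_funs (ball z 1)" for k unfolding g_def by (intro holomorphic_funs_diff h)
  have [measurable]: "g k \<in> borel_measurable (lebesgue_on (ball z 1))" for k unfolding g_def by simp
  have sum_g: "(\<Sum>k. ball_enorm q z 1 (g k)) < top"
  proof -
    have "(\<Sum>k. ball_enorm q z 1 (g k)) \<le> (\<Sum>k. ball_enorm q z 1 (\<lambda>w. f w - h k w) + ball_enorm q z 1 (\<lambda>w. f w - h (Suc k) w))"
    proof (intro suminf_le allI)
      fix k
      have "ball_enorm q z 1 (\<lambda>w. (f w - h k w) - (f w - h (Suc k) w)) \<le>
        ball_enorm q z 1 (\<lambda>w. f w - h k w) + ball_enorm q z 1 (\<lambda>w. f w - h (Suc k) w)"
        by (rule ball_enorm_diff_triangle[OF q]) measurable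
      then show "ball_enorm q z 1 (g k) \<le> ball_enorm q z 1 (\<lambda>w. f w - h k w) + ball_enorm q z 1 (\<lambda>w. f w - h (Suc k) w)"
        by (simp add: g_def[abs_def])
    qed auto
    also have "\<dots> = (\<Sum>k. ball_enorm q z 1 (\<lambda>w. f w - h k w)) + (\<Sum>k. ball_enorm q z 1 (\<lambda>w. f w - h (Suc k) w))"
      by (rule suminf_add[symmetric]) auto
    also have "\<dots> < top" using sum_fh sum_fh' by simp
    finally show ?thesis .
  qed
  have loc: "\<exists>r>0. ball w r \<subseteq> ball z 1 \<and> (\<Sum>k. ball_enorm q w r (g k)) < top"
    if w: "w \<in> ball z 1" for w
  proof -
    obtain r where r: "0 < r" "ball w r \<subseteq> ball z 1" using w open_contains_ball open_ball by blast
    from ball_enorm_sum_subball_finite[OF q0 _ sum_g r] r show ?thesis by auto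
  qed
  have H: "(\<lambda>w. \<Sum>k. g k w) \<in> holomorphic_funs (ball z 1)" and sg: "\<And>w. w \<in> ball z 1 \<Longrightarrow> summable (\<lambda>k. g k w)"
    using holomorphic_funs_suminf_of_summable_norms[OF q open_ball g loc] by blast+
  have "AE w in lebesgue. w \<in> ball z 1 \<longrightarrow> summable (\<lambda>k. cmod (f w - h k w))"
    by (rule ball_enorm_suminf(1)[OF q _ sum_fh]) simp
  then have "AE w in lebesgue. w \<in> ball z 1 \<longrightarrow> f w = h 0 w + (\<Sum>k. g k w)"
  proof eventually_elim
    case (elim w)
    show ?case
    proof
      assume w: "w \<in> ball z 1"
      have "(\<lambda>k. f w - h k w) \<longlonglongrightarrow> 0"
        using summable_LIMSEQ_zero[of "\<lambda>k. cmod (f w - h k w)"] elim w by (simp add: tendsto_norm_zero_iff)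
      then have "(\<lambda>k. f w - (f w - h k w)) \<longlonglongrightarrow> f w - 0" by (intro tendsto_intros)
      then have 1: "(\<lambda>k. h k w) \<longlonglongrightarrow> f w" by simp
      have tel: "(\<lambda>k. h 0 w + (\<Sum>j<k. g j w)) = (\<lambda>k. h k w)"
        unfolding g_def by (simp add: sum_lessThan_telescope[of "\<lambda>k. h k w"])
      have "(\<lambda>k. h 0 w + (\<Sum>j<k. g j w)) \<longlonglongrightarrow> h 0 w + (\<Sum>k. g k w)"
        by (intro tendsto_intros summable_LIMSEQ sg w)
      then have "(\<lambda>k. h k w) \<longlonglongrightarrow> h 0 w + (\<Sum>k. g k w)" unfolding tel .
      with 1 show "f w = h 0 w + (\<Sum>k. g k w)" by (rule LIMSEQ_unique)
    qed
  qed
  with holomorphic_funs_add[OF h[of 0] H] show ?thesis by (rule ae_holomorphicI)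
qed

section \<open>Convergence of rapidly Cauchy sequences\<close>

lemma ida_enorm_eq: "ida_enorm s q f = Lp_enorm lebesgue s (IDA_G q 1 f)"
  by (simp add: ida_enorm_def Lp_enorm_def)

lemma ida_enorm_add:
  assumes "1 \<le> s" "1 \<le> q" "f \<in> Lloc q" "g \<in> Lloc q"
  shows "ida_enorm s q (\<lambda>w. f w + g w) \<le> ida_enorm s q f + ida_enorm s q g"
proof -
  have "ida_enorm s q (\<lambda>w. f w + g w) \<le> Lp_enorm lebesgue s (\<lambda>z. IDA_G q 1 f z + IDA_G q 1 g z)"
    unfolding ida_enorm_eq using assms
    by (intro Lp_enorm_mono_AE AE_I2 IDA_G_add LlocD(2)) auto
  also have "\<dots> \<le> ida_enorm s q f + ida_enorm s q g"
    unfolding ida_enorm_eq using assms by (intro Lp_enorm_add IDA_G_measurable)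
  finally show ?thesis .
qed

lemma ida_enorm_cmult:
  assumes "1 \<le> s" "1 \<le> q" "f \<in> Lloc q"
  shows "ida_enorm s q (\<lambda>w. c * f w) = ennreal (cmod c) * ida_enorm s q f"
proof -
  have "IDA_G q 1 (\<lambda>w. c * f w) = (\<lambda>z. ennreal (cmod c) * IDA_G q 1 f z)"
    by (rule ext) (intro IDA_G_cmult assms LlocD(2)[OF assms(3)])
  then show ?thesis
    unfolding ida_enorm_eq using assms by (simp add: Lp_enorm_cmult IDA_G_measurable)
qed

lemma IDA_iff: "f \<in> IDA s q \<longleftrightarrow> f \<in> Lloc q \<and> ida_enorm s q f < top"
  by (simp add: IDA_def)

lemma IDA_add:
  assumes "1 \<le> s" "1 \<le> q" "f \<in> IDA s q" "g \<in> IDA s q"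
  shows "(\<lambda>w. f w + g w) \<in> IDA s q"
  using assms ida_enorm_add[of s q f g] Lloc_add[of q f g]
  by (auto simp: IDA_iff intro: le_less_trans)

lemma IDA_cmult:
  assumes "1 \<le> s" "1 \<le> q" "f \<in> IDA s q"
  shows "(\<lambda>w. c * f w) \<in> IDA s q"
  using assms by (simp add: IDA_iff ida_enorm_cmult Lloc_cmult ennreal_mult_less_top)

lemma IDA_diff:
  assumes "1 \<le> s" "1 \<le> q" "f \<in> IDA s q" "g \<in> IDA s q"
  shows "(\<lambda>w. f w - g w) \<in> IDA s q"
  using IDA_add[OF assms(1-3) IDA_cmult[OF assms(1,2,4), of "-1"]] by simp

lemma ida_enorm_entire:
  assumes "1 \<le> q" "f \<in> entire_ae" shows "ida_enorm s q f = 0"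
proof -
  have "IDA_G q 1 f z = 0" for z
    using assms(2) by (intro IDA_G_ae_holomorphic[OF assms(1)]) (simp add: entire_ae_eq ae_holomorphic_subset[of f UNIV])
  then show ?thesis by (simp add: ida_enorm_eq Lp_enorm_def)
qed

lemma entire_ae_subset_IDA:
  assumes "1 \<le> q" shows "entire_ae \<subseteq> IDA s q"
  by (auto simp: IDA_iff entire_ae_subset_Lloc[OF assms] ida_enorm_entire[OF assms])

text \<open>The centres of the balls on which \<open>f\<close> is almost everywhere holomorphic are dense, so these balls cover
  the space.\<close>

lemma ida_enorm_eq_0_iff:
  assumes s: "1 \<le> s" and q: "1 \<le> q" and f: "f \<in> Lloc q"
  shows "ida_enorm s q f = 0 \<longleftrightarrow> f \<in> entire_ae"
proof
  assume "ida_enorm s q f = 0"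
  then have "AE z in lebesgue. IDA_G q 1 f z = 0"
    using s q f by (simp add: ida_enorm_eq Lp_enorm_eq_0_iff IDA_G_measurable)
  then have ae: "AE z in lebesgue. z \<in> {z. IDA_G q 1 f z = 0}" by simp
  have "f \<in> ae_holomorphic UNIV"
  proof (rule ae_holomorphic_local)
    fix p
    obtain z where z: "IDA_G q 1 f z = 0" "dist z p < 1"
      using AE_imp_dense[OF ae, of 1 p] by auto
    have "f \<in> ae_holomorphic (ball z 1)"
      by (rule IDA_G_eq_0_imp_ae_holomorphic[OF q LlocD(2)[OF f] z(1)])
    with z(2) show "\<exists>U. open U \<and> p \<in> U \<and> f \<in> ae_holomorphic U"
      by (intro exI[of _ "ball z 1"]) auto
  qed
  then show "f \<in> entire_ae" by (simp add: entire_ae_eq)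
qed (rule ida_enorm_entire[OF q])

text \<open>At distance \<open>0\<close> the infimum is attained, because \<open>f\<close> is then almost everywhere holomorphic. A relative
  error is essential for completeness: an absolute error, constant in \<open>z\<close>, would not be in \<open>L\<^sup>s\<close> of the
  whole space.\<close>

lemma IDA_G_attained_up_to_factor_2:
  fixes f :: "complex ^ 'n \<Rightarrow> complex"
  assumes q: "1 \<le> q" and f: "f \<in> borel_measurable (lebesgue_on (ball z 1))" and fin: "IDA_G q 1 f z < top"
  shows "\<exists>h\<in>holomorphic_funs (ball z 1). ball_enorm q z 1 (\<lambda>w. f w - h w) \<le> 2 * IDA_G q 1 f z"
proof (cases "IDA_G q 1 f z = 0")
  case True
  from IDA_G_eq_0_imp_ae_holomorphic[OF q f True] obtain h where
    h: "h \<in> holomorphic_funs (ball z 1)" "AE w in lebesgue. w \<in> ball z 1 \<longrightarrow> f w = h w"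
    by (rule ae_holomorphicE)
  have "ball_enorm q z 1 (\<lambda>w. f w - h w) = 0" by (rule ball_enorm_eq_0[OF _ h(2)]) simp
  then show ?thesis using h(1) by (intro bexI[of _ h]) simp_all
next
  case False
  have "IDA_G q 1 f z < 2 * IDA_G q 1 f z"
    using False fin by (cases "IDA_G q 1 f z")
      (auto simp: ennreal_mult''[symmetric] ennreal_numeral[symmetric] ennreal_less_iff simp del: ennreal_numeral)
  then obtain h where "h \<in> holomorphic_funs (ball z 1)" "ball_enorm q z 1 (\<lambda>w. f w - h w) < 2 * IDA_G q 1 f z"
    using IDA_G_eq[of q f z] q f by (auto simp: INF_less_iff)
  then show ?thesis by (intro bexI[of _ h]) auto
qed

text \<open>The holomorphic part \<open>H\<close> may be unbounded near the boundary of its ball, so integrability is obtained on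
  smaller balls, whose closures lie inside.\<close>

lemma Lloc_of_local_approximation:
  fixes F f0 :: "complex ^ 'n \<Rightarrow> complex"
  assumes q: "1 \<le> q" and f0: "f0 \<in> Lloc q"
    and cover: "\<And>p. \<exists>z\<in>Z. dist z p < 1 / 2"
    and loc: "\<And>z. z \<in> Z \<Longrightarrow> \<exists>u H. u \<in> borel_measurable (lebesgue_on (ball z 1)) \<and> ball_enorm q z 1 u < top \<and>
      H \<in> holomorphic_funs (ball z 1) \<and> (AE w in lebesgue. w \<in> ball z 1 \<longrightarrow> F w = f0 w + (u w + H w))"
  shows "F \<in> Lloc q"
proof (rule Lloc_local)
  have q0: "0 < q" using q by simp
  then show "0 < q" .
  show "F \<in> borel_measurable lebesgue"
  proof -
    have *: "F \<in> borel_measurable (lebesgue_on (ball z 1))" if "z \<in> Z" for z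
    proof -
      obtain u H where u: "u \<in> borel_measurable (lebesgue_on (ball z 1))"
        and H: "H \<in> holomorphic_funs (ball z 1)" and F: "AE w in lebesgue. w \<in> ball z 1 \<longrightarrow> F w = f0 w + (u w + H w)"
        using loc[OF \<open>z \<in> Z\<close>] by blast
      have "H \<in> borel_measurable (lebesgue_on (ball z 1))" using holomorphic_funs_measurable[OF H] by simp
      then have "(\<lambda>w. f0 w + (u w + H w)) \<in> borel_measurable (lebesgue_on (ball z 1))"
        using u LlocD(2)[OF f0] by (intro borel_measurable_add)
      then have "(\<lambda>x. if x \<in> ball z 1 then f0 x + (u x + H x) else 0) \<in> borel_measurable lebesgue"
        by (rule borel_measurable_if_I) simp
      moreover have "AE x in lebesgue. (if x \<in> ball z 1 then f0 x + (u x + H x) else 0) = (if x \<in> ball z 1 then F x else 0)"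
        using F by eventually_elim auto
      ultimately have "(\<lambda>x. if x \<in> ball z 1 then F x else 0) \<in> borel_measurable lebesgue" by (rule borel_measurable_AE)
      then show ?thesis by (rule borel_measurable_if_D)
    qed
    obtain \<V> where V: "\<V> \<subseteq> (\<lambda>z. ball z 1) ` Z" "countable \<V>" "\<Union>\<V> = \<Union>((\<lambda>z. ball z 1) ` Z)"
      using Lindelof[of "(\<lambda>z. ball z 1) ` Z"] by (metis imageE open_ball)
    have all: "p \<in> \<Union>\<V>" for p
    proof -
      obtain z where "z \<in> Z" "dist z p < 1 / 2" using cover by blast
      then have "p \<in> ball z 1" by simp
      with \<open>z \<in> Z\<close> show ?thesis unfolding V(3) by blast
    qed
    show ?thesis
    proof (rule measurable_piecewise_restrict[OF V(2)])
      fix \<Omega> assume "\<Omega> \<in> \<V>"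
      then obtain z where z: "z \<in> Z" "\<Omega> = ball z 1" using V(1) by blast
      show "\<Omega> \<inter> space lebesgue \<in> sets lebesgue" unfolding z(2) by simp
      show "F \<in> borel_measurable (lebesgue_on \<Omega>)" unfolding z(2) by (rule *[OF z(1)])
    next
      show "space lebesgue \<subseteq> \<Union>\<V>" by (rule subsetI) (rule all)
    qed
  qed
  fix p
  obtain z where z: "z \<in> Z" "dist z p < 1 / 2" using cover by blast
  obtain u H where um: "u \<in> borel_measurable (lebesgue_on (ball z 1))" and u: "ball_enorm q z 1 u < top"
    and H: "H \<in> holomorphic_funs (ball z 1)" and F: "AE w in lebesgue. w \<in> ball z 1 \<longrightarrow> F w = f0 w + (u w + H w)"
    using loc[OF z(1)] by blast
  have sub: "cball p (1 / 4) \<subseteq> ball z 1"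
  proof
    fix x assume "x \<in> cball p (1 / 4)"
    then show "x \<in> ball z 1" using dist_triangle[of z x p] z(2) by simp
  qed
  then have sub': "ball p (1 / 4) \<subseteq> ball z 1" using ball_subset_cball by blast
  let ?N = "\<lambda>v. ball_enorm q p (1 / 4) v"
  have um': "u \<in> borel_measurable (lebesgue_on (ball p (1 / 4)))" by (rule measurable_restrict_mono[OF um sub'])
  have Hm: "H \<in> borel_measurable (lebesgue_on (ball p (1 / 4)))"
    by (rule holomorphic_funs_measurable[OF holomorphic_funs_subset[OF H sub']]) simp
  have "?N F = ?N (\<lambda>w. f0 w + (u w + H w))"
    by (rule ball_enorm_cong_AE) (use F sub' in \<open>auto elim!: eventually_mono\<close>)
  also have "\<dots> \<le> ?N f0 + ?N (\<lambda>w. u w + H w)"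
    by (rule ball_enorm_triangle[OF q LlocD(2)[OF f0] borel_measurable_add[OF um' Hm]])
  also have "\<dots> \<le> ?N f0 + (?N u + ?N H)"
    by (intro add_left_mono ball_enorm_triangle[OF q um' Hm])
  also have "\<dots> < top"
  proof -
    have "?N f0 < top" by (rule Lloc_ball_enorm_finite[OF q0 _ f0]) simp
    moreover have "?N H < top" by (rule holomorphic_ball_enorm_finite[OF q0 _ H sub]) simp
    moreover have "?N u < top"
    proof -
      have "?N u \<le> ennreal_powr (emeasure lebesgue (ball z 1) / emeasure lebesgue (ball p (1 / 4))) (1 / q) * ball_enorm q z 1 u"
        by (rule ball_enorm_subball[OF q0 _ _ sub']) (use um in simp_all)
      also have "\<dots> < top"
        using u emeasure_lebesgue_ball[of 1 z] emeasure_lebesgue_ball[of "1 / 4" p]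
        by (simp add: ennreal_mult_eq_top_iff ennreal_divide_eq_top_iff flip: less_top)
      finally show ?thesis .
    qed
    ultimately show ?thesis by simp
  qed
  finally show "\<exists>r>0. ball_enorm q p r F < top"
    by (intro exI[of _ "1 / 4"]) simp
qed

text \<open>The holomorphic functions \<open>h z j\<close> are nearly optimal for the differences \<open>D j\<close> of the sequence, \<open>u z j\<close> is
  the remaining error, and \<open>\<Phi> z\<close> is the limit of the sequence on the ball about \<open>z\<close> modulo holomorphic
  functions. The solution \<open>F\<close> of the Cousin problem for \<open>\<Phi>\<close> satisfies
  \<open>F - f k = (\<Sum>j. u z (k + j))\<close> up to a holomorphic function, so that
  \<open>IDA_G q 1 (F - f k) z\<close> is at most twice the tail sum of the distances of the \<open>D j\<close>.\<close>

lemma IDA_rapid_Cauchy_converges: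
  fixes f :: "nat \<Rightarrow> complex ^ 'n \<Rightarrow> complex"
  assumes s: "1 \<le> s" and q: "1 \<le> q" and f: "\<And>k. f k \<in> IDA s q"
    and fast: "\<And>k. ida_enorm s q (\<lambda>w. f (Suc k) w - f k w) \<le> ennreal ((1 / 2) ^ k)"
  shows "\<exists>F\<in>IDA s q. \<forall>k. ida_enorm s q (\<lambda>w. F w - f k w) \<le> ennreal (4 * (1 / 2) ^ k)"
proof -
  have s0: "0 < s" and q0: "0 < q" using s q by simp_all
  have fL: "f k \<in> Lloc q" for k using f by (simp add: IDA_iff)
  define D where "D j w = f (Suc j) w - f j w" for j w
  have DL: "D j \<in> Lloc q" for j unfolding D_def by (rule Lloc_diff[OF q fL fL])
  note Dm = LlocD(2)[OF DL] and fm = LlocD(2)[OF fL]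
  define G where "G j = IDA_G q 1 (D j)" for j
  have Gm [measurable]: "G j \<in> borel_measurable lebesgue" for j unfolding G_def by (rule IDA_G_measurable[OF q DL])
  have G_fast: "Lp_enorm lebesgue s (G j) \<le> ennreal ((1 / 2) ^ j)" for j
    using fast[of j] by (simp add: ida_enorm_eq G_def D_def[abs_def])
  have geo: "(\<Sum>j. ennreal ((1 / 2) ^ (k + j))) = ennreal (2 * (1 / 2) ^ k)" for k
  proof -
    have "(\<lambda>j. (1 / 2) ^ (k + j)) sums ((1 / 2) ^ k * (1 / (1 - 1 / 2)) :: real)"
      unfolding power_add by (intro sums_mult geometric_sums) simp
    then have sm: "(\<lambda>j. (1 / 2) ^ (k + j)) sums (2 * (1 / 2) ^ k :: real)" by (simp add: mult.commute)
    have "(\<Sum>j. ennreal ((1 / 2) ^ (k + j))) = ennreal (\<Sum>j. (1 / 2) ^ (k + j))"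
      by (rule suminf_ennreal2) (use sm in \<open>auto simp: sums_iff\<close>)
    then show ?thesis using sm by (simp add: sums_iff)
  qed
  \<comment> \<open>Minkowski in \<open>L\<^sup>s\<close> bounds all tails of the distances at once.\<close>
  have G_tail: "Lp_enorm lebesgue s (\<lambda>z. \<Sum>j. G (k + j) z) \<le> ennreal (2 * (1 / 2) ^ k)" for k
  proof -
    have "Lp_enorm lebesgue s (\<lambda>z. \<Sum>j. G (k + j) z) \<le> (\<Sum>j. Lp_enorm lebesgue s (G (k + j)))"
      by (rule Lp_enorm_suminf[OF s Gm])
    also have "\<dots> \<le> (\<Sum>j. ennreal ((1 / 2) ^ (k + j)))" by (rule suminf_le[OF G_fast]) simp_all
    finally show ?thesis unfolding geo .
  qed
  define Z where "Z = {z. (\<Sum>j. G j z) < top}"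
  have AE_Z: "AE z in lebesgue. z \<in> Z"
  proof -
    have "Lp_enorm lebesgue s (\<lambda>z. \<Sum>j. G j z) < top"
      using G_tail[of 0] by (simp add: le_less_trans)
    from Lp_enorm_finite_AE[OF s0 _ this] show ?thesis by (simp add: Z_def)
  qed
  have cover: "\<exists>z\<in>Z. dist z p < 1 / 2" for p by (rule AE_imp_dense[OF AE_Z]) simp
  have "\<exists>h\<in>holomorphic_funs (ball z 1). ball_enorm q z 1 (\<lambda>w. D j w - h w) \<le> 2 * G j z" if z: "z \<in> Z" for z j
    unfolding G_def
  proof (rule IDA_G_attained_up_to_factor_2[OF q Dm])
    show "IDA_G q 1 (D j) z < top"
      using z ennreal_suminf_lessD[of "\<lambda>j. G j z" top j] by (simp add: Z_def G_def)
  qed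
  then have "\<forall>p. \<exists>h. fst p \<in> Z \<longrightarrow> h \<in> holomorphic_funs (ball (fst p) 1) \<and>
      ball_enorm q (fst p) 1 (\<lambda>w. D (snd p) w - h w) \<le> 2 * G (snd p) (fst p)"
    by blast
  from choice[OF this] obtain hh where hh: "\<And>p. fst p \<in> Z \<Longrightarrow> hh p \<in> holomorphic_funs (ball (fst p) 1) \<and>
      ball_enorm q (fst p) 1 (\<lambda>w. D (snd p) w - hh p w) \<le> 2 * G (snd p) (fst p)"
    by blast
  define h where "h z j = hh (z, j)" for z and j :: nat
  have h: "h z j \<in> holomorphic_funs (ball z 1)" and hD: "ball_enorm q z 1 (\<lambda>w. D j w - h z j w) \<le> 2 * G j z"
    if "z \<in> Z" for z j
    using hh[of "(z, j)"] that by (simp_all add: h_def)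
  define u where "u z j w = D j w - h z j w" for z j w
  have um: "u z j \<in> borel_measurable (lebesgue_on (ball z 1))" if "z \<in> Z" for z j
    unfolding u_def by (rule borel_measurable_diff[OF Dm holomorphic_funs_measurable[OF h[OF that]]]) simp
  have u_tail: "(\<Sum>j. ball_enorm q z 1 (u z (k + j))) \<le> 2 * (\<Sum>j. G (k + j) z)" if "z \<in> Z" for z k
  proof -
    have "(\<Sum>j. ball_enorm q z 1 (u z (k + j))) \<le> (\<Sum>j. 2 * G (k + j) z)"
      by (rule suminf_le) (use hD[OF that] in \<open>simp_all add: u_def[abs_def]\<close>)
    then show ?thesis by simp
  qed
  have u_fin: "(\<Sum>j. ball_enorm q z 1 (u z (k + j))) < top" if z: "z \<in> Z" for z k
  proof -
    have "(\<Sum>j. G (k + j) z) \<le> (\<Sum>j. G j z)"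
    proof -
      have "(\<Sum>j. G j z) = (\<Sum>j. G (j + k) z) + (\<Sum>j<k. G j z)"
        by (rule suminf_offset) simp
      then show ?thesis by (simp add: add.commute add_increasing2)
    qed
    also have "\<dots> < top" using z by (simp add: Z_def)
    finally have "2 * (\<Sum>j. G (k + j) z) < top" by (simp add: ennreal_mult_less_top)
    with u_tail[OF z] show ?thesis by (rule le_less_trans)
  qed
  have u_sum: "AE w in lebesgue. w \<in> ball z 1 \<longrightarrow> summable (\<lambda>j. u z j w)" if z: "z \<in> Z" for z
  proof -
    have "AE w in lebesgue. w \<in> ball z 1 \<longrightarrow> summable (\<lambda>j. cmod (u z j w))"
      by (rule ball_enorm_suminf(1)[OF q um[OF z]]) (use u_fin[OF z, of 0] in simp)
    then show ?thesis by eventually_elim (auto intro: summable_norm_cancel)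
  qed
  define \<Phi> where "\<Phi> z w = f 0 w + (\<Sum>j. u z j w)" for z w
  have cocycle: "(\<lambda>w. \<Phi> z w - \<Phi> z' w) \<in> ae_holomorphic (ball z 1 \<inter> ball z' 1)" if z: "z \<in> Z" and z': "z' \<in> Z" for z z'
  proof -
    let ?V = "ball z 1 \<inter> ball z' 1"
    have hV: "(\<lambda>w. h z' j w - h z j w) \<in> holomorphic_funs ?V" for j
      by (intro holomorphic_funs_diff holomorphic_funs_subset[OF h[OF z]] holomorphic_funs_subset[OF h[OF z']]) auto
    have loc: "\<exists>r>0. ball w r \<subseteq> ?V \<and> (\<Sum>j. ball_enorm q w r (\<lambda>x. h z' j x - h z j x)) < top"
      if w: "w \<in> ?V" for w
    proof -
      have "open ?V" by (intro open_Int open_ball)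
      then obtain r where r: "0 < r" "ball w r \<subseteq> ?V" using w open_contains_ball by blast
      let ?N = "\<lambda>v. ball_enorm q w r v"
      have m: "u z j \<in> borel_measurable (lebesgue_on (ball w r))" "u z' j \<in> borel_measurable (lebesgue_on (ball w r))" for j
        using measurable_restrict_mono[OF um[OF z]] measurable_restrict_mono[OF um[OF z']] r(2) by blast+
      have "?N (\<lambda>x. h z' j x - h z j x) \<le> ?N (u z j) + ?N (u z' j)" for j
      proof -
        have "?N (\<lambda>x. u z j x - u z' j x) \<le> ?N (u z j) + ?N (u z' j)"
          by (rule ball_enorm_diff_triangle[OF q m])
        then show ?thesis by (simp add: u_def)
      qed
      then have "(\<Sum>j. ?N (\<lambda>x. h z' j x - h z j x)) \<le> (\<Sum>j. ?N (u z j) + ?N (u z' j))"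
        by (intro suminf_le) simp_all
      also have "\<dots> = (\<Sum>j. ?N (u z j)) + (\<Sum>j. ?N (u z' j))"
        by (rule suminf_add[symmetric]) simp_all
      also have "\<dots> < top"
        using ball_enorm_sum_subball_finite[OF q0 um[OF z] _ r(1)] ball_enorm_sum_subball_finite[OF q0 um[OF z'] _ r(1)]
          u_fin[OF z, of 0] u_fin[OF z', of 0] r(2) by simp
      finally show ?thesis using r by blast
    qed
    have "open ?V" by (intro open_Int open_ball)
    note hol = holomorphic_funs_suminf_of_summable_norms(1)[OF q this hV loc]
    have "AE w in lebesgue. w \<in> ?V \<longrightarrow> \<Phi> z w - \<Phi> z' w = (\<Sum>j. h z' j w - h z j w)"
      using u_sum[OF z] u_sum[OF z']
    proof eventually_elim
      case (elim w)
      show ?case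
      proof
        assume "w \<in> ?V"
        then have "(\<Sum>j. u z j w) - (\<Sum>j. u z' j w) = (\<Sum>j. u z j w - u z' j w)"
          using elim by (intro suminf_diff) auto
        then show "\<Phi> z w - \<Phi> z' w = (\<Sum>j. h z' j w - h z j w)" by (simp add: \<Phi>_def u_def)
      qed
    qed
    with hol show ?thesis by (rule ae_holomorphicI)
  qed
  obtain F where F: "glues_on Z \<Phi> UNIV F" using exists_global_gluing[OF cover cocycle] by blast
  have "\<exists>H. H \<in> holomorphic_funs (ball z 1) \<and> (AE w in lebesgue. w \<in> ball z 1 \<longrightarrow> F w = \<Phi> z w + H w)" if z: "z \<in> Z" for z
  proof -
    have "(\<lambda>w. F w - \<Phi> z w) \<in> ae_holomorphic (ball z 1)" using F z by (auto simp: glues_on_def)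
    then obtain H where H: "H \<in> holomorphic_funs (ball z 1)" "AE w in lebesgue. w \<in> ball z 1 \<longrightarrow> F w - \<Phi> z w = H w"
      by (rule ae_holomorphicE)
    from H(2) have "AE w in lebesgue. w \<in> ball z 1 \<longrightarrow> F w = \<Phi> z w + H w" by eventually_elim (auto simp: algebra_simps)
    with H(1) show ?thesis by blast
  qed
  note FH = this
  have FL: "F \<in> Lloc q"
  proof (rule Lloc_of_local_approximation[OF q fL[of 0] cover])
    fix z assume z: "z \<in> Z"
    obtain H where H: "H \<in> holomorphic_funs (ball z 1)" "AE w in lebesgue. w \<in> ball z 1 \<longrightarrow> F w = \<Phi> z w + H w"
      using FH[OF z] by blast
    have "ball_enorm q z 1 (\<lambda>w. \<Sum>j. u z j w) \<le> (\<Sum>j. ball_enorm q z 1 (u z j))"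
      by (rule ball_enorm_suminf(2)[OF q um[OF z]]) (use u_fin[OF z, of 0] in simp)
    also have "\<dots> < top" using u_fin[OF z, of 0] by simp
    finally have "ball_enorm q z 1 (\<lambda>w. \<Sum>j. u z j w) < top" .
    moreover have "(\<lambda>w. \<Sum>j. u z j w) \<in> borel_measurable (lebesgue_on (ball z 1))"
      by (rule borel_measurable_suminf[OF um[OF z]])
    moreover have "AE w in lebesgue. w \<in> ball z 1 \<longrightarrow> F w = f 0 w + ((\<Sum>j. u z j w) + H w)"
      using H(2) by (simp add: \<Phi>_def add.assoc)
    ultimately show "\<exists>u H. u \<in> borel_measurable (lebesgue_on (ball z 1)) \<and> ball_enorm q z 1 u < top \<and>
      H \<in> holomorphic_funs (ball z 1) \<and> (AE w in lebesgue. w \<in> ball z 1 \<longrightarrow> F w = f 0 w + (u w + H w))"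
      using H(1) by blast
  qed
  have tail: "ida_enorm s q (\<lambda>w. F w - f k w) \<le> ennreal (4 * (1 / 2) ^ k)" for k
  proof -
    have pt: "IDA_G q 1 (\<lambda>w. F w - f k w) z \<le> 2 * (\<Sum>j. G (k + j) z)" if z: "z \<in> Z" for z
    proof -
      obtain H where H: "H \<in> holomorphic_funs (ball z 1)" "AE w in lebesgue. w \<in> ball z 1 \<longrightarrow> F w = \<Phi> z w + H w"
        using FH[OF z] by blast
      have "IDA_G q 1 (\<lambda>w. F w - f k w) z \<le> ball_enorm q z 1 (\<lambda>w. (F w - f k w) - (H w - (\<Sum>j<k. h z j w)))"
        by (rule IDA_G_le[OF q0 LlocD(2)[OF Lloc_diff[OF q FL fL]]])
           (intro holomorphic_funs_diff H(1) holomorphic_funs_sum h z)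
      also have "\<dots> = ball_enorm q z 1 (\<lambda>w. \<Sum>j. u z (k + j) w)"
      proof (rule ball_enorm_cong_AE)
        show "AE w in lebesgue. w \<in> ball z 1 \<longrightarrow> (F w - f k w) - (H w - (\<Sum>j<k. h z j w)) = (\<Sum>j. u z (k + j) w)"
          using H(2) u_sum[OF z]
        proof eventually_elim
          case (elim w)
          show ?case
          proof
            assume w: "w \<in> ball z 1"
            have "(\<Sum>j. u z j w) = (\<Sum>j. u z (j + k) w) + (\<Sum>j<k. u z j w)"
              using elim w by (intro suminf_split_initial_segment) auto
            moreover have "(\<Sum>j<k. D j w) = f k w - f 0 w"
              unfolding D_def by (rule sum_lessThan_telescope)
            then have "(\<Sum>j<k. u z j w) = f k w - f 0 w - (\<Sum>j<k. h z j w)"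
              by (simp add: u_def sum_subtractf)
            ultimately show "(F w - f k w) - (H w - (\<Sum>j<k. h z j w)) = (\<Sum>j. u z (k + j) w)"
              using elim w by (simp add: \<Phi>_def add.commute[of k])
          qed
        qed
      qed simp
      also have "\<dots> \<le> (\<Sum>j. ball_enorm q z 1 (u z (k + j)))"
        by (rule ball_enorm_suminf(2)[OF q um[OF z] u_fin[OF z]])
      also have "\<dots> \<le> 2 * (\<Sum>j. G (k + j) z)" by (rule u_tail[OF z])
      finally show ?thesis .
    qed
    have "ida_enorm s q (\<lambda>w. F w - f k w) \<le> Lp_enorm lebesgue s (\<lambda>z. 2 * (\<Sum>j. G (k + j) z))"
      unfolding ida_enorm_eq by (rule Lp_enorm_mono_AE[OF s0]) (use AE_Z pt in \<open>auto elim!: eventually_mono\<close>)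
    also have "\<dots> = 2 * Lp_enorm lebesgue s (\<lambda>z. \<Sum>j. G (k + j) z)"
      by (rule Lp_enorm_cmult[OF s0]) measurable
    also have "\<dots> \<le> 2 * ennreal (2 * (1 / 2) ^ k)" by (rule mult_left_mono[OF G_tail]) simp
    also have "\<dots> = ennreal (4 * (1 / 2) ^ k)"
      by (simp add: ennreal_mult''[symmetric] ennreal_numeral[symmetric] ennreal_mult'[symmetric] del: ennreal_numeral)
    finally show ?thesis .
  qed
  have "F \<in> IDA s q"
  proof -
    have "(\<lambda>w. F w - f 0 w) \<in> IDA s q"
      using Lloc_diff[OF q FL fL[of 0]] tail[of 0] by (simp add: IDA_iff le_less_trans)
    from IDA_add[OF s q this f[of 0]] show ?thesis by simp
  qed
  with tail show ?thesis by blast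
qed

section \<open>Quotient modules and the quotient norm\<close>

lemma quotient_module_simps:
  "carrier (quotient_module M N) = a_rcosets\<^bsub>M\<^esub> N"
  "zero (quotient_module M N) = N"
  "add (quotient_module M N) A B = A <+>\<^bsub>M\<^esub> B"
  "smult (quotient_module M N) c A = (\<Union>x\<in>A. N +>\<^bsub>M\<^esub> (c \<odot>\<^bsub>M\<^esub> x))"
  by (simp_all add: quotient_module_def)

lemma (in module) abelian_subgroup_of_submodule:
  assumes "submodule N R M" shows "abelian_subgroup N M"
proof (rule abelian_subgroupI3)
  show "additive_subgroup N M"
    using assms by (simp add: additive_subgroup_def submodule_def)
  show "abelian_group M" by (rule M.abelian_group_axioms)
qed

text \<open>Submodules are closed under scalars, so all members of the coset contribute the same coset to the
  union.\<close>

lemma (in module) quotient_smult_coset: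
  assumes N: "submodule N R M" and c: "c \<in> carrier R" and x: "x \<in> carrier M"
  shows "c \<odot>\<^bsub>quotient_module M N\<^esub> (N +>\<^bsub>M\<^esub> x) = N +>\<^bsub>M\<^esub> (c \<odot>\<^bsub>M\<^esub> x)"
proof -
  interpret N: abelian_subgroup N M by (rule abelian_subgroup_of_submodule[OF N])
  have "N +>\<^bsub>M\<^esub> (c \<odot>\<^bsub>M\<^esub> y) = N +>\<^bsub>M\<^esub> (c \<odot>\<^bsub>M\<^esub> x)" if y: "y \<in> N +>\<^bsub>M\<^esub> x" for y
  proof -
    obtain n where n: "n \<in> N" "y = n \<oplus>\<^bsub>M\<^esub> x" using y by (auto simp: a_r_coset_def')
    have nM: "n \<in> carrier M" using n(1) N.a_subset by blast
    have "c \<odot>\<^bsub>M\<^esub> y = c \<odot>\<^bsub>M\<^esub> n \<oplus>\<^bsub>M\<^esub> c \<odot>\<^bsub>M\<^esub> x"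
      unfolding n(2) by (rule smult_r_distr[OF c nM x])
    moreover have "c \<odot>\<^bsub>M\<^esub> n \<in> N" by (rule submodule.smult_closed[OF N c n(1)])
    ultimately have "c \<odot>\<^bsub>M\<^esub> y \<in> N +>\<^bsub>M\<^esub> (c \<odot>\<^bsub>M\<^esub> x)" by (auto simp: a_r_coset_def')
    then show ?thesis
      using M.a_repr_independence[OF _ smult_closed[OF c x] N.a_subgroup] by simp
  qed
  moreover have "x \<in> N +>\<^bsub>M\<^esub> x" by (rule N.a_rcos_self[OF x])
  ultimately show ?thesis unfolding quotient_module_simps by blast
qed

lemma (in module) quotient_add_coset:
  assumes N: "submodule N R M" and x: "x \<in> carrier M" and y: "y \<in> carrier M"
  shows "(N +>\<^bsub>M\<^esub> x) \<oplus>\<^bsub>quotient_module M N\<^esub> (N +>\<^bsub>M\<^esub> y) = N +>\<^bsub>M\<^esub> (x \<oplus>\<^bsub>M\<^esub> y)"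
proof -
  interpret N: abelian_subgroup N M by (rule abelian_subgroup_of_submodule[OF N])
  show ?thesis unfolding quotient_module_simps by (rule N.a_rcos_sum[OF x y])
qed

lemma (in module) carrier_quotient:
  "carrier (quotient_module M N) = (\<lambda>x. N +>\<^bsub>M\<^esub> x) ` carrier M"
  by (auto simp: quotient_module_simps A_RCOSETS_def')

lemma (in module) module_quotient:
  assumes N: "submodule N R M" shows "module R (quotient_module M N)"
proof -
  interpret N: abelian_subgroup N M by (rule abelian_subgroup_of_submodule[OF N])
  let ?Q = "quotient_module M N"
  note [simp] = quotient_add_coset[OF N] quotient_smult_coset[OF N]
  have zero: "\<zero>\<^bsub>?Q\<^esub> = N +>\<^bsub>M\<^esub> \<zero>\<^bsub>M\<^esub>"
    using M.a_coset_add_zero[OF N.a_subset] by (simp add: quotient_module_simps)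
  have "abelian_group ?Q"
  proof (rule abelian_groupI)
    fix A assume "A \<in> carrier ?Q"
    then obtain x where x: "x \<in> carrier M" "A = N +>\<^bsub>M\<^esub> x" by (auto simp: carrier_quotient)
    show "\<exists>B\<in>carrier ?Q. B \<oplus>\<^bsub>?Q\<^esub> A = \<zero>\<^bsub>?Q\<^esub>"
      using x by (intro bexI[of _ "N +>\<^bsub>M\<^esub> (\<ominus>\<^bsub>M\<^esub> x)"]) (auto simp: zero carrier_quotient M.l_neg)
  qed (auto simp: carrier_quotient zero M.a_ac)
  then show ?thesis
    by (intro moduleI) (auto simp: carrier_quotient smult_l_distr smult_r_distr smult_assoc1 R.is_cring)
qed

lemma (in module) quotient_minus_coset:
  assumes N: "submodule N R M" and x: "x \<in> carrier M" and y: "y \<in> carrier M"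
  shows "(N +>\<^bsub>M\<^esub> x) \<ominus>\<^bsub>quotient_module M N\<^esub> (N +>\<^bsub>M\<^esub> y) = N +>\<^bsub>M\<^esub> (x \<ominus>\<^bsub>M\<^esub> y)"
proof -
  interpret N: abelian_subgroup N M by (rule abelian_subgroup_of_submodule[OF N])
  let ?Q = "quotient_module M N"
  interpret Q: module R ?Q by (rule module_quotient[OF N])
  have zero: "\<zero>\<^bsub>?Q\<^esub> = N +>\<^bsub>M\<^esub> \<zero>\<^bsub>M\<^esub>"
    using M.a_coset_add_zero[OF N.a_subset] by (simp add: quotient_module_simps)
  have "\<ominus>\<^bsub>?Q\<^esub> (N +>\<^bsub>M\<^esub> y) = N +>\<^bsub>M\<^esub> (\<ominus>\<^bsub>M\<^esub> y)"
    by (rule Q.M.minus_equality)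
       (use y in \<open>auto simp: carrier_quotient quotient_add_coset[OF N] zero M.l_neg\<close>)
  then show ?thesis
    using x y by (simp add: a_minus_def quotient_add_coset[OF N])
qed

lemma IDA_module_simps [simp]:
  "carrier (IDA_module s q) = IDA s q" "zero (IDA_module s q) = (\<lambda>z. 0)"
  "add (IDA_module s q) f g = (\<lambda>z. f z + g z)" "smult (IDA_module s q) c f = (\<lambda>z. c * f z)"
  by (simp_all add: IDA_module_def)

lemma ring_of_complex_simps [simp]:
  "carrier (ring_of_type_algebra :: complex ring) = UNIV" "one (ring_of_type_algebra :: complex ring) = 1"
  "add (ring_of_type_algebra :: complex ring) a b = a + b" "mult (ring_of_type_algebra :: complex ring) a b = a * b"
  by (simp_all add: ring_of_type_algebra_def)

lemma zero_in_entire_ae: "(\<lambda>z. 0) \<in> entire_ae"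
  by (simp add: entire_ae_eq holomorphic_funs_imp_ae_holomorphic holomorphic_funs_const)

lemma module_IDA:
  assumes s: "1 \<le> s" and q: "1 \<le> q"
  shows "module (ring_of_type_algebra :: complex ring) (IDA_module s q :: (complex, complex ^ 'n \<Rightarrow> complex) module)"
proof -
  let ?M = "IDA_module s q :: (complex, complex ^ 'n \<Rightarrow> complex) module"
  have "abelian_group ?M"
  proof (rule abelian_groupI)
    fix f assume "f \<in> carrier ?M"
    then show "\<exists>g\<in>carrier ?M. g \<oplus>\<^bsub>?M\<^esub> f = \<zero>\<^bsub>?M\<^esub>"
      using IDA_cmult[OF s q, of f "-1"] by (intro bexI[of _ "\<lambda>z. - 1 * f z"]) auto
  next
    show "\<zero>\<^bsub>?M\<^esub> \<in> carrier ?M"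
      using zero_in_entire_ae entire_ae_subset_IDA[OF q] by auto
  qed (auto simp: IDA_add[OF s q] algebra_simps)
  then show ?thesis
    by (intro moduleI) (auto simp: cring_from_type_algebra IDA_cmult[OF s q] algebra_simps)
qed

lemma submodule_entire_ae:
  assumes s: "1 \<le> s" and q: "1 \<le> q"
  shows "submodule entire_ae (ring_of_type_algebra :: complex ring) (IDA_module s q :: (complex, complex ^ 'n \<Rightarrow> complex) module)"
proof -
  let ?M = "IDA_module s q :: (complex, complex ^ 'n \<Rightarrow> complex) module"
  interpret M: module "ring_of_type_algebra :: complex ring" ?M by (rule module_IDA[OF s q])
  have neg: "\<ominus>\<^bsub>?M\<^esub> f = (\<lambda>z. - f z)" if "f \<in> IDA s q" for f
    by (rule M.M.minus_equality) (use that IDA_cmult[OF s q that, of "-1"] in auto)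
  show ?thesis
  proof (rule M.submoduleI)
    show "entire_ae \<subseteq> carrier ?M" using entire_ae_subset_IDA[OF q] by simp
    show "\<zero>\<^bsub>?M\<^esub> \<in> entire_ae" by (simp add: zero_in_entire_ae)
    fix f :: "complex ^ 'n \<Rightarrow> complex" assume f: "f \<in> entire_ae"
    then show "\<ominus>\<^bsub>?M\<^esub> f \<in> entire_ae"
      using ae_holomorphic_cmult[of f UNIV "-1"] entire_ae_subset_IDA[OF q, of s] by (auto simp: neg entire_ae_eq)
    fix g :: "complex ^ 'n \<Rightarrow> complex" assume "g \<in> entire_ae"
    with f show "f \<oplus>\<^bsub>?M\<^esub> g \<in> entire_ae" by (simp add: entire_ae_eq ae_holomorphic_add)
  next
    fix c and f :: "complex ^ 'n \<Rightarrow> complex" assume "f \<in> entire_ae"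
    then show "c \<odot>\<^bsub>?M\<^esub> f \<in> entire_ae" by (simp add: entire_ae_eq ae_holomorphic_cmult)
  qed
qed

text \<open>The operation on the left is derived from the module structure, as the sum with the additive inverse.\<close>

lemma IDA_minus:
  assumes s: "1 \<le> s" and q: "1 \<le> q" and f: "f \<in> IDA s q" and g: "g \<in> IDA s q"
  shows "f \<ominus>\<^bsub>IDA_module s q\<^esub> g = (\<lambda>z. f z - g z)"
proof -
  interpret M: module "ring_of_type_algebra :: complex ring" "IDA_module s q" by (rule module_IDA[OF s q])
  have "\<ominus>\<^bsub>IDA_module s q\<^esub> g = (\<lambda>z. - g z)"
    by (rule M.M.minus_equality) (use g IDA_cmult[OF s q g, of "-1"] in auto)
  then show ?thesis by (simp add: a_minus_def)
qed

lemma ennreal_ida_norm: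
  assumes "f \<in> IDA s q" shows "ennreal (ida_norm s q f) = ida_enorm s q f"
  using assms by (simp add: ida_norm_def IDA_iff)

lemma ida_norm_triangle:
  assumes s: "1 \<le> s" and q: "1 \<le> q" and f: "f \<in> IDA s q" and g: "g \<in> IDA s q"
  shows "ida_norm s q (\<lambda>z. f z + g z) \<le> ida_norm s q f + ida_norm s q g"
proof -
  have "ennreal (ida_norm s q (\<lambda>z. f z + g z)) \<le> ennreal (ida_norm s q f + ida_norm s q g)"
    using ida_enorm_add[OF s q, of f g] f g IDA_add[OF s q f g]
    by (simp add: ennreal_ida_norm ida_norm_def IDA_iff)
  then show ?thesis by (subst (asm) ennreal_le_iff) (simp_all add: ida_norm_def)
qed

lemma ida_norm_cmult:
  assumes "1 \<le> s" "1 \<le> q" "f \<in> IDA s q"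
  shows "ida_norm s q (\<lambda>z. c * f z) = cmod c * ida_norm s q f"
  using assms by (simp add: ida_norm_def ida_enorm_cmult IDA_iff enn2real_mult)

lemma ida_norm_eq_0_iff:
  assumes "1 \<le> s" "1 \<le> q" "f \<in> IDA s q"
  shows "ida_norm s q f = 0 \<longleftrightarrow> f \<in> entire_ae"
  using assms ida_enorm_eq_0_iff[of s q f] by (auto simp: ida_norm_def enn2real_eq_0_iff IDA_iff)

lemma ida_norm_add_entire:
  assumes s: "1 \<le> s" and q: "1 \<le> q" and f: "f \<in> IDA s q" and e: "e \<in> entire_ae"
  shows "ida_norm s q (\<lambda>z. e z + f z) = ida_norm s q f"
proof (rule antisym)
  have eI: "e \<in> IDA s q" using e entire_ae_subset_IDA[OF q] by blast
  have e0: "ida_norm s q e = 0" using ida_norm_eq_0_iff[OF s q eI] e by simp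
  show "ida_norm s q (\<lambda>z. e z + f z) \<le> ida_norm s q f"
    using ida_norm_triangle[OF s q eI f] e0 by simp
  have "ida_norm s q (\<lambda>z. - 1 * e z + (e z + f z)) \<le> ida_norm s q (\<lambda>z. - 1 * e z) + ida_norm s q (\<lambda>z. e z + f z)"
    by (rule ida_norm_triangle[OF s q IDA_cmult[OF s q eI] IDA_add[OF s q eI f]])
  then show "ida_norm s q f \<le> ida_norm s q (\<lambda>z. e z + f z)"
    using e0 ida_norm_cmult[OF s q eI, of "-1"] by simp
qed

lemma ida_quotient_norm_coset:
  assumes s: "1 \<le> s" and q: "1 \<le> q" and f: "f \<in> IDA s q"
  shows "ida_quotient_norm s q (entire_ae +>\<^bsub>IDA_module s q\<^esub> f) = ida_norm s q f"
proof -
  have "ida_norm s q ` (entire_ae +>\<^bsub>IDA_module s q\<^esub> f) = {ida_norm s q f}"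
    using zero_in_entire_ae ida_norm_add_entire[OF s q f] by (force simp: a_r_coset_def')
  then show ?thesis by (simp add: ida_quotient_norm_def)
qed

text \<open>Adding up the thresholds makes the chosen indices strictly increasing.\<close>

lemma (in Metric_space) MCauchy_fast_subsequence:
  assumes "MCauchy \<sigma>"
  shows "\<exists>r. strict_mono r \<and> (\<forall>k. d (\<sigma> (r (Suc k))) (\<sigma> (r k)) \<le> (1 / 2) ^ k)"
proof -
  have "\<forall>k::nat. \<exists>N. \<forall>n n'. N \<le> n \<longrightarrow> N \<le> n' \<longrightarrow> d (\<sigma> n) (\<sigma> n') < (1 / 2) ^ k"
    using assms by (simp add: MCauchy_def)
  from choice[OF this] obtain N where N: "\<And>k n n'. N k \<le> n \<Longrightarrow> N k \<le> n' \<Longrightarrow> d (\<sigma> n) (\<sigma> n') < (1 / 2) ^ k"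
    by blast
  \<comment> \<open>The summand \<open>k\<close> gives strictness.\<close>
  define r where "r k = k + (\<Sum>i\<le>k. N i)" for k
  have "strict_mono r" by (simp add: strict_mono_Suc_iff r_def)
  moreover have "N k \<le> r k" "N k \<le> r (Suc k)" for k
    using member_le_sum[of k "{..k}" N] by (simp_all add: r_def)
  then have "d (\<sigma> (r (Suc k))) (\<sigma> (r k)) \<le> (1 / 2) ^ k" for k
    using N by (simp add: less_imp_le)
  ultimately show ?thesis by blast
qed

lemma complex_normed_space_IDA_quotient:
  assumes s: "1 \<le> s" and q: "1 \<le> q"
  shows "complex_normed_space
    (IDA_quotient s q :: (complex, (complex ^ 'n \<Rightarrow> complex) set) module) (ida_quotient_norm s q)"
proof -
  let ?R = "ring_of_type_algebra :: complex ring"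
  let ?M = "IDA_module s q :: (complex, complex ^ 'n \<Rightarrow> complex) module"
  let ?N = "entire_ae :: (complex ^ 'n \<Rightarrow> complex) set"
  let ?Q = "IDA_quotient s q :: (complex, (complex ^ 'n \<Rightarrow> complex) set) module"
  let ?\<nu> = "ida_quotient_norm s q :: (complex ^ 'n \<Rightarrow> complex) set \<Rightarrow> real"
  interpret M: module ?R ?M by (rule module_IDA[OF s q])
  have N: "submodule ?N ?R ?M" by (rule submodule_entire_ae[OF s q])
  interpret N: abelian_subgroup ?N ?M by (rule M.abelian_subgroup_of_submodule[OF N])
  interpret Q: module ?R ?Q unfolding IDA_quotient_def by (rule M.module_quotient[OF N])
  note norm = ida_quotient_norm_coset[OF s q]
  have ex: "\<exists>f\<in>IDA s q. A = ?N +>\<^bsub>?M\<^esub> f" if "A \<in> carrier ?Q" for A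
    using that by (auto simp: IDA_quotient_def M.carrier_quotient)
  show ?thesis
  proof (intro complex_normed_space.intro complex_normed_space_axioms.intro Q.module_axioms)
    fix A assume "A \<in> carrier ?Q"
    then obtain f where f: "f \<in> IDA s q" and A: "A = ?N +>\<^bsub>?M\<^esub> f" using ex by blast
    show "0 \<le> ?\<nu> A" using f by (simp add: A norm ida_norm_def)
    show "?\<nu> A = 0 \<longleftrightarrow> A = \<zero>\<^bsub>?Q\<^esub>"
    proof -
      have "A = ?N \<longleftrightarrow> f \<in> ?N"
        using f unfolding A by (metis IDA_module_simps(1) M.a_coset_join2 N.a_rcos_self N.a_subgroup)
      then show ?thesis
        using f by (simp add: A norm ida_norm_eq_0_iff[OF s q] IDA_quotient_def quotient_module_simps)
    qed
    show "?\<nu> (c \<odot>\<^bsub>?Q\<^esub> A) = cmod c * ?\<nu> A" for c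
      using f by (simp add: A norm IDA_quotient_def M.quotient_smult_coset[OF N] ida_norm_cmult[OF s q] IDA_cmult[OF s q])
    fix B assume "B \<in> carrier ?Q"
    then obtain g where g: "g \<in> IDA s q" and B: "B = ?N +>\<^bsub>?M\<^esub> g" using ex by blast
    show "?\<nu> (A \<oplus>\<^bsub>?Q\<^esub> B) \<le> ?\<nu> A + ?\<nu> B"
      using f g by (simp add: A B norm IDA_quotient_def M.quotient_add_coset[OF N] ida_norm_triangle[OF s q] IDA_add[OF s q])
  qed
qed

theorem theorem3p12:
  fixes s q :: real
  assumes "1 \<le> s" and "1 \<le> q"
  shows "complex_banach_space
           (IDA_quotient s q :: (complex, (complex ^ 'n \<Rightarrow> complex) set) module)
           (ida_quotient_norm s q)
       \<and> (\<forall>f \<in> (IDA s q :: (complex ^ 'n \<Rightarrow> complex) set).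
            ida_quotient_norm s q (entire_ae +>\<^bsub>IDA_module s q\<^esub> f) = ida_norm s q f)"
proof (intro conjI ballI)
  note s = assms(1) and q = assms(2)
  show "ida_quotient_norm s q (entire_ae +>\<^bsub>IDA_module s q\<^esub> f) = ida_norm s q f"
    if "f \<in> IDA s q" for f :: "complex ^ 'n \<Rightarrow> complex"
    by (rule ida_quotient_norm_coset[OF s q that])
  let ?R = "ring_of_type_algebra :: complex ring"
  let ?M = "IDA_module s q :: (complex, complex ^ 'n \<Rightarrow> complex) module"
  let ?N = "entire_ae :: (complex ^ 'n \<Rightarrow> complex) set"
  let ?Q = "IDA_quotient s q :: (complex, (complex ^ 'n \<Rightarrow> complex) set) module"
  let ?\<nu> = "ida_quotient_norm s q :: (complex ^ 'n \<Rightarrow> complex) set \<Rightarrow> real"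
  interpret M: module ?R ?M by (rule module_IDA[OF s q])
  have N: "submodule ?N ?R ?M" by (rule submodule_entire_ae[OF s q])
  interpret Q: complex_normed_space ?Q ?\<nu> by (rule complex_normed_space_IDA_quotient[OF s q])
  interpret D: Metric_space "carrier ?Q" "norm_dist ?Q ?\<nu>" by (rule Q.Metric_space_norm_dist)
  have carrier: "carrier ?Q = (\<lambda>f. ?N +>\<^bsub>?M\<^esub> f) ` IDA s q"
    by (simp add: IDA_quotient_def M.carrier_quotient)
  have dist: "norm_dist ?Q ?\<nu> (?N +>\<^bsub>?M\<^esub> f) (?N +>\<^bsub>?M\<^esub> g) = ida_norm s q (\<lambda>z. f z - g z)"
    if f: "f \<in> IDA s q" and g: "g \<in> IDA s q" for f g
  proof -
    have "(?N +>\<^bsub>?M\<^esub> f) \<ominus>\<^bsub>?Q\<^esub> (?N +>\<^bsub>?M\<^esub> g) = ?N +>\<^bsub>?M\<^esub> (\<lambda>z. f z - g z)"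
      using M.quotient_minus_coset[OF N, of f g] f g by (simp add: IDA_quotient_def IDA_minus[OF s q])
    then show ?thesis
      using f g by (simp add: norm_dist_def carrier ida_quotient_norm_coset[OF s q IDA_diff[OF s q]])
  qed
  show "complex_banach_space ?Q ?\<nu>"
  proof (intro complex_banach_space.intro complex_banach_space_axioms.intro Q.complex_normed_space_axioms)
    show "D.mcomplete"
      unfolding D.mcomplete_def
    proof (intro allI impI)
      fix \<sigma> assume \<sigma>: "D.MCauchy \<sigma>"
      obtain r where r: "strict_mono r" and fast: "\<And>k. norm_dist ?Q ?\<nu> (\<sigma> (r (Suc k))) (\<sigma> (r k)) \<le> (1 / 2) ^ k"
        using D.MCauchy_fast_subsequence[OF \<sigma>] by blast
      have "\<forall>k. \<exists>f. f \<in> IDA s q \<and> \<sigma> (r k) = ?N +>\<^bsub>?M\<^esub> f"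
      proof
        fix k
        have "\<sigma> (r k) \<in> carrier ?Q" using \<sigma> unfolding D.MCauchy_def by blast
        then show "\<exists>f. f \<in> IDA s q \<and> \<sigma> (r k) = ?N +>\<^bsub>?M\<^esub> f" unfolding carrier by blast
      qed
      from choice[OF this] obtain f where f: "\<And>k. f k \<in> IDA s q" and \<sigma>f: "\<And>k. \<sigma> (r k) = ?N +>\<^bsub>?M\<^esub> f k" by blast
      have "ida_enorm s q (\<lambda>w. f (Suc k) w - f k w) \<le> ennreal ((1 / 2) ^ k)" for k
      proof -
        have "ida_norm s q (\<lambda>w. f (Suc k) w - f k w) \<le> (1 / 2) ^ k"
          using fast[of k] by (simp only: \<sigma>f dist[OF f f])
        then show ?thesis
          unfolding ennreal_ida_norm[OF IDA_diff[OF s q f f], symmetric] by (rule ennreal_leI)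
      qed
      from IDA_rapid_Cauchy_converges[OF s q f this] obtain F where F: "F \<in> IDA s q"
        and lim: "\<And>k. ida_enorm s q (\<lambda>w. F w - f k w) \<le> ennreal (4 * (1 / 2) ^ k)" by blast
      have bound: "norm_dist ?Q ?\<nu> (\<sigma> (r k)) (?N +>\<^bsub>?M\<^esub> F) \<le> 4 * (1 / 2) ^ k" for k
      proof -
        have "ida_norm s q (\<lambda>w. F w - f k w) \<le> 4 * (1 / 2) ^ k"
          using lim[of k] unfolding ennreal_ida_norm[OF IDA_diff[OF s q F f], symmetric]
          by (subst (asm) ennreal_le_iff) simp_all
        then show ?thesis by (simp only: \<sigma>f D.commute dist[OF F f])
      qed
      have "limitin D.mtopology (\<sigma> \<circ> r) (?N +>\<^bsub>?M\<^esub> F) sequentially"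
        unfolding D.limitin_metric
      proof (intro conjI allI impI)
        show "?N +>\<^bsub>?M\<^esub> F \<in> carrier ?Q" using F by (simp add: carrier)
        fix e :: real assume "0 < e"
        have "(\<lambda>k. 4 * (1 / 2) ^ k) \<longlonglongrightarrow> (4 * 0 :: real)"
          by (intro tendsto_intros LIMSEQ_realpow_zero) auto
        then have "\<forall>\<^sub>F k in sequentially. 4 * (1 / 2) ^ k < e"
          using \<open>0 < e\<close> by (intro order_tendstoD) auto
        then show "\<forall>\<^sub>F k in sequentially. (\<sigma> \<circ> r) k \<in> carrier ?Q \<and> norm_dist ?Q ?\<nu> ((\<sigma> \<circ> r) k) (?N +>\<^bsub>?M\<^esub> F) < e"
        proof eventually_elim
          case (elim k)
          have "\<sigma> (r k) \<in> carrier ?Q" using f[of k] by (simp add: \<sigma>f carrier)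
          with bound[of k] elim show ?case by simp
        qed
      qed
      from D.MCauchy_convergent_subsequence[OF \<sigma> r this]
      show "\<exists>x. limitin D.mtopology \<sigma> x sequentially" by blast
    qed
  qed
qed

end
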